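(* Let $S$ be an infinite one-sided subshift. Then $C^*_r(\Gamma_S)$ is simple if and only if the following holds: For every non-empty generalized cylinder $C(u;F)$ there is an $m\in\mathbb N$ with the property that for all $x\in S$ there is an element $y\in C(u;F)$ and a $k\in\{0,1,2,\dots,m\}$ such that $x_i=y_{i+k}$ for all $i\ge1$.
   Context: Subshifts. Let $A=\{1,\dots,n\}$, $A^{\mathbb N}=\{(x_1,x_2,\dots):x_i\in A\}$ with the product topology, and $\sigma(x)_i=x_{i+1}$. A one-sided subshift is a closed set $S\subseteq A^{\mathbb N}$ with $\sigma(S)=S$. $\mathbb W(S)$ is the set of finite words occurring in elements of $S$, $|u|$ is the length of $u$, and $C(u)=\{x\in S:x_1x_2\cdots x_{|u|}=u\}$. Given $u\in\mathbb W(S)$ and a finite set $F\subseteq\mathbb W(S)$ of words of the same length as $u$, the generalized cylinder $C(u;F)$ is the set of $x\in C(u)$ such that for every $v\in F$ there is $y^v\in C(v)$ with $y^v_{|v|+i}=x_{|u|+i}$ for all $i\ge1$. The groupoid $\Gamma_S$. Here $\mathbb N=\{0,1,2,\dots\}$. $\sigma:S\to S$ is continuous and locally injective. $\Gamma_S=\{(x,k,y)\in S\times\mathbb Z\times S:\exists a,b\in\mathbb N,\ k=a-b,\ \sigma^a(x)=\sigma^b(y)\}$ with product $(x,k,y)(y,k',y')=(x,k+k',y')$ and inverse $(x,k,y)^{-1}=(y,-k,x)$. For $k\in\mathbb Z$, $n\in\mathbb N$, $n+k\ge0$, let $\Gamma_S(k,n)=\{(x,k,y):\sigma^{k+i}(x)=\sigma^i(y)\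 \forall i\ge n\}$ with the relative topology from $S\times\mathbb Z\times S$; it is open in $\Gamma_S(k,n+1)$. $\Gamma_S(k)=\bigcup_n\Gamma_S(k,n)$ has the inductive limit topology and $\Gamma_S=\bigsqcup_k\Gamma_S(k)$ has the topology in which each $\Gamma_S(k)$ is open and closed. This is a locally compact Hausdorff groupoid with locally injective range map; its unit space is $S$ via $x\mapsto(x,0,x)$. The groupoid $C^*$-algebra. For a locally compact Hausdorff groupoid $G$ with locally injective range map $r$ (source map $s$, unit space $G^0$), $B_c(G)$ is the $*$-algebra of bounded compactly supported (not necessarily continuous) functions $G\to\mathbb C$ with product $(f\star g)(\gamma)=\sum_{\gamma_1\gamma_2=\gamma}f(\gamma_1)g(\gamma_2)$ and involution $f^*(\gamma)=\overline{f(\gamma^{-1})}$. For $x\in G^0$, $\pi_x$ is the representation on $l^2(s^{-1}(x))$ with $(\pi_x(f)\psi)(\gamma)=\sum_{\gamma_1\gamma_2=\gamma}f(\gamma_1)\psi(\gamma_2)$. $B^*_r(G)$ is the completion of $B_c(G)$ in $\|f\|=\sup_x\|\pi_x(f)\|$, and $C^*_r(G)$ is the $C^*$-subalgebra of $B^*_r(G)$ generated by the continuous compactly supported functions $C_c(G)$. *)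

theory Defs
  imports "HOL-Analysis.Analysis"
begin

section \<open>One-sided subshifts\<close>

text \<open>A sequence $(x_1,x_2,\dots)$ is represented by the function \<open>x\<close> with \<open>x 0\<close> $= x_1$,
  \<open>x 1\<close> $= x_2$, and so on. The type \<^typ>\<open>nat \<Rightarrow> nat\<close> carries the product topology of the discrete
  topology; the full shift is a closed subset of it, so that being closed in the full shift and
  being closed in the type are the same.\<close>

definition shift :: "(nat \<Rightarrow> 'a) \<Rightarrow> nat \<Rightarrow> 'a" where
  "shift x = (\<lambda>i. x (i + 1))"

definition full_shift :: "nat \<Rightarrow> (nat \<Rightarrow> nat) set" where
  "full_shift n = {x. \<forall>i. x i \<in> {1..n}}"

definition one_sided_subshift :: "nat \<Rightarrow> (nat \<Rightarrow> nat) set \<Rightarrow> bool" where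
  "one_sided_subshift n S \<longleftrightarrow> S \<subseteq> full_shift n \<and> closed S \<and> shift ` S = S"

definition subshift_words :: "(nat \<Rightarrow> nat) set \<Rightarrow> nat list set" where
  "subshift_words S = {u. \<exists>x\<in>S. \<exists>j. \<forall>i<length u. u ! i = x (j + i)}"

definition cylinder :: "(nat \<Rightarrow> nat) set \<Rightarrow> nat list \<Rightarrow> (nat \<Rightarrow> nat) set" where
  "cylinder S u = {x\<in>S. \<forall>i<length u. x i = u ! i}"

definition generalized_cylinder ::
    "(nat \<Rightarrow> nat) set \<Rightarrow> nat list \<Rightarrow> nat list set \<Rightarrow> (nat \<Rightarrow> nat) set" where
  "generalized_cylinder S u F =
     {x \<in> cylinder S u. \<forall>v\<in>F. \<exists>y\<in>cylinder S v. \<forall>i. y (length v + i) = x (length u + i)}"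


section \<open>Topological groupoids\<close>

text \<open>The underlying set of a groupoid is the \<^const>\<open>topspace\<close> of its topology. Source and range
  are derived as $s(\gamma)=\gamma^{-1}\gamma$ and $r(\gamma)=\gamma\gamma^{-1}$, so units are
  themselves arrows; \<open>gmult \<gamma>1 \<gamma>2\<close> is meaningful only if $s(\gamma_1)=r(\gamma_2)$.\<close>

record 'g groupoid =
  gtop :: "'g topology"
  gmult :: "'g \<Rightarrow> 'g \<Rightarrow> 'g"
  ginv :: "'g \<Rightarrow> 'g"

definition gsrc :: "'g groupoid \<Rightarrow> 'g \<Rightarrow> 'g" where
  "gsrc G \<gamma> = gmult G (ginv G \<gamma>) \<gamma>"

definition grng :: "'g groupoid \<Rightarrow> 'g \<Rightarrow> 'g" where
  "grng G \<gamma> = gmult G \<gamma> (ginv G \<gamma>)"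

definition gunits :: "'g groupoid \<Rightarrow> 'g set" where
  "gunits G = gsrc G ` topspace (gtop G)"

definition gfactorizations :: "'g groupoid \<Rightarrow> 'g \<Rightarrow> ('g \<times> 'g) set" where
  "gfactorizations G \<gamma> =
     {(\<gamma>1, \<gamma>2). \<gamma>1 \<in> topspace (gtop G) \<and> \<gamma>2 \<in> topspace (gtop G) \<and>
        gsrc G \<gamma>1 = grng G \<gamma>2 \<and> gmult G \<gamma>1 \<gamma>2 = \<gamma>}"

definition gsrc_fibre :: "'g groupoid \<Rightarrow> 'g \<Rightarrow> 'g set" where
  "gsrc_fibre G x = {\<gamma> \<in> topspace (gtop G). gsrc G \<gamma> = x}"


section \<open>The groupoid of a subshift\<close>

text \<open>The final topology of the inclusions of the spaces \<open>X i\<close> into their union. For an increasing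
  sequence it is the inductive limit topology, for pairwise disjoint spaces it is the topology of
  the disjoint union, in which every \<open>X i\<close> is open and closed.\<close>

definition union_topology :: "'i set \<Rightarrow> ('i \<Rightarrow> 'a topology) \<Rightarrow> 'a topology" where
  "union_topology I X =
     topology (\<lambda>U. U \<subseteq> (\<Union>i\<in>I. topspace (X i)) \<and>
                   (\<forall>i\<in>I. openin (X i) (U \<inter> topspace (X i))))"

lemma openin_union_topology:
  "openin (union_topology I X) U \<longleftrightarrow>
     U \<subseteq> (\<Union>i\<in>I. topspace (X i)) \<and> (\<forall>i\<in>I. openin (X i) (U \<inter> topspace (X i)))"
proof -
  have "istopology (\<lambda>U. U \<subseteq> (\<Union>i\<in>I. topspace (X i)) \<and>
                   (\<forall>i\<in>I. openin (X i) (U \<inter> topspace (X i))))"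
    unfolding istopology_def
  proof (intro conjI allI impI)
    fix S T assume S: "S \<subseteq> (\<Union>i\<in>I. topspace (X i)) \<and> (\<forall>i\<in>I. openin (X i) (S \<inter> topspace (X i)))"
      and T: "T \<subseteq> (\<Union>i\<in>I. topspace (X i)) \<and> (\<forall>i\<in>I. openin (X i) (T \<inter> topspace (X i)))"
    show "S \<inter> T \<subseteq> (\<Union>i\<in>I. topspace (X i))" by (rule le_infI1) (rule conjunct1[OF S])
    show "\<forall>i\<in>I. openin (X i) (S \<inter> T \<inter> topspace (X i))"
    proof
      fix i assume i: "i \<in> I"
      have eq: "S \<inter> T \<inter> topspace (X i) = (S \<inter> topspace (X i)) \<inter> (T \<inter> topspace (X i))"
        by blast
      show "openin (X i) (S \<inter> T \<inter> topspace (X i))"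
        unfolding eq by (rule openin_Int) (use S T i in simp_all)
    qed
  next
    fix K assume K: "\<forall>U\<in>K. U \<subseteq> (\<Union>i\<in>I. topspace (X i)) \<and>
                   (\<forall>i\<in>I. openin (X i) (U \<inter> topspace (X i)))"
    show "\<Union> K \<subseteq> (\<Union>i\<in>I. topspace (X i))" by (rule Union_least) (use K in simp)
    show "\<forall>i\<in>I. openin (X i) (\<Union> K \<inter> topspace (X i))"
    proof
      fix i assume i: "i \<in> I"
      have eq: "\<Union> K \<inter> topspace (X i) = (\<Union>U\<in>K. U \<inter> topspace (X i))"
        by blast
      show "openin (X i) (\<Union> K \<inter> topspace (X i))"
        unfolding eq by (rule openin_Union) (use K i in auto)
    qed
  qed
  then show ?thesis
    unfolding union_topology_def by (simp add: topology_inverse')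
qed

lemma topspace_union_topology: "topspace (union_topology I X) = (\<Union>i\<in>I. topspace (X i))"
proof
  show "topspace (union_topology I X) \<subseteq> (\<Union>i\<in>I. topspace (X i))"
    using iffD1[OF openin_union_topology openin_topspace] by (rule conjunct1)
  have "(\<Union>i\<in>I. topspace (X i)) \<inter> topspace (X i) = topspace (X i)" if "i \<in> I" for i
    using that by blast
  then have "openin (union_topology I X) (\<Union>i\<in>I. topspace (X i))"
    by (simp add: openin_union_topology)
  then show "(\<Union>i\<in>I. topspace (X i)) \<subseteq> topspace (union_topology I X)"
    by (rule openin_subset)
qed

type_synonym arrow = "(nat \<Rightarrow> nat) \<times> int \<times> (nat \<Rightarrow> nat)"

text \<open>$\Gamma_S(k,n)$; used only for $n + k \ge 0$, in which case \<^term>\<open>nat (k + int i)\<close> does not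
  truncate.\<close>

definition subshift_arrows_level :: "(nat \<Rightarrow> nat) set \<Rightarrow> int \<Rightarrow> nat \<Rightarrow> arrow set" where
  "subshift_arrows_level S k n =
     {(x, l, y). x \<in> S \<and> y \<in> S \<and> l = k \<and>
        (\<forall>i\<ge>n. (shift ^^ nat (k + int i)) x = (shift ^^ i) y)}"

definition subshift_topology_degree :: "(nat \<Rightarrow> nat) set \<Rightarrow> int \<Rightarrow> arrow topology" where
  "subshift_topology_degree S k =
     union_topology {n. int n + k \<ge> 0} (\<lambda>n. top_of_set (subshift_arrows_level S k n))"

definition subshift_groupoid :: "(nat \<Rightarrow> nat) set \<Rightarrow> arrow groupoid" where
  "subshift_groupoid S =
     \<lparr> gtop = union_topology UNIV (subshift_topology_degree S),
       gmult = (\<lambda>(x, k, y) (y', k', z). (x, k + k', z)),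
       ginv = (\<lambda>(x, k, y). (y, - k, x)) \<rparr>"

lemma topspace_subshift_groupoid:
  "topspace (gtop (subshift_groupoid S)) =
     {(x, k, y). x \<in> S \<and> y \<in> S \<and>
        (\<exists>a b. k = int a - int b \<and> (shift ^^ a) x = (shift ^^ b) y)}"
proof -
  have *: "(\<exists>n. int n + k \<ge> 0 \<and> (\<forall>i\<ge>n. (shift ^^ nat (k + int i)) x = (shift ^^ i) y)) \<longleftrightarrow>
      (\<exists>a b. k = int a - int b \<and> (shift ^^ a) x = (shift ^^ b) y)"
    for k and x y :: "nat \<Rightarrow> nat"
  proof
    assume "\<exists>n. int n + k \<ge> 0 \<and> (\<forall>i\<ge>n. (shift ^^ nat (k + int i)) x = (shift ^^ i) y)"
    then obtain n where "int n + k \<ge> 0" "(shift ^^ nat (k + int n)) x = (shift ^^ n) y"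
      by blast
    then show "\<exists>a b. k = int a - int b \<and> (shift ^^ a) x = (shift ^^ b) y"
      by (intro exI[of _ "nat (k + int n)"] exI[of _ n]) auto
  next
    assume "\<exists>a b. k = int a - int b \<and> (shift ^^ a) x = (shift ^^ b) y"
    then obtain a b where ab: "k = int a - int b" "(shift ^^ a) x = (shift ^^ b) y" by blast
    have "(shift ^^ nat (k + int i)) x = (shift ^^ i) y" if "i \<ge> b" for i
    proof -
      have "nat (k + int i) = (i - b) + a" using ab(1) that by simp
      then have "(shift ^^ nat (k + int i)) x = (shift ^^ (i - b)) ((shift ^^ a) x)"
        by (simp only: funpow_add o_apply)
      also have "\<dots> = (shift ^^ (i - b)) ((shift ^^ b) y)" by (simp only: ab(2))
      also have "\<dots> = (shift ^^ (i - b + b)) y" by (simp only: funpow_add o_apply)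
      finally show ?thesis using that by simp
    qed
    then show "\<exists>n. int n + k \<ge> 0 \<and> (\<forall>i\<ge>n. (shift ^^ nat (k + int i)) x = (shift ^^ i) y)"
      using ab(1) by (intro exI[of _ b]) auto
  qed
  show ?thesis
  proof (rule set_eqI)
    fix g :: arrow
    obtain x k y where g: "g = (x, k, y)" by (cases g) auto
    have "g \<in> topspace (gtop (subshift_groupoid S)) \<longleftrightarrow> x \<in> S \<and> y \<in> S \<and>
        (\<exists>n. int n + k \<ge> 0 \<and> (\<forall>i\<ge>n. (shift ^^ nat (k + int i)) x = (shift ^^ i) y))"
      unfolding g subshift_groupoid_def subshift_topology_degree_def groupoid.simps
        topspace_union_topology topspace_euclidean_subtopology subshift_arrows_level_def
      by blast
    then show "g \<in> topspace (gtop (subshift_groupoid S)) \<longleftrightarrow>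
        g \<in> {(x, k, y). x \<in> S \<and> y \<in> S \<and>
          (\<exists>a b. k = int a - int b \<and> (shift ^^ a) x = (shift ^^ b) y)}"
      unfolding * g by simp
  qed
qed


section \<open>Normed \<open>*\<close>-algebras\<close>

text \<open>Complex, not necessarily unital.\<close>

record 'a star_algebra =
  acarrier :: "'a set"
  azero :: "'a"
  aplus :: "'a \<Rightarrow> 'a \<Rightarrow> 'a"
  ascale :: "complex \<Rightarrow> 'a \<Rightarrow> 'a"
  atimes :: "'a \<Rightarrow> 'a \<Rightarrow> 'a"
  astar :: "'a \<Rightarrow> 'a"
  anorm :: "'a \<Rightarrow> real"

definition adist :: "'a star_algebra \<Rightarrow> 'a \<Rightarrow> 'a \<Rightarrow> real" where
  "adist A a b = anorm A (aplus A a (ascale A (- 1) b))"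

definition anorm_closed :: "'a star_algebra \<Rightarrow> 'a set \<Rightarrow> bool" where
  "anorm_closed A B \<longleftrightarrow>
     (\<forall>f a. range f \<subseteq> B \<and> a \<in> acarrier A \<and> (\<lambda>n. adist A (f n) a) \<longlonglongrightarrow> 0 \<longrightarrow> a \<in> B)"

definition linear_subspace :: "'a star_algebra \<Rightarrow> 'a set \<Rightarrow> bool" where
  "linear_subspace A B \<longleftrightarrow>
     B \<subseteq> acarrier A \<and> azero A \<in> B \<and>
     (\<forall>a\<in>B. \<forall>b\<in>B. aplus A a b \<in> B) \<and> (\<forall>c. \<forall>a\<in>B. ascale A c a \<in> B)"

definition cstar_subalgebra :: "'a star_algebra \<Rightarrow> 'a set \<Rightarrow> bool" where
  "cstar_subalgebra A B \<longleftrightarrow>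
     linear_subspace A B \<and> (\<forall>a\<in>B. \<forall>b\<in>B. atimes A a b \<in> B) \<and> (\<forall>a\<in>B. astar A a \<in> B) \<and>
     anorm_closed A B"

definition cstar_generated :: "'a star_algebra \<Rightarrow> 'a set \<Rightarrow> 'a star_algebra" where
  "cstar_generated A D = A\<lparr>acarrier := \<Inter>{B. cstar_subalgebra A B \<and> D \<subseteq> B}\<rparr>"

definition closed_ideal :: "'a star_algebra \<Rightarrow> 'a set \<Rightarrow> bool" where
  "closed_ideal A J \<longleftrightarrow>
     linear_subspace A J \<and>
     (\<forall>a\<in>acarrier A. \<forall>j\<in>J. atimes A a j \<in> J \<and> atimes A j a \<in> J) \<and>
     anorm_closed A J"

definition simple_cstar_algebra :: "'a star_algebra \<Rightarrow> bool" where
  "simple_cstar_algebra A \<longleftrightarrow>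
     acarrier A \<noteq> {azero A} \<and>
     (\<forall>J. closed_ideal A J \<longrightarrow> J = {azero A} \<or> J = acarrier A)"


section \<open>Completion\<close>

text \<open>The elements are the classes of Cauchy sequences modulo sequences converging to zero.\<close>

definition cauchy_seqs :: "'a star_algebra \<Rightarrow> (nat \<Rightarrow> 'a) set" where
  "cauchy_seqs A =
     {f. range f \<subseteq> acarrier A \<and>
         (\<forall>e>0. \<exists>N. \<forall>m\<ge>N. \<forall>n\<ge>N. adist A (f m) (f n) < e)}"

definition cauchy_rel :: "'a star_algebra \<Rightarrow> ((nat \<Rightarrow> 'a) \<times> (nat \<Rightarrow> 'a)) set" where
  "cauchy_rel A =
     {(f, g). f \<in> cauchy_seqs A \<and> g \<in> cauchy_seqs A \<and> (\<lambda>n. adist A (f n) (g n)) \<longlonglongrightarrow> 0}"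

definition completion :: "'a star_algebra \<Rightarrow> (nat \<Rightarrow> 'a) set star_algebra" where
  "completion A =
     \<lparr> acarrier = cauchy_seqs A // cauchy_rel A,
       azero = cauchy_rel A `` {\<lambda>n. azero A},
       aplus = (\<lambda>X Y. \<Union>f\<in>X. \<Union>g\<in>Y. cauchy_rel A `` {\<lambda>n. aplus A (f n) (g n)}),
       ascale = (\<lambda>c X. \<Union>f\<in>X. cauchy_rel A `` {\<lambda>n. ascale A c (f n)}),
       atimes = (\<lambda>X Y. \<Union>f\<in>X. \<Union>g\<in>Y. cauchy_rel A `` {\<lambda>n. atimes A (f n) (g n)}),
       astar = (\<lambda>X. \<Union>f\<in>X. cauchy_rel A `` {\<lambda>n. astar A (f n)}),
       anorm = (\<lambda>X. THE r. \<forall>f\<in>X. (\<lambda>n. anorm A (f n)) \<longlonglongrightarrow> r) \<rparr>"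

definition completion_embed :: "'a star_algebra \<Rightarrow> 'a \<Rightarrow> (nat \<Rightarrow> 'a) set" where
  "completion_embed A a = cauchy_rel A `` {\<lambda>n. a}"


section \<open>The reduced \<open>C\<^sup>*\<close>-algebra of a groupoid\<close>

text \<open>Functions on the groupoid are represented by functions on the type that vanish outside the
  groupoid. The sums below have only finitely many non-zero terms when one of the factors has
  compact support and the range map is locally injective.\<close>

definition gconv :: "'g groupoid \<Rightarrow> ('g \<Rightarrow> complex) \<Rightarrow> ('g \<Rightarrow> complex) \<Rightarrow> 'g \<Rightarrow> complex" where
  "gconv G f g = (\<lambda>\<gamma>. \<Sum>\<^sub>\<infinity>(\<gamma>1, \<gamma>2)\<in>gfactorizations G \<gamma>. f \<gamma>1 * g \<gamma>2)"

definition gstar :: "'g groupoid \<Rightarrow> ('g \<Rightarrow> complex) \<Rightarrow> 'g \<Rightarrow> complex" where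
  "gstar G f = (\<lambda>\<gamma>. if \<gamma> \<in> topspace (gtop G) then cnj (f (ginv G \<gamma>)) else 0)"

definition Bc :: "'g groupoid \<Rightarrow> ('g \<Rightarrow> complex) set" where
  "Bc G = {f. (\<forall>\<gamma>. \<gamma> \<notin> topspace (gtop G) \<longrightarrow> f \<gamma> = 0) \<and> bounded (range f) \<and>
              compactin (gtop G) (gtop G closure_of {\<gamma>. f \<gamma> \<noteq> 0})}"

definition Cc :: "'g groupoid \<Rightarrow> ('g \<Rightarrow> complex) set" where
  "Cc G = {f \<in> Bc G. continuous_map (gtop G) euclidean f}"

definition l2_space :: "'g set \<Rightarrow> ('g \<Rightarrow> complex) set" where
  "l2_space X = {\<psi>. (\<forall>\<gamma>. \<gamma> \<notin> X \<longrightarrow> \<psi> \<gamma> = 0) \<and> (\<lambda>\<gamma>. (cmod (\<psi> \<gamma>))\<^sup>2) summable_on X}"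

definition l2_norm :: "'g set \<Rightarrow> ('g \<Rightarrow> complex) \<Rightarrow> real" where
  "l2_norm X \<psi> = sqrt (\<Sum>\<^sub>\<infinity>\<gamma>\<in>X. (cmod (\<psi> \<gamma>))\<^sup>2)"

definition regular_rep ::
    "'g groupoid \<Rightarrow> 'g \<Rightarrow> ('g \<Rightarrow> complex) \<Rightarrow> ('g \<Rightarrow> complex) \<Rightarrow> 'g \<Rightarrow> complex" where
  "regular_rep G x f \<psi> = (\<lambda>\<gamma>. if \<gamma> \<in> gsrc_fibre G x then gconv G f \<psi> \<gamma> else 0)"

definition regular_rep_norm :: "'g groupoid \<Rightarrow> 'g \<Rightarrow> ('g \<Rightarrow> complex) \<Rightarrow> real" where
  "regular_rep_norm G x f =
     (SUP \<psi> \<in> {\<psi> \<in> l2_space (gsrc_fibre G x). l2_norm (gsrc_fibre G x) \<psi> \<le> 1}.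
        l2_norm (gsrc_fibre G x) (regular_rep G x f \<psi>))"

definition Bc_algebra :: "'g groupoid \<Rightarrow> ('g \<Rightarrow> complex) star_algebra" where
  "Bc_algebra G =
     \<lparr> acarrier = Bc G,
       azero = (\<lambda>\<gamma>. 0),
       aplus = (\<lambda>f g \<gamma>. f \<gamma> + g \<gamma>),
       ascale = (\<lambda>c f \<gamma>. c * f \<gamma>),
       atimes = gconv G,
       astar = gstar G,
       anorm = (\<lambda>f. SUP x\<in>gunits G. regular_rep_norm G x f) \<rparr>"

definition Br_algebra :: "'g groupoid \<Rightarrow> (nat \<Rightarrow> 'g \<Rightarrow> complex) set star_algebra" where
  "Br_algebra G = completion (Bc_algebra G)"

definition Cr_algebra :: "'g groupoid \<Rightarrow> (nat \<Rightarrow> 'g \<Rightarrow> complex) set star_algebra" where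
  "Cr_algebra G = cstar_generated (Br_algebra G) (completion_embed (Bc_algebra G) ` Cc G)"

end

theory Submission
  imports Defs "HOL-Library.Omega_Words_Fun"
begin

text \<open>An element of $C^*_r(\Gamma_S)$ is determined by its values on the groupoid. The functions in
  the algebra generated by $C_c(\Gamma_S)$ are continuous for the finer topology that is generated
  by the generalized cylinders, and the indicator functions of generalized cylinders belong to
  $C^*_r(\Gamma_S)$.

  Suppose that every non-empty generalized cylinder is mapped onto $S$ by finitely many powers of
  the shift. Then these sets are infinite, and since $\sigma^a(x)=\sigma^b(x)$ has only finitely
  many solutions when $a\neq b$, they contain points with trivial isotropy up to any given level.
  Around such a point an element $b=X^*X$ of an ideal, cut down to a small generalized cylinder $C$,
  is close to a non-zero multiple of the projection $1_C$; hence $1_C$, and with it the unit, lies in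
  the ideal.

  Conversely, for a non-empty generalized cylinder $C$ the functions that are supported over
  $U_N=\{x:\sigma^a(x)=\sigma^b(y),\ y\in C,\ a,b\le N\}$ for some $N$ generate a non-zero closed
  ideal. If it contains the unit, then $U_N=S$ for some $N$, and applying this to a preimage of $x$
  under $\sigma^N$ writes $x$ as $\sigma^k(y)$ with $y\in C$ and $k\le 2N$.\<close>

section \<open>Normed \<open>*\<close>-algebras and their completions\<close>

text \<open>The obstacle is that \<open>C_c\<close> is not closed under convolution: the range map
  of the groupoid is locally injective but need not be open. Already the product of the continuous
  functions \<open>bisection u v\<close> and \<open>bisection v u\<close> is the indicator of a set
  of units that need not be open. Hence the calculations take place in \<open>B_c\<close>, and a
  finer topology is needed to describe what remains of continuity.

  The elements of the completion are classes of Cauchy sequences. On the source fibre of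
  \<open>y\<close> a function \<open>f\<close> is the matrix with entries \<open>f\<close> at
  \<open>g\<close> times the inverse of \<open>h\<close>, and its operator norm is controlled by
  finite sections. Such bounds survive pointwise limits, which is why an element whose values all
  vanish is zero.

  The passage to \<open>X^*X\<close> moves a non-zero value to a unit: the value of
  \<open>X^*X\<close> at \<open>y\<close> dominates \<open>|X(g)|^2\<close> for every
  \<open>g\<close> with source \<open>y\<close>. The normalised cut-down \<open>T\<close> of
  \<open>X^*X\<close> lies within 1/2 of the projection \<open>P = 1_C\<close>, so the powers of
  \<open>P - T\<close> tend to zero while remaining congruent to \<open>P\<close> modulo the
  ideal.\<close>

locale normed_star_algebra =
  fixes A :: "'a star_algebra"
  assumes zero_in: "azero A \<in> acarrier A"
    and plus_in: "\<lbrakk>a \<in> acarrier A; b \<in> acarrier A\<rbrakk> \<Longrightarrow> aplus A a b \<in> acarrier A"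
    and scale_in: "a \<in> acarrier A \<Longrightarrow> ascale A z a \<in> acarrier A"
    and times_in: "\<lbrakk>a \<in> acarrier A; b \<in> acarrier A\<rbrakk> \<Longrightarrow> atimes A a b \<in> acarrier A"
    and star_in: "a \<in> acarrier A \<Longrightarrow> astar A a \<in> acarrier A"
    and plus_assoc: "\<lbrakk>a \<in> acarrier A; b \<in> acarrier A; c \<in> acarrier A\<rbrakk> \<Longrightarrow>
          aplus A (aplus A a b) c = aplus A a (aplus A b c)"
    and plus_commute: "\<lbrakk>a \<in> acarrier A; b \<in> acarrier A\<rbrakk> \<Longrightarrow> aplus A a b = aplus A b a"
    and plus_zero: "a \<in> acarrier A \<Longrightarrow> aplus A a (azero A) = a"
    and plus_minus: "a \<in> acarrier A \<Longrightarrow> aplus A a (ascale A (- 1) a) = azero A"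
    and scale_one: "a \<in> acarrier A \<Longrightarrow> ascale A 1 a = a"
    and scale_scale: "a \<in> acarrier A \<Longrightarrow> ascale A z (ascale A w a) = ascale A (z * w) a"
    and scale_plus: "\<lbrakk>a \<in> acarrier A; b \<in> acarrier A\<rbrakk> \<Longrightarrow>
          ascale A z (aplus A a b) = aplus A (ascale A z a) (ascale A z b)"
    and plus_times: "\<lbrakk>a \<in> acarrier A; b \<in> acarrier A; c \<in> acarrier A\<rbrakk> \<Longrightarrow>
          atimes A (aplus A a b) c = aplus A (atimes A a c) (atimes A b c)"
    and times_plus: "\<lbrakk>a \<in> acarrier A; b \<in> acarrier A; c \<in> acarrier A\<rbrakk> \<Longrightarrow>
          atimes A a (aplus A b c) = aplus A (atimes A a b) (atimes A a c)"
    and scale_times: "\<lbrakk>a \<in> acarrier A; b \<in> acarrier A\<rbrakk> \<Longrightarrow>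
          atimes A (ascale A z a) b = ascale A z (atimes A a b)"
    and times_scale: "\<lbrakk>a \<in> acarrier A; b \<in> acarrier A\<rbrakk> \<Longrightarrow>
          atimes A a (ascale A z b) = ascale A z (atimes A a b)"
    and star_plus: "\<lbrakk>a \<in> acarrier A; b \<in> acarrier A\<rbrakk> \<Longrightarrow>
          astar A (aplus A a b) = aplus A (astar A a) (astar A b)"
    and star_scale: "a \<in> acarrier A \<Longrightarrow> astar A (ascale A z a) = ascale A (cnj z) (astar A a)"
    and norm_plus: "\<lbrakk>a \<in> acarrier A; b \<in> acarrier A\<rbrakk> \<Longrightarrow>
          anorm A (aplus A a b) \<le> anorm A a + anorm A b"
    and norm_scale: "a \<in> acarrier A \<Longrightarrow> anorm A (ascale A z a) = cmod z * anorm A a"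
    and norm_times: "\<lbrakk>a \<in> acarrier A; b \<in> acarrier A\<rbrakk> \<Longrightarrow>
          anorm A (atimes A a b) \<le> anorm A a * anorm A b"
    and norm_star: "a \<in> acarrier A \<Longrightarrow> anorm A (astar A a) = anorm A a"
begin

abbreviation cls :: "(nat \<Rightarrow> 'a) \<Rightarrow> (nat \<Rightarrow> 'a) set" where "cls f \<equiv> cauchy_rel A `` {f}"

lemmas closed_ops = zero_in plus_in scale_in times_in star_in

lemma plus_left_commute:
  "\<lbrakk>a \<in> acarrier A; b \<in> acarrier A; c \<in> acarrier A\<rbrakk> \<Longrightarrow>
    aplus A a (aplus A b c) = aplus A b (aplus A a c)"
  by (metis plus_assoc plus_commute)

lemmas plus_ac = plus_assoc plus_commute plus_left_commute

lemma zero_plus: "a \<in> acarrier A \<Longrightarrow> aplus A (azero A) a = a"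
  by (metis plus_commute plus_zero zero_in)

text \<open>The axioms prescribe only \<open>plus_minus\<close> for cancellation, so zero is first
  written as \<open>0 + (-1) 0\<close>.\<close>

lemma scale_zero: "ascale A z (azero A) = azero A"
proof -
  have "ascale A z (azero A) = ascale A z (aplus A (azero A) (ascale A (-1) (azero A)))"
    by (simp add: plus_minus zero_in)
  also have "\<dots> = aplus A (ascale A z (azero A)) (ascale A (-1) (ascale A z (azero A)))"
    by (simp add: scale_plus scale_scale closed_ops)
  also have "\<dots> = azero A" by (simp add: plus_minus closed_ops)
  finally show ?thesis .
qed

text \<open>Multiplication by 2 fixes zero but doubles its norm.\<close>

lemma norm_zero: "anorm A (azero A) = 0"
  using norm_scale[OF zero_in, of 2] by (simp add: scale_zero)

lemma norm_ge_0: "a \<in> acarrier A \<Longrightarrow> 0 \<le> anorm A a"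
  using norm_plus[of a "ascale A (-1) a"] by (simp add: plus_minus closed_ops norm_zero norm_scale)

section \<open>Distances in a seminormed algebra\<close>

lemma dist_self: "a \<in> acarrier A \<Longrightarrow> adist A a a = 0"
  by (simp add: adist_def plus_minus norm_zero)

lemma dist_zero: "a \<in> acarrier A \<Longrightarrow> adist A a (azero A) = anorm A a"
  by (simp add: adist_def scale_zero plus_zero)

lemma dist_ge_0: "\<lbrakk>a \<in> acarrier A; b \<in> acarrier A\<rbrakk> \<Longrightarrow> 0 \<le> adist A a b"
  by (simp add: adist_def norm_ge_0 closed_ops)

lemma dist_scale:
  "\<lbrakk>a \<in> acarrier A; b \<in> acarrier A\<rbrakk> \<Longrightarrow>
    adist A (ascale A z a) (ascale A z b) = cmod z * adist A a b"
  by (simp add: adist_def closed_ops scale_plus scale_scale mult.commute flip: norm_scale)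

lemma dist_commute:
  assumes "a \<in> acarrier A" "b \<in> acarrier A" shows "adist A a b = adist A b a"
proof -
  have "ascale A (-1) (aplus A b (ascale A (-1) a)) = aplus A a (ascale A (-1) b)"
    using assms by (simp add: scale_plus scale_scale closed_ops scale_one plus_commute)
  then have "anorm A (aplus A a (ascale A (-1) b)) = cmod (-1) * anorm A (aplus A b (ascale A (-1) a))"
    using assms by (metis norm_scale closed_ops(2,3))
  then show ?thesis by (simp add: adist_def)
qed

lemma diff_plus_diff:
  assumes "a \<in> acarrier A" "b \<in> acarrier A" "c \<in> acarrier A"
  shows "aplus A (aplus A a (ascale A (-1) b)) (aplus A b (ascale A (-1) c)) =
    aplus A a (ascale A (-1) c)"
proof -
  have "aplus A (ascale A (-1) b) (aplus A b (ascale A (-1) c)) =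
      aplus A (aplus A b (ascale A (-1) b)) (ascale A (-1) c)"
    using assms by (simp add: plus_ac closed_ops)
  then show ?thesis using assms by (simp add: plus_assoc plus_minus zero_plus closed_ops)
qed

lemma dist_triangle:
  assumes "a \<in> acarrier A" "b \<in> acarrier A" "c \<in> acarrier A"
  shows "adist A a c \<le> adist A a b + adist A b c"
  using assms norm_plus[of "aplus A a (ascale A (-1) b)" "aplus A b (ascale A (-1) c)"]
  by (simp add: adist_def diff_plus_diff closed_ops)

lemma dist_plus:
  assumes "a \<in> acarrier A" "b \<in> acarrier A" "a' \<in> acarrier A" "b' \<in> acarrier A"
  shows "adist A (aplus A a b) (aplus A a' b') \<le> adist A a a' + adist A b b'"
proof -
  have "aplus A (aplus A a b) (ascale A (-1) (aplus A a' b')) =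
      aplus A (aplus A a (ascale A (-1) a')) (aplus A b (ascale A (-1) b'))"
    using assms by (simp add: plus_ac closed_ops scale_plus)
  then show ?thesis using assms by (simp add: adist_def norm_plus closed_ops)
qed

lemma dist_star:
  "\<lbrakk>a \<in> acarrier A; b \<in> acarrier A\<rbrakk> \<Longrightarrow> adist A (astar A a) (astar A b) = adist A a b"
  using norm_star[of "aplus A a (ascale A (-1) b)"]
  by (simp add: adist_def closed_ops star_plus star_scale)

lemma times_diff:
  "\<lbrakk>a \<in> acarrier A; b \<in> acarrier A; c \<in> acarrier A\<rbrakk> \<Longrightarrow>
    aplus A (atimes A a b) (ascale A (-1) (atimes A a c)) = atimes A a (aplus A b (ascale A (-1) c))"
  by (simp add: times_plus times_scale closed_ops)

lemma diff_times:
  "\<lbrakk>a \<in> acarrier A; b \<in> acarrier A; c \<in> acarrier A\<rbrakk> \<Longrightarrow>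
    aplus A (atimes A a c) (ascale A (-1) (atimes A b c)) = atimes A (aplus A a (ascale A (-1) b)) c"
  by (simp add: plus_times scale_times closed_ops)

text \<open>The intermediate point is \<open>atimes A a b'\<close>; therefore the norm of
  \<open>a\<close> meets the distance of the second factors and the norm of \<open>b'\<close> that
  of the first.\<close>

lemma dist_times:
  assumes "a \<in> acarrier A" "b \<in> acarrier A" "a' \<in> acarrier A" "b' \<in> acarrier A"
  shows "adist A (atimes A a b) (atimes A a' b') \<le> anorm A a * adist A b b' + adist A a a' * anorm A b'"
proof -
  have "adist A (atimes A a b) (atimes A a b') \<le> anorm A a * adist A b b'"
    using assms by (simp add: adist_def times_diff norm_times closed_ops)
  moreover have "adist A (atimes A a b') (atimes A a' b') \<le> adist A a a' * anorm A b'"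
    using assms by (simp add: adist_def diff_times norm_times closed_ops)
  ultimately show ?thesis
    using assms dist_triangle[of "atimes A a b" "atimes A a b'" "atimes A a' b'"]
    by (simp add: closed_ops)
qed

lemma norm_le_norm_plus_dist:
  "\<lbrakk>a \<in> acarrier A; b \<in> acarrier A\<rbrakk> \<Longrightarrow> anorm A a \<le> anorm A b + adist A a b"
  using dist_triangle[of a b "azero A"] by (simp add: dist_zero zero_in)

lemma norm_diff_le_dist:
  assumes "a \<in> acarrier A" "b \<in> acarrier A"
  shows "\<bar>anorm A a - anorm A b\<bar> \<le> adist A a b"
  using norm_le_norm_plus_dist[OF assms] norm_le_norm_plus_dist[OF assms(2,1)] dist_commute[OF assms]
  by simp

section \<open>Cauchy sequences\<close>

lemma cauchy_seqsD:
  assumes "f \<in> cauchy_seqs A"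
  shows "f n \<in> acarrier A" "e > 0 \<Longrightarrow> \<exists>N. \<forall>m\<ge>N. \<forall>n\<ge>N. adist A (f m) (f n) < e"
  using assms by (auto simp: cauchy_seqs_def)

lemma const_cauchy: "a \<in> acarrier A \<Longrightarrow> (\<lambda>n. a) \<in> cauchy_seqs A"
  by (auto simp: cauchy_seqs_def dist_self)

lemma cauchy_bounded:
  assumes "f \<in> cauchy_seqs A" obtains M where "M > 0" "\<And>n. anorm A (f n) \<le> M"
proof -
  obtain N where N: "\<forall>m\<ge>N. \<forall>n\<ge>N. adist A (f m) (f n) < 1"
    using cauchy_seqsD(2)[OF assms, of 1] by auto
  define M where "M = Max ((\<lambda>n. anorm A (f n)) ` {..N}) + 1"
  have le: "anorm A (f n) \<le> M - 1" if "n \<le> N" for n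
    unfolding M_def using that by (simp add: Max_ge)
  have "anorm A (f n) \<le> M" for n
  proof (cases "n \<le> N")
    case True then show ?thesis using le[of n] by simp
  next
    case False
    have "anorm A (f n) \<le> anorm A (f N) + adist A (f n) (f N)"
      by (intro norm_le_norm_plus_dist cauchy_seqsD[OF assms])
    moreover have "adist A (f n) (f N) < 1" using N False by simp
    ultimately show ?thesis using le[of N] by simp
  qed
  moreover have "M > 0" using le[of N] norm_ge_0[OF cauchy_seqsD(1)[OF assms, of N]] by simp
  ultimately show ?thesis using that by blast
qed

text \<open>One epsilon argument shared by sums, multiples and products: each satisfies a Lipschitz
  estimate of this form, for products with the bounds of the two sequences as constants.\<close>

lemma cauchy_dominated:
  assumes f: "f \<in> cauchy_seqs A" and g: "g \<in> cauchy_seqs A"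
    and h: "\<And>n. h n \<in> acarrier A" and "K > 0" "L > 0"
    and le: "\<And>m n. adist A (h m) (h n) \<le> K * adist A (f m) (f n) + L * adist A (g m) (g n)"
  shows "h \<in> cauchy_seqs A"
  unfolding cauchy_seqs_def
proof (intro CollectI conjI allI impI)
  show "range h \<subseteq> acarrier A" using h by auto
next
  fix e :: real assume "e > 0"
  obtain N1 where N1: "\<forall>m\<ge>N1. \<forall>n\<ge>N1. adist A (f m) (f n) < e/(2*K)"
    using cauchy_seqsD(2)[OF f, of "e/(2*K)"] \<open>e > 0\<close> \<open>K > 0\<close> by auto
  obtain N2 where N2: "\<forall>m\<ge>N2. \<forall>n\<ge>N2. adist A (g m) (g n) < e/(2*L)"
    using cauchy_seqsD(2)[OF g, of "e/(2*L)"] \<open>e > 0\<close> \<open>L > 0\<close> by auto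
  have "adist A (h m) (h n) < e" if "m \<ge> max N1 N2" "n \<ge> max N1 N2" for m n
  proof -
    have "adist A (h m) (h n) \<le> K * adist A (f m) (f n) + L * adist A (g m) (g n)" by (rule le)
    also have "\<dots> < K * (e/(2*K)) + L * (e/(2*L))" using N1 N2 that \<open>K > 0\<close> \<open>L > 0\<close>
      by (intro add_strict_mono mult_strict_left_mono) auto
    also have "\<dots> = e" using \<open>K > 0\<close> \<open>L > 0\<close> by simp
    finally show ?thesis .
  qed
  then show "\<exists>N. \<forall>m\<ge>N. \<forall>n\<ge>N. adist A (h m) (h n) < e" by blast
qed

lemma cauchy_plus:
  assumes f: "f \<in> cauchy_seqs A" and g: "g \<in> cauchy_seqs A"
  shows "(\<lambda>n. aplus A (f n) (g n)) \<in> cauchy_seqs A"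
  by (rule cauchy_dominated[OF f g _ zero_less_one zero_less_one])
    (simp_all add: dist_plus plus_in cauchy_seqsD(1)[OF f] cauchy_seqsD(1)[OF g])

lemma cauchy_scale:
  assumes f: "f \<in> cauchy_seqs A"
  shows "(\<lambda>n. ascale A z (f n)) \<in> cauchy_seqs A"
  \<comment> \<open>\<open>cauchy_dominated\<close> asks for positive constants, so
    \<open>cmod z + 1\<close> stands in for \<open>cmod z\<close>, which may vanish.\<close>
  by (rule cauchy_dominated[OF f f, where K = "cmod z + 1" and L = 1])
    (simp_all add: dist_scale dist_ge_0 scale_in cauchy_seqsD(1)[OF f] add_nonneg_pos distrib_right)

lemma cauchy_star:
  assumes f: "f \<in> cauchy_seqs A"
  shows "(\<lambda>n. astar A (f n)) \<in> cauchy_seqs A"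
  using f cauchy_seqsD(1)[OF f] by (auto simp: cauchy_seqs_def dist_star intro: closed_ops)

lemma dist_times_bounded:
  assumes "a \<in> acarrier A" "b \<in> acarrier A" "a' \<in> acarrier A" "b' \<in> acarrier A"
    and "anorm A a \<le> K" "anorm A b' \<le> L"
  shows "adist A (atimes A a b) (atimes A a' b') \<le> L * adist A a a' + K * adist A b b'"
proof -
  have "anorm A a * adist A b b' + adist A a a' * anorm A b' \<le> K * adist A b b' + adist A a a' * L"
    using assms by (intro add_mono mult_right_mono mult_left_mono dist_ge_0)
  then show ?thesis using dist_times[OF assms(1-4)] by (simp add: mult.commute)
qed

lemma cauchy_times:
  assumes f: "f \<in> cauchy_seqs A" and g: "g \<in> cauchy_seqs A"
  shows "(\<lambda>n. atimes A (f n) (g n)) \<in> cauchy_seqs A"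
proof -
  obtain K where K: "K > 0" "\<And>n. anorm A (f n) \<le> K" using cauchy_bounded[OF f] by blast
  obtain L where L: "L > 0" "\<And>n. anorm A (g n) \<le> L" using cauchy_bounded[OF g] by blast
  show ?thesis
    by (rule cauchy_dominated[OF f g _ L(1) K(1)])
      (simp_all add: dist_times_bounded K L times_in cauchy_seqsD(1)[OF f] cauchy_seqsD(1)[OF g])
qed

section \<open>The quotient of Cauchy sequences and its operations\<close>

lemma equiv_cauchy_rel: "equiv (cauchy_seqs A) (cauchy_rel A)"
proof (rule equivI)
  show "refl_on (cauchy_seqs A) (cauchy_rel A)"
    by (auto simp: refl_on_def cauchy_rel_def dist_self cauchy_seqsD(1))
  show "cauchy_rel A \<subseteq> cauchy_seqs A \<times> cauchy_seqs A" by (auto simp: cauchy_rel_def)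
  show "sym (cauchy_rel A)"
    by (auto simp: sym_def cauchy_rel_def dist_commute cauchy_seqsD(1))
  show "trans (cauchy_rel A)"
  proof (rule transI)
    fix f g h assume "(f, g) \<in> cauchy_rel A" "(g, h) \<in> cauchy_rel A"
    then have fgh: "f \<in> cauchy_seqs A" "g \<in> cauchy_seqs A" "h \<in> cauchy_seqs A"
      and lim: "(\<lambda>n. adist A (f n) (g n)) \<longlonglongrightarrow> 0" "(\<lambda>n. adist A (g n) (h n)) \<longlonglongrightarrow> 0"
      by (auto simp: cauchy_rel_def)
    have "(\<lambda>n. adist A (f n) (h n)) \<longlonglongrightarrow> 0"
    proof (rule tendsto_sandwich[OF _ _ tendsto_const])
      show "(\<lambda>n. adist A (f n) (g n) + adist A (g n) (h n)) \<longlonglongrightarrow> 0"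
        using tendsto_add[OF lim] by simp
    qed (use fgh in \<open>auto simp: dist_ge_0 cauchy_seqsD(1) dist_triangle\<close>)
    then show "(f, h) \<in> cauchy_rel A" using fgh by (simp add: cauchy_rel_def)
  qed
qed

lemma class_eq_iff:
  "\<lbrakk>f \<in> cauchy_seqs A; g \<in> cauchy_seqs A\<rbrakk> \<Longrightarrow>
    cls f = cls g \<longleftrightarrow> (\<lambda>n. adist A (f n) (g n)) \<longlonglongrightarrow> 0"
  by (subst eq_equiv_class_iff[OF equiv_cauchy_rel]) (auto simp: cauchy_rel_def)

lemma class_memD:
  assumes "f' \<in> cls f"
  shows "f \<in> cauchy_seqs A" "f' \<in> cauchy_seqs A" "(\<lambda>n. adist A (f n) (f' n)) \<longlonglongrightarrow> 0"
    "(\<lambda>n. adist A (f' n) (f n)) \<longlonglongrightarrow> 0"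
  using assms by (auto simp: cauchy_rel_def dist_commute cauchy_seqsD(1))

lemma class_self: "f \<in> cauchy_seqs A \<Longrightarrow> f \<in> cls f"
  by (rule equiv_class_self[OF equiv_cauchy_rel])

lemma class_in: "f \<in> cauchy_seqs A \<Longrightarrow> cls f \<in> acarrier (completion A)"
  by (auto simp: completion_def intro: quotientI)

lemma classE:
  assumes "X \<in> acarrier (completion A)"
  obtains f where "f \<in> cauchy_seqs A" "X = cls f"
  using assms by (auto simp: completion_def elim: quotientE)

text \<open>The operations of \<open>completion\<close> are unions over all representatives. Such a
  union collapses once its members agree, so well-definedness becomes an equality of
  classes.\<close>

lemma class_Union:
  "\<lbrakk>f \<in> cauchy_seqs A; \<And>f'. f' \<in> cls f \<Longrightarrow> H f' = X\<rbrakk> \<Longrightarrow>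
    (\<Union>f'\<in>cls f. H f') = X"
  using class_self by blast

lemma completion_plus:
  assumes f: "f \<in> cauchy_seqs A" and g: "g \<in> cauchy_seqs A"
  shows "aplus (completion A) (cls f) (cls g) =
    cls (\<lambda>n. aplus A (f n) (g n))"
  unfolding completion_def star_algebra.simps
proof (intro class_Union f g)
  fix f' g' assume f': "f' \<in> cls f" and g': "g' \<in> cls g"
  note F = class_memD[OF f'] and G = class_memD[OF g']
  show "cls (\<lambda>n. aplus A (f' n) (g' n)) = cls (\<lambda>n. aplus A (f n) (g n))"
    unfolding class_eq_iff[OF cauchy_plus[OF F(2) G(2)] cauchy_plus[OF F(1) G(1)]]
  proof (rule tendsto_sandwich[OF _ _ tendsto_const])
    show "(\<lambda>n. adist A (f' n) (f n) + adist A (g' n) (g n)) \<longlonglongrightarrow> 0"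
      using tendsto_add[OF F(4) G(4)] by simp
  qed (use F G in \<open>auto simp: dist_ge_0 cauchy_seqsD(1) dist_plus closed_ops\<close>)
qed

lemma completion_scale:
  assumes f: "f \<in> cauchy_seqs A"
  shows "ascale (completion A) z (cls f) = cls (\<lambda>n. ascale A z (f n))"
  unfolding completion_def star_algebra.simps
proof (intro class_Union f)
  fix f' assume f': "f' \<in> cls f"
  note F = class_memD[OF f']
  have "(\<lambda>n. cmod z * adist A (f' n) (f n)) \<longlonglongrightarrow> 0" using tendsto_mult_right_zero[OF F(4)] .
  then show "cls (\<lambda>n. ascale A z (f' n)) = cls (\<lambda>n. ascale A z (f n))"
    unfolding class_eq_iff[OF cauchy_scale[OF F(2)] cauchy_scale[OF F(1)]]
    using F by (simp add: dist_scale cauchy_seqsD(1))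
qed

lemma completion_star:
  assumes f: "f \<in> cauchy_seqs A"
  shows "astar (completion A) (cls f) = cls (\<lambda>n. astar A (f n))"
  unfolding completion_def star_algebra.simps
proof (intro class_Union f)
  fix f' assume f': "f' \<in> cls f"
  note F = class_memD[OF f']
  show "cls (\<lambda>n. astar A (f' n)) = cls (\<lambda>n. astar A (f n))"
    unfolding class_eq_iff[OF cauchy_star[OF F(2)] cauchy_star[OF F(1)]]
    using F by (simp add: dist_star cauchy_seqsD(1))
qed

lemma completion_times:
  assumes f: "f \<in> cauchy_seqs A" and g: "g \<in> cauchy_seqs A"
  shows "atimes (completion A) (cls f) (cls g) =
    cls (\<lambda>n. atimes A (f n) (g n))"
  unfolding completion_def star_algebra.simps
proof (intro class_Union f g)
  fix f' g' assume f': "f' \<in> cls f" and g': "g' \<in> cls g"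
  note F = class_memD[OF f'] and G = class_memD[OF g']
  obtain K where K: "K > 0" "\<And>n. anorm A (f' n) \<le> K" using cauchy_bounded[OF F(2)] by blast
  obtain L where L: "L > 0" "\<And>n. anorm A (g n) \<le> L" using cauchy_bounded[OF g] by blast
  show "cls (\<lambda>n. atimes A (f' n) (g' n)) = cls (\<lambda>n. atimes A (f n) (g n))"
    unfolding class_eq_iff[OF cauchy_times[OF F(2) G(2)] cauchy_times[OF F(1) G(1)]]
  proof (rule tendsto_sandwich[OF _ _ tendsto_const])
    show "(\<lambda>n. L * adist A (f' n) (f n) + K * adist A (g' n) (g n)) \<longlonglongrightarrow> 0"
      using tendsto_add[OF tendsto_mult_right_zero[OF F(4)] tendsto_mult_right_zero[OF G(4)]] by simp
  qed (use F G K L in \<open>auto simp: dist_ge_0 cauchy_seqsD(1) closed_ops dist_times_bounded\<close>)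
qed

lemma completion_zero: "azero (completion A) = cls (\<lambda>n. azero A)"
  by (simp add: completion_def)

text \<open>By the reverse triangle inequality the norms form a real Cauchy sequence, and equivalent
  sequences have norms with the same limit; this makes the definite description in
  \<open>completion\<close> denote that limit.\<close>

lemma completion_norm:
  assumes f: "f \<in> cauchy_seqs A"
  shows "(\<lambda>n. anorm A (f n)) \<longlonglongrightarrow> anorm (completion A) (cls f)"
proof -
  have "Cauchy (\<lambda>n. anorm A (f n))"
  proof (rule metric_CauchyI)
    fix e :: real assume "e > 0"
    then obtain N where N: "\<forall>m\<ge>N. \<forall>n\<ge>N. adist A (f m) (f n) < e"
      using cauchy_seqsD(2)[OF f] by blast
    then show "\<exists>M. \<forall>m\<ge>M. \<forall>n\<ge>M. dist (anorm A (f m)) (anorm A (f n)) < e"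
      unfolding dist_real_def
      by (meson cauchy_seqsD(1)[OF f] norm_diff_le_dist order_le_less_trans)
  qed
  then obtain r where r: "(\<lambda>n. anorm A (f n)) \<longlonglongrightarrow> r"
    by (auto simp: Cauchy_convergent_iff convergent_def)
  have all: "(\<lambda>n. anorm A (f' n)) \<longlonglongrightarrow> r" if f': "f' \<in> cls f" for f'
  proof -
    note F = class_memD[OF f']
    have "(\<lambda>n. anorm A (f' n) - anorm A (f n)) \<longlonglongrightarrow> 0"
      by (rule tendsto_rabs_zero_cancel, rule tendsto_sandwich[OF _ _ tendsto_const F(4)])
        (use F in \<open>auto simp: norm_diff_le_dist cauchy_seqsD(1)\<close>)
    from tendsto_add[OF this r] show ?thesis by simp
  qed
  have "(THE r. \<forall>f'\<in>cls f. (\<lambda>n. anorm A (f' n)) \<longlonglongrightarrow> r) = r"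
    using all class_self[OF f] by (intro the_equality) (auto intro: LIMSEQ_unique r)
  then show ?thesis using r by (simp add: completion_def)
qed

lemma completion_dist:
  assumes f: "f \<in> cauchy_seqs A" and g: "g \<in> cauchy_seqs A"
  shows "(\<lambda>n. adist A (f n) (g n)) \<longlonglongrightarrow> adist (completion A) (cls f) (cls g)"
  using completion_norm[OF cauchy_plus[OF f cauchy_scale[OF g, of "-1"]]]
  by (simp add: adist_def completion_plus completion_scale cauchy_scale f g)

text \<open>The axioms are closure conditions, equations and weak norm inequalities. The first two
  hold termwise for representatives, and the norm axioms pass to the limit by
  \<open>completion_norm\<close>.\<close>

lemma normed_star_algebra_completion: "normed_star_algebra (completion A)"
proof -
  note rep = completion_plus completion_scale completion_star completion_times completion_zero
    cauchy_plus cauchy_scale cauchy_star cauchy_times const_cauchy cauchy_seqsD(1) zero_in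
    class_in closed_ops
  show ?thesis
  proof (unfold_locales, goal_cases)
    case 1 show ?case by (simp add: rep)
  next
    case (2 a b) then show ?case by (auto elim!: classE simp: rep)
  next
    case (3 a c) then show ?case by (auto elim!: classE simp: rep)
  next
    case (4 a b) then show ?case by (auto elim!: classE simp: rep)
  next
    case (5 a) then show ?case by (auto elim!: classE simp: rep)
  next
    case (6 a b c) then show ?case by (auto elim!: classE simp: rep plus_assoc)
  next
    case (7 a b) then show ?case
      by (elim classE) (simp add: rep, metis plus_commute cauchy_seqsD(1))
  next
    case (8 a) then show ?case by (auto elim!: classE simp: rep plus_zero)
  next
    case (9 a) then show ?case by (auto elim!: classE simp: rep plus_minus)
  next
    case (10 a) then show ?case by (auto elim!: classE simp: rep scale_one)
  next
    case (11 a z w) then show ?case by (auto elim!: classE simp: rep scale_scale)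
  next
    case (12 a b z) then show ?case by (auto elim!: classE simp: rep scale_plus)
  next
    case (13 a b c) then show ?case by (auto elim!: classE simp: rep plus_times)
  next
    case (14 a b c) then show ?case by (auto elim!: classE simp: rep times_plus)
  next
    case (15 a b z) then show ?case by (auto elim!: classE simp: rep scale_times)
  next
    case (16 a b z) then show ?case by (auto elim!: classE simp: rep times_scale)
  next
    case (17 a b) then show ?case by (auto elim!: classE simp: rep star_plus)
  next
    case (18 a z) then show ?case by (auto elim!: classE simp: rep star_scale)
  next
    case (19 a b)
    then obtain f g where fg: "f \<in> cauchy_seqs A" "a = cls f"
      "g \<in> cauchy_seqs A" "b = cls g" by (metis classE)
    show ?case unfolding fg(2,4) completion_plus[OF fg(1,3)]
      by (rule LIMSEQ_le[OF completion_norm[OF cauchy_plus[OF fg(1,3)]]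
          tendsto_add[OF completion_norm[OF fg(1)] completion_norm[OF fg(3)]]])
        (use fg in \<open>auto simp: norm_plus cauchy_seqsD(1)\<close>)
  next
    case (20 a z)
    then obtain f where f: "f \<in> cauchy_seqs A" "a = cls f" by (metis classE)
    show ?case unfolding f(2) completion_scale[OF f(1)]
      using completion_norm[OF cauchy_scale[OF f(1), of z]] tendsto_mult_left[OF completion_norm[OF f(1)], of "cmod z"]
      by (simp add: norm_scale cauchy_seqsD(1)[OF f(1)] LIMSEQ_unique)
  next
    case (21 a b)
    then obtain f g where fg: "f \<in> cauchy_seqs A" "a = cls f"
      "g \<in> cauchy_seqs A" "b = cls g" by (metis classE)
    show ?case unfolding fg(2,4) completion_times[OF fg(1,3)]
      by (rule LIMSEQ_le[OF completion_norm[OF cauchy_times[OF fg(1,3)]]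
          tendsto_mult[OF completion_norm[OF fg(1)] completion_norm[OF fg(3)]]])
        (use fg in \<open>auto simp: norm_times cauchy_seqsD(1)\<close>)
  next
    case (22 a)
    then obtain f where f: "f \<in> cauchy_seqs A" "a = cls f" by (metis classE)
    show ?case unfolding f(2) completion_star[OF f(1)]
      using completion_norm[OF cauchy_star[OF f(1)]] completion_norm[OF f(1)]
      by (simp add: norm_star cauchy_seqsD(1)[OF f(1)] LIMSEQ_unique)
  qed
qed

section \<open>The isometric embedding into the completion\<close>

lemma embed_in: "a \<in> acarrier A \<Longrightarrow> completion_embed A a \<in> acarrier (completion A)"
  by (simp add: completion_embed_def class_in const_cauchy)

lemma embed_plus:
  "\<lbrakk>a \<in> acarrier A; b \<in> acarrier A\<rbrakk> \<Longrightarrow>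
    aplus (completion A) (completion_embed A a) (completion_embed A b) = completion_embed A (aplus A a b)"
  by (simp add: completion_embed_def completion_plus const_cauchy)

lemma embed_scale:
  "a \<in> acarrier A \<Longrightarrow>
    ascale (completion A) z (completion_embed A a) = completion_embed A (ascale A z a)"
  by (simp add: completion_embed_def completion_scale const_cauchy)

lemma embed_times:
  "\<lbrakk>a \<in> acarrier A; b \<in> acarrier A\<rbrakk> \<Longrightarrow>
    atimes (completion A) (completion_embed A a) (completion_embed A b) = completion_embed A (atimes A a b)"
  by (simp add: completion_embed_def completion_times const_cauchy)

lemma embed_zero: "completion_embed A (azero A) = azero (completion A)"
  by (simp add: completion_embed_def completion_zero)

lemma embed_norm: "a \<in> acarrier A \<Longrightarrow> anorm (completion A) (completion_embed A a) = anorm A a"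
  using completion_norm[OF const_cauchy] LIMSEQ_unique[OF _ tendsto_const]
  by (fastforce simp: completion_embed_def)

lemma embed_dist:
  "\<lbrakk>a \<in> acarrier A; b \<in> acarrier A\<rbrakk> \<Longrightarrow>
    adist (completion A) (completion_embed A a) (completion_embed A b) = adist A a b"
  by (simp add: adist_def embed_plus embed_scale embed_norm closed_ops)

lemma class_dist_le:
  assumes f: "f \<in> cauchy_seqs A" and a: "a \<in> acarrier A" and "\<And>n. n \<ge> N \<Longrightarrow> adist A (f n) a \<le> e"
  shows "adist (completion A) (cls f) (completion_embed A a) \<le> e"
  unfolding completion_embed_def
  by (rule LIMSEQ_le_const2[OF completion_dist[OF f const_cauchy[OF a]]]) (use assms in blast)

end

text \<open>The norm closure of the image of \<open>B\<close> in the completion, given by the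
  classes that have a representative with all terms in \<open>B\<close>. This form makes closure
  under the operations a termwise statement; that the set is closed needs an argument.\<close>

definition completion_closure :: "'a star_algebra \<Rightarrow> 'a set \<Rightarrow> (nat \<Rightarrow> 'a) set set" where
  "completion_closure A B = {cauchy_rel A `` {f} |f. f \<in> cauchy_seqs A \<and> range f \<subseteq> B}"

context normed_star_algebra
begin

interpretation C: normed_star_algebra "completion A"
  by (rule normed_star_algebra_completion)

lemma closureI: "\<lbrakk>f \<in> cauchy_seqs A; \<And>n. f n \<in> B\<rbrakk> \<Longrightarrow> cls f \<in> completion_closure A B"
  unfolding completion_closure_def by blast

lemma closureE:
  assumes "X \<in> completion_closure A B"
  obtains f where "f \<in> cauchy_seqs A" "\<And>n. f n \<in> B" "X = cls f"
  using assms unfolding completion_closure_def by blast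

lemma closure_sub: "completion_closure A B \<subseteq> acarrier (completion A)"
  unfolding completion_closure_def using class_in by blast

lemma completion_closure_carrier: "completion_closure A (acarrier A) = acarrier (completion A)"
  using closure_sub by (auto elim!: classE intro!: closureI intro: cauchy_seqsD(1))

lemma embed_in_closure:
  "\<lbrakk>B \<subseteq> acarrier A; b \<in> B\<rbrakk> \<Longrightarrow> completion_embed A b \<in> completion_closure A B"
  unfolding completion_embed_def by (intro closureI const_cauchy) auto

lemma closure_approx:
  assumes "X \<in> completion_closure A B" "e > 0"
  obtains b where "b \<in> B" "adist (completion A) X (completion_embed A b) < e"
proof -
  obtain f where f: "f \<in> cauchy_seqs A" "\<And>n. f n \<in> B" "X = cls f"
    using assms(1) by (rule closureE) blast
  obtain N where "\<forall>m\<ge>N. \<forall>n\<ge>N. adist A (f m) (f n) < e/2"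
    using cauchy_seqsD(2)[OF f(1), of "e/2"] assms(2) by auto
  then have "adist (completion A) X (completion_embed A (f N)) \<le> e/2"
    unfolding f(3) by (intro class_dist_le[where N = N] f(1) cauchy_seqsD(1)) (auto intro: less_imp_le)
  then show ?thesis using assms(2) that[OF f(2)[of N]] by simp
qed

lemma closure_closed:
  assumes B: "B \<subseteq> acarrier A"
  shows "anorm_closed (completion A) (completion_closure A B)"
  unfolding anorm_closed_def
proof (intro allI impI, elim conjE)
  fix F X assume F: "range F \<subseteq> completion_closure A B" and X: "X \<in> acarrier (completion A)"
    and lim: "(\<lambda>n. adist (completion A) (F n) X) \<longlonglongrightarrow> 0"
  have "\<exists>b\<in>B. adist (completion A) X (completion_embed A b) < e" if "e > 0" for e
  proof -
    obtain n where n: "adist (completion A) (F n) X < e/2"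
      using eventually_happens[OF order_tendstoD(2)[OF lim, of "e/2"]] \<open>e > 0\<close> by auto
    have Fn: "F n \<in> completion_closure A B" "F n \<in> acarrier (completion A)" using F closure_sub by auto
    obtain b where b: "b \<in> B" "adist (completion A) (F n) (completion_embed A b) < e/2"
      by (rule closure_approx[OF Fn(1), of "e/2"]) (use \<open>e > 0\<close> in auto)
    have "adist (completion A) X (completion_embed A b) \<le>
        adist (completion A) (F n) X + adist (completion A) (F n) (completion_embed A b)"
      using C.dist_triangle[OF X Fn(2) embed_in[of b]] C.dist_commute[OF X Fn(2)] b(1) B by auto
    then show ?thesis using n b by (intro bexI[of _ b]) auto
  qed
  \<comment> \<open>A diagonal choice: the rate \<open>1 / Suc k\<close> makes \<open>b\<close> a
    Cauchy sequence in \<open>B\<close> that is equivalent to any representative \<open>f\<close> of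
    \<open>X\<close>.\<close>
  then have "\<forall>k. \<exists>b\<in>B. adist (completion A) X (completion_embed A b) < 1 / real (Suc k)" by simp
  then obtain b where b: "\<And>k. b k \<in> B" "\<And>k. adist (completion A) X (completion_embed A (b k)) < 1 / real (Suc k)"
    by metis
  obtain f where f: "f \<in> cauchy_seqs A" "X = cls f" using X by (rule classE)
  note in_A = cauchy_seqsD(1)[OF f(1)] subsetD[OF B b(1)]
  \<comment> \<open>Since the embedding is isometric, a distance in \<open>A\<close> can be
    estimated by passing through the point \<open>X\<close> of the completion.\<close>
  have tri: "adist A a (b n) \<le> adist (completion A) X (completion_embed A a) +
      adist (completion A) X (completion_embed A (b n))" if "a \<in> acarrier A" for a n
    using C.dist_triangle[OF embed_in[OF that] X embed_in[OF in_A(2)], of n]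
    by (simp add: C.dist_commute[OF X embed_in] embed_dist that in_A(2))
  have small: "\<exists>M. \<forall>n\<ge>M. adist (completion A) X (completion_embed A (b n)) < e" if "e > 0" for e
  proof -
    obtain M where M: "1 / real (Suc M) < e" using nat_approx_posE[OF \<open>e > 0\<close>] by blast
    have "1 / real (Suc n) \<le> 1 / real (Suc M)" if "n \<ge> M" for n using that by (simp add: frac_le)
    then show ?thesis using b(2) M by (meson less_le_trans order_less_trans)
  qed
  have bc: "b \<in> cauchy_seqs A"
    unfolding cauchy_seqs_def
  proof (intro CollectI conjI allI impI)
    show "range b \<subseteq> acarrier A" using in_A by auto
    fix e :: real assume "e > 0"
    then obtain M where M: "\<forall>n\<ge>M. adist (completion A) X (completion_embed A (b n)) < e/2"
      using small[of "e/2"] by auto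
    have "adist A (b m) (b n) < e" if "m \<ge> M" "n \<ge> M" for m n
      using tri[OF in_A(2), of m n] M[rule_format, OF that(1)] M[rule_format, OF that(2)] by linarith
    then show "\<exists>N. \<forall>m\<ge>N. \<forall>n\<ge>N. adist A (b m) (b n) < e" by blast
  qed
  have "(\<lambda>n. adist A (f n) (b n)) \<longlonglongrightarrow> 0"
  proof (rule LIMSEQ_I)
    fix e :: real assume "e > 0"
    then obtain M where M: "\<forall>n\<ge>M. adist (completion A) X (completion_embed A (b n)) < e/2"
      using small[of "e/2"] by auto
    obtain N where N: "\<forall>m\<ge>N. \<forall>n\<ge>N. adist A (f m) (f n) < e/2"
      using cauchy_seqsD(2)[OF f(1), of "e/2"] \<open>e > 0\<close> by auto
    have "adist A (f n) (b n) < e" if n: "n \<ge> max N M" for n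
    proof -
      have "adist (completion A) X (completion_embed A (f n)) \<le> e/2"
        unfolding f(2) by (rule class_dist_le[where N = N]) (use N n f(1) in_A in \<open>auto intro: less_imp_le\<close>)
      moreover have "adist (completion A) X (completion_embed A (b n)) < e/2" using M n by simp
      ultimately show ?thesis using tri[OF in_A(1), of n n] by linarith
    qed
    then show "\<exists>no. \<forall>n\<ge>no. norm (adist A (f n) (b n) - 0) < e"
      using dist_ge_0[OF in_A] by (intro exI[of _ "max N M"]) auto
  qed
  then have "X = cls b" unfolding f(2) class_eq_iff[OF f(1) bc] .
  then show "X \<in> completion_closure A B" using closureI[OF bc b(1)] by simp
qed

lemma closure_linear_subspace:
  assumes B: "linear_subspace A B"
  shows "linear_subspace (completion A) (completion_closure A B)"
  unfolding linear_subspace_def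
proof (intro conjI ballI allI)
  show "completion_closure A B \<subseteq> acarrier (completion A)" by (rule closure_sub)
  show "azero (completion A) \<in> completion_closure A B"
    unfolding completion_zero using B zero_in by (intro closureI const_cauchy) (auto simp: linear_subspace_def)
  fix X assume "X \<in> completion_closure A B"
  then obtain f where f: "f \<in> cauchy_seqs A" "\<And>n. f n \<in> B" "X = cls f" by (rule closureE) blast
  show "ascale (completion A) z X \<in> completion_closure A B" for z
    unfolding f(3) completion_scale[OF f(1)]
    using B f(2) by (intro closureI cauchy_scale f(1)) (auto simp: linear_subspace_def)
  fix Y assume "Y \<in> completion_closure A B"
  then obtain g where g: "g \<in> cauchy_seqs A" "\<And>n. g n \<in> B" "Y = cls g" by (rule closureE) blast
  show "aplus (completion A) X Y \<in> completion_closure A B"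
    unfolding f(3) g(3) completion_plus[OF f(1) g(1)]
    using B f(2) g(2) by (intro closureI cauchy_plus f(1) g(1)) (auto simp: linear_subspace_def)
qed

text \<open>Three sets are allowed, so that the rule covers products within a subalgebra as well as
  products of an ideal with the whole algebra.\<close>

lemma closure_times:
  assumes prod: "\<And>a b. a \<in> B \<Longrightarrow> b \<in> B' \<Longrightarrow> atimes A a b \<in> D"
    and X: "X \<in> completion_closure A B" and Y: "Y \<in> completion_closure A B'"
  shows "atimes (completion A) X Y \<in> completion_closure A D"
proof -
  obtain f where f: "f \<in> cauchy_seqs A" "\<And>n. f n \<in> B" "X = cls f" using X by (rule closureE) blast
  obtain g where g: "g \<in> cauchy_seqs A" "\<And>n. g n \<in> B'" "Y = cls g" using Y by (rule closureE) blast
  show ?thesis unfolding f(3) g(3) completion_times[OF f(1) g(1)]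
    by (intro closureI cauchy_times f(1) g(1) prod f(2) g(2))
qed

lemma closure_star:
  assumes star: "\<And>a. a \<in> B \<Longrightarrow> astar A a \<in> B" and X: "X \<in> completion_closure A B"
  shows "astar (completion A) X \<in> completion_closure A B"
proof -
  obtain f where f: "f \<in> cauchy_seqs A" "\<And>n. f n \<in> B" "X = cls f" using X by (rule closureE) blast
  show ?thesis unfolding f(3) completion_star[OF f(1)] by (intro closureI cauchy_star f(1) star f(2))
qed

lemma closure_cstar_subalgebra:
  assumes "linear_subspace A B" "\<And>a b. a \<in> B \<Longrightarrow> b \<in> B \<Longrightarrow> atimes A a b \<in> B"
    "\<And>a. a \<in> B \<Longrightarrow> astar A a \<in> B"
  shows "cstar_subalgebra (completion A) (completion_closure A B)"
proof -
  have "B \<subseteq> acarrier A" using assms(1) by (simp add: linear_subspace_def)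
  then show ?thesis unfolding cstar_subalgebra_def
    using closure_linear_subspace[OF assms(1)] closure_closed closure_times[of B B B] closure_star[of B] assms(2,3)
    by blast
qed

end

text \<open>A Neumann series argument that needs neither completeness nor associativity: the powers of
  \<open>d\<close> stay in the coset of \<open>p\<close> modulo \<open>J\<close> and tend to zero.\<close>

lemma (in normed_star_algebra) closed_ideal_memI:
  assumes sub: "R \<subseteq> acarrier A" and J: "closed_ideal (A\<lparr>acarrier := R\<rparr>) J"
    and R: "\<And>a b. a \<in> R \<Longrightarrow> b \<in> R \<Longrightarrow> atimes A a b \<in> R"
    and p: "p \<in> R" and d: "d \<in> R" and pd: "atimes A p d = d"
    and diff: "aplus A p (ascale A (-1) d) \<in> J" and norm: "anorm A d < 1"
  shows "p \<in> J"
proof -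
  define e where "e = rec_nat d (\<lambda>_ x. atimes A x d)"
  have e_simps: "e 0 = d" "e (Suc k) = atimes A (e k) d" for k by (simp_all add: e_def)
  have eR: "e k \<in> R" for k by (induction k) (auto simp: e_simps d R)
  have A: "p \<in> acarrier A" "d \<in> acarrier A" "e k \<in> acarrier A" for k using p d eR sub by auto
  have J_plus: "aplus A a b \<in> J" if "a \<in> J" "b \<in> J" for a b
    using J that by (auto simp: closed_ideal_def linear_subspace_def)
  have J_times: "atimes A a b \<in> J" if "a \<in> J" "b \<in> R" for a b
    using J that by (auto simp: closed_ideal_def)
  have inJ: "aplus A p (ascale A (-1) (e k)) \<in> J" for k
  proof (induction k)
    case 0 then show ?case by (simp add: e_simps diff)
  next
    case (Suc k)
    \<comment> \<open>Here \<open>e k\<close> is the power of \<open>d\<close> with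
      \<open>k + 1\<close> factors, bracketed to the left. As \<open>p d = d\<close>, multiplying
      \<open>p - e k\<close> by \<open>d\<close> gives \<open>d - e (Suc k)\<close>, and adding
      \<open>p - d\<close> cancels \<open>d\<close>.\<close>
    have "atimes A (aplus A p (ascale A (-1) (e k))) d = aplus A d (ascale A (-1) (e (Suc k)))"
      using diff_times[of p "e k" d] A by (simp add: pd e_simps)
    then have "aplus A (aplus A p (ascale A (-1) d)) (aplus A d (ascale A (-1) (e (Suc k)))) \<in> J"
      using J_plus[OF diff J_times[OF Suc d]] by simp
    then show ?case using diff_plus_diff[of p d "e (Suc k)"] A by simp
  qed
  have le: "anorm A (e k) \<le> anorm A d ^ Suc k" for k
  proof (induction k)
    case 0 then show ?case by (simp add: e_simps)
  next
    case (Suc k)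
    have "anorm A (e (Suc k)) \<le> anorm A (e k) * anorm A d" by (simp add: e_simps norm_times A)
    also have "\<dots> \<le> anorm A d ^ Suc k * anorm A d" using Suc A by (intro mult_right_mono norm_ge_0) auto
    finally show ?case by (simp add: mult.commute)
  qed
  have dist: "adist A (aplus A p (ascale A (-1) (e k))) p = anorm A (e k)" for k
  proof -
    have "aplus A (aplus A p (ascale A (-1) (e k))) (ascale A (-1) p) =
        aplus A (aplus A p (ascale A (-1) p)) (ascale A (-1) (e k))"
      using A by (simp add: plus_ac closed_ops)
    then show ?thesis using A by (simp add: adist_def plus_minus zero_plus closed_ops norm_scale)
  qed
  have "(\<lambda>k. anorm A d ^ Suc k) \<longlonglongrightarrow> 0"
    using LIMSEQ_power_zero[of "anorm A d"] norm norm_ge_0[OF A(2)] by (intro LIMSEQ_Suc) auto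
  then have "(\<lambda>k. anorm A (e k)) \<longlonglongrightarrow> 0"
    by (rule tendsto_sandwich[OF _ _ tendsto_const, rotated 2]) (use le A in \<open>auto simp: norm_ge_0\<close>)
  then have "(\<lambda>k. adist (A\<lparr>acarrier := R\<rparr>) (aplus A p (ascale A (-1) (e k))) p) \<longlonglongrightarrow> 0"
    using dist by (simp add: adist_def)
  moreover have "anorm_closed (A\<lparr>acarrier := R\<rparr>) J" using J by (simp add: closed_ideal_def)
  moreover have "range (\<lambda>k. aplus A p (ascale A (-1) (e k))) \<subseteq> J" using inJ by auto
  ultimately show ?thesis using p unfolding anorm_closed_def by simp
qed

section \<open>The groupoid of a subshift\<close>

lemma funpow_shift: "(shift ^^ k) x = suffix k x"
  by (induction k arbitrary: x) (auto simp: shift_def fun_eq_iff funpow_Suc_right simp del: funpow.simps)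

lemma suffix_conc_length [simp]: "suffix (length u) (u \<frown> w) = w"
  by (simp add: fun_eq_iff)

lemma suffix_eq_mono:
  "\<lbrakk>suffix a x = suffix b y; a' = a + d; b' = b + d\<rbrakk> \<Longrightarrow> suffix a' x = suffix b' y"
  by (metis suffix_suffix)

lemma conc_eq_iff: "length u = a \<Longrightarrow> x = u \<frown> w \<longleftrightarrow> suffix a x = w \<and> (\<forall>i<a. x i = u ! i)"
proof -
  assume a: "length u = a"
  have "x = u \<frown> w" if "suffix a x = w" "\<forall>i<a. x i = u ! i"
  proof
    fix i
    show "x i = (u \<frown> w) i" using that a by (cases "i < a") auto
  qed
  then show ?thesis using a by auto
qed

lemma infsum_single_nonzero:
  fixes f :: "'a \<Rightarrow> complex"
  assumes "a \<in> A" "\<And>b. b \<in> A \<Longrightarrow> b \<noteq> a \<Longrightarrow> f b = 0"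
  shows "infsum f A = f a"
proof -
  have "infsum f A = infsum f {a}" by (rule infsum_cong_neutral) (use assms in auto)
  then show ?thesis by simp
qed

lemma open_contains_prefix_cylinder:
  fixes U :: "(nat \<Rightarrow> nat) set"
  assumes "open U" "x \<in> U" shows "\<exists>L. \<forall>y. (\<forall>i<L. y i = x i) \<longrightarrow> y \<in> U"
proof -
  have "openin (product_topology (\<lambda>i. euclidean) UNIV) U" using assms(1) by (simp add: euclidean_product_topology)
  from product_topology_open_contains_basis[OF this assms(2)]
  obtain X where X: "x \<in> (\<Pi>\<^sub>E i\<in>UNIV. X i)" "finite {i. X i \<noteq> UNIV}" "(\<Pi>\<^sub>E i\<in>UNIV. X i) \<subseteq> U"
    by auto
  obtain L where L: "\<And>i. X i \<noteq> UNIV \<Longrightarrow> i < L"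
    using X(2) by (metis (mono_tags, lifting) finite_nat_set_iff_bounded mem_Collect_eq)
  have "y \<in> U" if "\<forall>i<L. y i = x i" for y
  proof -
    have "y i \<in> X i" for i using X(1) L[of i] that by (cases "X i = UNIV") (auto simp: PiE_iff)
    then show ?thesis using X(3) by (auto simp: PiE_iff subset_eq)
  qed
  then show ?thesis by blast
qed

lemma continuous_conc_suffix: "continuous_on UNIV (\<lambda>y :: nat \<Rightarrow> nat. v \<frown> suffix L y)"
proof (rule continuous_on_coordinatewise_then_product)
  fix i show "continuous_on UNIV (\<lambda>y :: nat \<Rightarrow> nat. (v \<frown> suffix L y) i)"
    by (cases "i < length v") simp_all
qed

lemma triple_set_eqI: "(\<And>x l y. (x, l, y) \<in> A \<longleftrightarrow> (x, l, y) \<in> B) \<Longrightarrow> A = B"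
  by auto

text \<open>The product of \<open>g\<close> with the inverse of \<open>h\<close>, for arrows with a
  common source. Being total in the coordinates, it can serve as the index of a matrix
  entry.\<close>

definition quot :: "arrow \<Rightarrow> arrow \<Rightarrow> arrow" where
  "quot g h = (fst g, fst (snd g) - fst (snd h), fst h)"

lemma quot_simps [simp]: "quot (x, k, y) (z, l, y') = (x, k - l, z)"
  by (simp add: quot_def)

locale infinite_subshift =
  fixes n :: nat and S :: "(nat \<Rightarrow> nat) set"
  assumes subshift: "one_sided_subshift n S"
    and infinite_S: "infinite S"
begin

abbreviation G :: "arrow groupoid" where "G \<equiv> subshift_groupoid S"

abbreviation level :: "int \<Rightarrow> nat \<Rightarrow> arrow set" where "level \<equiv> subshift_arrows_level S"

definition arrows :: "arrow set" where "arrows = topspace (gtop G)"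

definition words :: "nat list set" where "words = {u. set u \<subseteq> {1..n}}"

lemma closed_S: "closed S" using subshift by (simp add: one_sided_subshift_def)

lemma letter: "x \<in> S \<Longrightarrow> x i \<in> {1..n}"
  using subshift by (auto simp: one_sided_subshift_def full_shift_def subset_eq)

lemma suffix_in: "x \<in> S \<Longrightarrow> suffix k x \<in> S"
proof (induction k)
  case (Suc k)
  have "suffix (Suc k) x = shift (suffix k x)" by (simp add: shift_def fun_eq_iff)
  then show ?case using Suc subshift unfolding one_sided_subshift_def by blast
qed simp

lemma conc_tail_in: "u \<frown> w \<in> S \<Longrightarrow> w \<in> S"
  by (metis suffix_conc_length suffix_in)

lemma left_extension: "x \<in> S \<Longrightarrow> \<exists>u. length u = k \<and> u \<frown> x \<in> S"
proof (induction k)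
  case 0 then show ?case by (intro exI[of _ "[]"]) simp
next
  case (Suc k)
  then obtain u where u: "length u = k" "u \<frown> x \<in> S" by blast
  then obtain y where y: "y \<in> S" "u \<frown> x = shift y" using subshift unfolding one_sided_subshift_def by blast
  have "y = (y 0 # u) \<frown> x"
  proof
    fix i show "y i = ((y 0 # u) \<frown> x) i"
      using fun_cong[OF y(2), of "i - 1"] by (cases i) (auto simp: shift_def conc_def)
  qed
  then show ?case using y(1) u(1) by (intro exI[of _ "y 0 # u"]) auto
qed

lemma words_conc: "u \<frown> w \<in> S \<Longrightarrow> u \<in> words"
  using letter[of "u \<frown> w"] unfolding words_def
  by (metis (no_types, lifting) CollectI conc_fst in_set_conv_nth subsetI)

lemma finite_words: "finite {u \<in> words. length u \<le> N}"
  unfolding words_def using finite_lists_length_le[of "{1..n}" N] by simp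

lemma compact_S: "compact S"
proof -
  have "compactin (product_topology (\<lambda>i. euclidean) UNIV) (Pi\<^sub>E UNIV (\<lambda>i::nat. {1..n}))"
    by (subst compactin_PiE) (auto intro: finite_imp_compact)
  then have "compact (Pi\<^sub>E UNIV (\<lambda>i::nat. {1..n}))" by (simp add: euclidean_product_topology)
  moreover have "S \<subseteq> Pi\<^sub>E UNIV (\<lambda>i::nat. {1..n})" using letter by auto
  ultimately show ?thesis using closed_S by (metis compact_Int_closed inf.absorb2)
qed

lemma mem_arrows:
  "(x, k, y) \<in> arrows \<longleftrightarrow> x \<in> S \<and> y \<in> S \<and> (\<exists>a b. k = int a - int b \<and> suffix a x = suffix b y)"
  by (simp add: arrows_def topspace_subshift_groupoid funpow_shift)

lemma mem_arrowsI:
  "\<lbrakk>x \<in> S; y \<in> S; k = int a - int b; suffix a x = suffix b y\<rbrakk> \<Longrightarrow> (x, k, y) \<in> arrows"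
  unfolding mem_arrows by blast

lemma arrowsI: "\<lbrakk>u \<frown> w \<in> S; v \<frown> w \<in> S\<rbrakk> \<Longrightarrow> (u \<frown> w, int (length u) - int (length v), v \<frown> w) \<in> arrows"
  unfolding mem_arrows by (metis suffix_conc_length)

lemma arrows_inv: "(x, k, y) \<in> arrows \<Longrightarrow> (y, - k, x) \<in> arrows"
  unfolding mem_arrows by (metis minus_diff_eq)

lemma arrows_unit: "x \<in> S \<Longrightarrow> (x, 0, x) \<in> arrows"
  unfolding mem_arrows by (metis diff_self)

lemma arrows_comp:
  assumes "(x, k, y) \<in> arrows" "(y, l, z) \<in> arrows" shows "(x, k + l, z) \<in> arrows"
proof -
  obtain a b where ab: "k = int a - int b" "suffix a x = suffix b y" using assms by (auto simp: mem_arrows)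
  obtain c d where cd: "l = int c - int d" "suffix c y = suffix d z" using assms by (auto simp: mem_arrows)
  have "suffix (a + c) x = suffix (d + b) z"
    using suffix_eq_mono[OF ab(2), of "a + c" c "b + c"] suffix_eq_mono[OF cd(2), of "c + b" b "d + b"]
    by (simp add: add.commute)
  moreover have "k + l = int (a + c) - int (d + b)" using ab cd by simp
  ultimately show ?thesis using assms unfolding mem_arrows by blast
qed

section \<open>Source fibres and convolution\<close>

definition fibre :: "(nat \<Rightarrow> nat) \<Rightarrow> arrow set" where
  "fibre y = {g \<in> arrows. snd (snd g) = y}"

lemma mem_fibre: "(x, k, z) \<in> fibre y \<longleftrightarrow> z = y \<and> (x, k, y) \<in> arrows"
  by (auto simp: fibre_def)

lemma gsrc_eq: "gsrc G (x, k, y) = (y, 0, y)"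
  by (simp add: gsrc_def subshift_groupoid_def)

lemma grng_eq: "grng G (x, k, y) = (x, 0, x)"
  by (simp add: grng_def subshift_groupoid_def)

lemma gunits_eq: "gunits G = (\<lambda>x. (x, 0, x)) ` S"
proof
  show "gunits G \<subseteq> (\<lambda>x. (x, 0, x)) ` S"
    by (auto simp: gunits_def gsrc_eq mem_arrows simp flip: arrows_def)
  show "(\<lambda>x. (x, 0, x)) ` S \<subseteq> gunits G"
  proof
    fix g :: arrow assume "g \<in> (\<lambda>x. (x, 0, x)) ` S"
    then obtain x where x: "x \<in> S" "g = (x, 0, x)" by blast
    then have "g = gsrc G (x, 0, x)" by (simp add: gsrc_eq)
    then show "g \<in> gunits G" unfolding gunits_def using arrows_unit[OF x(1)] arrows_def by blast
  qed
qed

lemma gsrc_fibre_eq: "gsrc_fibre G (y, 0, y) = fibre y"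
  by (auto simp: gsrc_fibre_def fibre_def gsrc_eq simp flip: arrows_def)

lemma quotient_in: "\<lbrakk>g \<in> fibre y; h \<in> fibre y\<rbrakk> \<Longrightarrow> quot g h \<in> arrows"
  by (cases g; cases h) (auto simp: mem_fibre dest: arrows_inv arrows_comp)

text \<open>A factorization is determined by its second factor \<open>h\<close>, which can be any
  arrow with the same source; the first factor is then forced. Convolution thereby becomes a matrix
  acting on the source fibre.\<close>

lemma gfactorizations_eq:
  "gfactorizations G (x, k, y) =
    (if (x, k, y) \<in> arrows then (\<lambda>h. (quot (x, k, y) h, h)) ` fibre y else {})"
proof -
  have "(g1, g2) \<in> gfactorizations G (x, k, y) \<longleftrightarrow>
     (x, k, y) \<in> arrows \<and> g2 \<in> fibre y \<and> g1 = quot (x, k, y) g2" for g1 g2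
  proof -
    obtain x1 k1 y1 where g1: "g1 = (x1, k1, y1)" by (cases g1)
    obtain x2 k2 y2 where g2: "g2 = (x2, k2, y2)" by (cases g2)
    have "(g1, g2) \<in> gfactorizations G (x, k, y) \<longleftrightarrow>
       g1 \<in> arrows \<and> g2 \<in> arrows \<and> y1 = x2 \<and> x1 = x \<and> y2 = y \<and> k = k1 + k2"
      unfolding g1 g2 by (auto simp: gfactorizations_def gsrc_eq grng_eq simp flip: arrows_def)
        (auto simp: subshift_groupoid_def)
    also have "\<dots> \<longleftrightarrow> (x, k, y) \<in> arrows \<and> g2 \<in> fibre y \<and> g1 = quot (x, k, y) g2"
      using quotient_in[of "(x, k, y)" y g2] unfolding g1 g2
      by (auto simp: mem_fibre intro: arrows_comp)
    finally show ?thesis .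
  qed
  then have "p \<in> gfactorizations G (x, k, y) \<longleftrightarrow>
     (x, k, y) \<in> arrows \<and> p \<in> (\<lambda>h. (quot (x, k, y) h, h)) ` fibre y" for p
    by (cases p) (simp only: image_iff prod.inject, blast)
  then show ?thesis by (simp add: set_eq_iff)
qed

lemma gconv_eq:
  "gconv G f f' (x, k, y) =
    (if (x, k, y) \<in> arrows then \<Sum>\<^sub>\<infinity>h\<in>fibre y. f (quot (x, k, y) h) * f' h else 0)"
proof (cases "(x, k, y) \<in> arrows")
  case True
  have "inj_on (\<lambda>h. (quot (x, k, y) h, h)) (fibre y)" by (auto simp: inj_on_def)
  then show ?thesis
    unfolding gconv_def gfactorizations_eq using True
    by (simp add: infsum_reindex o_def case_prod_unfold)
qed (simp add: gconv_def gfactorizations_eq)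

text \<open>An increasing exhaustion of the groupoid by sets that turn out to be compact, open and
  closed. Bounding both exponents, and not only the degree, is what makes source fibres meet these
  sets in finitely many arrows.\<close>

definition lev :: "nat \<Rightarrow> arrow set" where
  "lev N = {(x, k, y). x \<in> S \<and> y \<in> S \<and>
     (\<exists>a\<le>N. \<exists>b\<le>N. k = int a - int b \<and> suffix a x = suffix b y)}"

lemma levI:
  "\<lbrakk>x \<in> S; y \<in> S; a \<le> N; b \<le> N; k = int a - int b; suffix a x = suffix b y\<rbrakk> \<Longrightarrow> (x, k, y) \<in> lev N"
  unfolding lev_def by blast

lemma levE:
  assumes "g \<in> lev N"
  obtains x a b y where "g = (x, int a - int b, y)" "x \<in> S" "y \<in> S" "a \<le> N" "b \<le> N"
    "suffix a x = suffix b y"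
  using assms unfolding lev_def by blast

lemma lev_mono: "N \<le> M \<Longrightarrow> lev N \<subseteq> lev M"
proof
  fix g assume "N \<le> M" "g \<in> lev N"
  then show "g \<in> lev M" by (elim levE) (hypsubst, rule levI, auto)
qed

lemma lev_sub_arrows: "lev N \<subseteq> arrows"
  unfolding lev_def mem_arrows subset_eq by clarify (unfold mem_arrows, blast)

lemma arrows_lev: "g \<in> arrows \<Longrightarrow> \<exists>N. g \<in> lev N"
proof (cases g)
  case (fields x k y)
  assume "g \<in> arrows"
  then obtain a b where "x \<in> S" "y \<in> S" "k = int a - int b" "suffix a x = suffix b y"
    unfolding fields mem_arrows by blast
  then have "g \<in> lev (max a b)" unfolding fields by (intro levI[of x y a _ b]) auto
  then show ?thesis ..
qed

lemma lev_inv: "(x, k, y) \<in> lev N \<longleftrightarrow> (y, - k, x) \<in> lev N"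
proof -
  have "(y, - k, x) \<in> lev N" if "(x, k, y) \<in> lev N" for x k y
    using that unfolding lev_def by clarsimp (metis minus_diff_eq)
  from this[of x k y] this[of y "-k" x] show ?thesis by auto
qed

lemma lev_comp:
  assumes "(x, k, y) \<in> lev N" "(y, l, z) \<in> lev M" shows "(x, k + l, z) \<in> lev (N + M)"
proof -
  obtain a b where ab: "a \<le> N" "b \<le> N" "k = int a - int b" "suffix a x = suffix b y" using assms by (auto simp: lev_def)
  obtain c d where cd: "c \<le> M" "d \<le> M" "l = int c - int d" "suffix c y = suffix d z" using assms by (auto simp: lev_def)
  have "suffix (a + c) x = suffix (d + b) z"
    using suffix_eq_mono[OF ab(4), of "a + c" c "b + c"] suffix_eq_mono[OF cd(4), of "c + b" b "d + b"]
    by (simp add: add.commute)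
  moreover have "k + l = int (a + c) - int (d + b)" using ab cd by simp
  moreover have "a + c \<le> N + M" "d + b \<le> N + M" using ab cd by auto
  ultimately show ?thesis using assms unfolding lev_def by blast
qed

text \<open>For \<open>f\<close> supported in \<open>lev N\<close>, the positions in the row of
  \<open>g\<close> at which the matrix of \<open>f\<close> can be non-zero.\<close>

definition row :: "nat \<Rightarrow> arrow \<Rightarrow> arrow set" where
  "row N g = {h \<in> fibre (snd (snd g)). quot g h \<in> lev N}"

definition row_bound :: "nat \<Rightarrow> nat" where
  "row_bound N = card ({..N} \<times> {..N} \<times> {u \<in> words. length u \<le> N})"

text \<open>The range of \<open>h\<close> arises from that of \<open>g\<close> by deleting
  \<open>a\<close> letters and prepending a word of length \<open>b\<close>. The exponents and the
  word come from a finite set independent of \<open>g\<close>, which gives the uniform bound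
  \<open>row_bound N\<close>.\<close>

lemma row_sub:
  "row N (x, k, y) \<subseteq> (\<lambda>(a, b, p). (p \<frown> suffix a x, k - int a + int b, y)) `
     ({..N} \<times> {..N} \<times> {u \<in> words. length u \<le> N})"
proof
  fix h assume h: "h \<in> row N (x, k, y)"
  obtain z l where zl: "h = (z, l, y)" using h by (cases h) (auto simp: row_def mem_fibre)
  then obtain a b where ab: "a \<le> N" "b \<le> N" "k - l = int a - int b" "suffix a x = suffix b z" "z \<in> S"
    using h by (auto simp: row_def lev_def)
  then have z: "z = prefix b z \<frown> suffix a x" by simp
  have "prefix b z \<in> words" using z ab(5) words_conc by metis
  then have "(a, b, prefix b z) \<in> {..N} \<times> {..N} \<times> {u \<in> words. length u \<le> N}" using ab by auto
  moreover have "h = (\<lambda>(a, b, p). (p \<frown> suffix a x, k - int a + int b, y)) (a, b, prefix b z)"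
    using zl z ab by auto
  ultimately show "h \<in> (\<lambda>(a, b, p). (p \<frown> suffix a x, k - int a + int b, y)) `
     ({..N} \<times> {..N} \<times> {u \<in> words. length u \<le> N})" by blast
qed

lemma finite_row: "finite (row N g)"
  by (cases g) (auto intro!: finite_subset[OF row_sub] finite_imageI finite_cartesian_product finite_words)

lemma card_row: "card (row N g) \<le> row_bound N"
proof (cases g)
  case (fields x k y)
  have fin: "finite ({..N} \<times> {..N} \<times> {u \<in> words. length u \<le> N})"
    by (intro finite_cartesian_product finite_atMost finite_words)
  then show ?thesis
    unfolding fields row_bound_def using row_sub[of N x k y] by (rule surj_card_le)
qed

text \<open>\<open>lev N\<close> is closed under inversion, so columns are rows and the row bound is
  also a column bound.\<close>

lemma row_commute: "g \<in> fibre y \<Longrightarrow> h \<in> fibre y \<Longrightarrow> h \<in> row N g \<longleftrightarrow> g \<in> row N h"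
  using lev_inv[of "fst g" "fst (snd g) - fst (snd h)" "fst h" N]
  by (cases g; cases h) (simp add: row_def mem_fibre)

text \<open>The freedom in \<open>H\<close> allows several entries of a convolution to be summed
  over one common index set.\<close>

lemma gconv_sum:
  assumes f: "\<And>g. f g \<noteq> 0 \<Longrightarrow> g \<in> lev N" and g: "(x, k, y) \<in> arrows"
    and H: "finite H" "row N (x, k, y) \<subseteq> H" "H \<subseteq> fibre y"
  shows "gconv G f f' (x, k, y) = (\<Sum>h\<in>H. f (quot (x, k, y) h) * f' h)"
proof -
  have "(\<Sum>\<^sub>\<infinity>h\<in>fibre y. f (quot (x, k, y) h) * f' h) =
      (\<Sum>\<^sub>\<infinity>h\<in>H. f (quot (x, k, y) h) * f' h)"
    by (rule infsum_cong_neutral) (use H in \<open>auto simp: row_def dest: f\<close>)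
  then show ?thesis using g H by (simp add: gconv_eq)
qed

lemma gconv_row:
  assumes f: "\<forall>g. f g \<noteq> 0 \<longrightarrow> g \<in> lev N" and g: "(x, k, y) \<in> arrows"
  shows "gconv G f f' (x, k, y) = (\<Sum>h\<in>row N (x, k, y). f (quot (x, k, y) h) * f' h)"
  by (rule gconv_sum[OF _ g finite_row]) (use f in \<open>auto simp: row_def\<close>)

section \<open>The topology of the groupoid\<close>

lemma mem_level: "(x, l, y) \<in> level k m \<longleftrightarrow>
  x \<in> S \<and> y \<in> S \<and> l = k \<and> (\<forall>i\<ge>m. suffix (nat (k + int i)) x = suffix i y)"
  by (simp add: subshift_arrows_level_def funpow_shift)

lemma mem_level':
  assumes "int m + k \<ge> 0"
  shows "(x, l, y) \<in> level k m \<longleftrightarrow>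
    x \<in> S \<and> y \<in> S \<and> l = k \<and> suffix (nat (k + int m)) x = suffix m y"
proof -
  have "suffix (nat (k + int i)) x = suffix i y"
    if "suffix (nat (k + int m)) x = suffix m y" "i \<ge> m" for i
    by (rule suffix_eq_mono[OF that(1), of _ "i - m"]) (use that assms in auto)
  then show ?thesis unfolding mem_level by auto
qed

text \<open>Both final topologies collapse into one test on the levels: a level lies in a single
  degree, so intersecting with the degree first changes nothing.\<close>

lemma openin_gtop: "openin (gtop G) U \<longleftrightarrow> U \<subseteq> arrows \<and>
    (\<forall>k m. int m + k \<ge> 0 \<longrightarrow>
      openin (top_of_set (level k m)) (U \<inter> level k m))"
proof -
  have top: "arrows = (\<Union>k. \<Union>m\<in>{m. int m + k \<ge> 0}. level k m)"
    unfolding arrows_def subshift_groupoid_def subshift_topology_degree_def groupoid.simps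
        topspace_union_topology topspace_euclidean_subtopology by simp
  have sub: "level k m \<subseteq> {g. fst (snd g) = k}" for k m
    by (auto simp: subshift_arrows_level_def)
  have int: "V \<inter> (\<Union>m\<in>I. level k m) \<inter> level k m =
      V \<inter> level k m" if "m \<in> I" for V I k m using that by auto
  show ?thesis
    unfolding subshift_groupoid_def subshift_topology_degree_def groupoid.simps
      openin_union_topology topspace_union_topology topspace_euclidean_subtopology
    unfolding top by (auto simp: int)
qed

text \<open>A witness \<open>C\<close> that is clopen in the ambient product space tests the set
  and, through \<open>- C\<close>, its complement on the same level.\<close>

lemma clopen_gtop:
  assumes "U \<subseteq> arrows"
    and "\<And>k m. int m + k \<ge> 0 \<Longrightarrow> \<exists>C. open C \<and> closed C \<and>
      U \<inter> level k m = level k m \<inter> C"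
  shows "openin (gtop G) U" "closedin (gtop G) U"
proof -
  show "openin (gtop G) U" unfolding openin_gtop openin_open using assms by blast
  have sub: "level k m \<subseteq> arrows" if "int m + k \<ge> 0" for k m
    using that by (auto simp: mem_level' intro!: mem_arrowsI[of _ _ _ "nat (k + int m)" m])
  have "openin (gtop G) (arrows - U)"
    unfolding openin_gtop
  proof (intro conjI allI impI)
    fix k m assume km: "int m + k \<ge> 0"
    then obtain C where C: "closed C" "U \<inter> level k m = level k m \<inter> C"
      using assms(2) by blast
    have "(arrows - U) \<inter> level k m = level k m \<inter> - C"
      using C(2) sub[OF km] by blast
    then show "openin (top_of_set (level k m)) ((arrows - U) \<inter> level k m)"
      using C(1) by (auto simp: openin_open open_Compl)
  qed auto
  then show "closedin (gtop G) U" using assms(1) by (simp add: closedin_def arrows_def)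
qed

lemma continuous_coordinates:
  "continuous_on A (\<lambda>g :: arrow. fst g i)" "continuous_on A (\<lambda>g :: arrow. snd (snd g) i)"
  by (rule continuous_on_product_then_coordinatewise, rule continuous_on_fst, rule continuous_on_id)
    (rule continuous_on_product_then_coordinatewise, rule continuous_on_snd, rule continuous_on_snd, rule continuous_on_id)

text \<open>A single equation between letters is clopen because letters are discrete; finiteness of
  \<open>P\<close> keeps the intersection open.\<close>

lemma clopen_agree:
  fixes P :: "(nat \<times> nat) set"
  assumes "finite P"
  shows "open {g :: arrow. \<forall>(i, j)\<in>P. fst g i = snd (snd g) j}"
    "closed {g :: arrow. \<forall>(i, j)\<in>P. fst g i = snd (snd g) j}"
proof -
  note c = continuous_coordinates[of UNIV]
  have eq: "{g :: arrow. \<forall>(i, j)\<in>P. fst g i = snd (snd g) j} = (\<Inter>p\<in>P. {g. fst g (fst p) = snd (snd g) (snd p)})"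
    by (auto simp: case_prod_unfold)
  show "closed {g :: arrow. \<forall>(i, j)\<in>P. fst g i = snd (snd g) j}" unfolding eq
    by (intro closed_INT ballI closed_Collect_eq c)
  have "open {g :: arrow. fst g i = snd (snd g) j}" for i j
  proof -
    have "{g :: arrow. fst g i = snd (snd g) j} = (\<Union>a. (\<lambda>g. fst g i) -` {a} \<inter> (\<lambda>g. snd (snd g) j) -` {a})"
      by auto
    moreover have "open \<dots>" by (intro open_UN ballI open_Int open_vimage c open_discrete)
    ultimately show ?thesis by simp
  qed
  then show "open {g :: arrow. \<forall>(i, j)\<in>P. fst g i = snd (snd g) j}" unfolding eq
    using assms by (intro open_INT) auto
qed

lemma clopen_cylinder:
  fixes u :: "nat list"
  shows "open {x. \<forall>i<length u. x i = u ! i}" "closed {x. \<forall>i<length u. x i = u ! i}"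
proof -
  have c: "continuous_on UNIV (\<lambda>x :: nat \<Rightarrow> nat. x i)" for i by simp
  have eq: "{x. \<forall>i<length u. x i = u ! i} = (\<Inter>i\<in>{..<length u}. (\<lambda>x. x i) -` {u ! i})" by auto
  show "open {x. \<forall>i<length u. x i = u ! i}" unfolding eq
    by (intro open_INT ballI open_vimage c open_discrete) auto
  show "closed {x. \<forall>i<length u. x i = u ! i}" unfolding eq
    by (intro closed_INT ballI closed_vimage c) auto
qed

lemma suffix_eq_iff: "a \<le> c \<Longrightarrow> suffix a x = w \<longleftrightarrow> suffix c x = suffix (c - a) w \<and> (\<forall>i<c - a. x (a + i) = w i)"
proof
  assume ac: "a \<le> c" and r: "suffix c x = suffix (c - a) w \<and> (\<forall>i<c - a. x (a + i) = w i)"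
  show "suffix a x = w"
  proof
    fix i
    show "suffix a x i = w i"
    proof (cases "i < c - a")
      case False
      then have "w i = suffix (c - a) w (i - (c - a))" by simp
      also have "\<dots> = suffix c x (i - (c - a))" using r by simp
      also have "\<dots> = x (a + i)" using ac False by (simp add: add.commute)
      finally show ?thesis by simp
    qed (use r in simp)
  qed
qed auto

text \<open>On a fixed level the tails agree from position \<open>m\<close> of \<open>y\<close>
  onwards anyway. Hence equality of the longer tails, a priori infinitely many conditions, amounts
  to agreement at the \<open>m - b\<close> remaining positions (none if \<open>b \<ge> m\<close>),
  which is a clopen condition.\<close>

lemma level_suffix_iff:
  assumes km: "int m + k \<ge> 0" and g: "(x, k, y) \<in> level k m" and k: "k = int a - int b"
  shows "suffix a x = suffix b y \<longleftrightarrow>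
     (x, k, y) \<in> {g. \<forall>(i, j)\<in>(\<lambda>i. (a + i, b + i)) ` {..<m - b}. fst g i = snd (snd g) j}"
proof -
  define c where "c = max b m"
  have c: "a \<le> nat (k + int c)" "nat (k + int c) - a = c - b" "c - b = m - b"
    "b + (m - b) = c" using k by (auto simp: c_def)
  have "suffix (nat (k + int c)) x = suffix c y" using g by (simp add: mem_level c_def)
  then show ?thesis using suffix_eq_iff[OF c(1), of x "suffix b y"] by (auto simp: c)
qed

lemma clopen_lev: "openin (gtop G) (lev N)" "closedin (gtop G) (lev N)"
proof -
  have *: "\<exists>C. open C \<and> closed C \<and>
      lev N \<inter> level k m = level k m \<inter> C"
    if km: "int m + k \<ge> 0" for k m
  proof (cases "\<bar>k\<bar> \<le> int N")
    case True
    \<comment> \<open>Among the pairs in \<open>{..N}\<close> with difference \<open>k\<close>, the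
      pair \<open>(a, b)\<close> is the largest. Equality of tails for any other such pair implies
      it for this one, so in degree \<open>k\<close> a single equation describes
      \<open>lev N\<close>.\<close>
    define b where "b = (if k \<ge> 0 then nat (int N - k) else N)"
    define a where "a = (if k \<ge> 0 then N else nat (int N + k))"
    have ab: "k = int a - int b" "a \<le> N" "b \<le> N" "\<And>c d. c \<le> N \<Longrightarrow> d \<le> N \<Longrightarrow> k = int c - int d \<Longrightarrow> c \<le> a \<and> a - c = b - d"
      using True by (auto simp: a_def b_def)
    have lev_iff: "(x, k, y) \<in> lev N \<longleftrightarrow> x \<in> S \<and> y \<in> S \<and> suffix a x = suffix b y" for x y
    proof
      assume "(x, k, y) \<in> lev N"
      then obtain c d where cd: "c \<le> N" "d \<le> N" "k = int c - int d" "suffix c x = suffix d y" "x \<in> S" "y \<in> S"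
        by (auto simp: lev_def)
      have "suffix a x = suffix b y"
        by (rule suffix_eq_mono[OF cd(4), of _ "a - c"]) (use ab(1) ab(4)[OF cd(1-3)] cd(3) in auto)
      then show "x \<in> S \<and> y \<in> S \<and> suffix a x = suffix b y" using cd by simp
    qed (use ab in \<open>auto simp: lev_def\<close>)
    show ?thesis
    proof (intro exI conjI)
      let ?C = "{g :: arrow. \<forall>(i, j)\<in>(\<lambda>i. (a + i, b + i)) ` {..<m - b}. fst g i = snd (snd g) j}"
      show "open ?C" "closed ?C" by (rule clopen_agree; simp)+
      have "(x, l, y) \<in> lev N \<inter> level k m \<longleftrightarrow> (x, l, y) \<in> level k m \<inter> ?C" for x l y
      proof (cases "(x, l, y) \<in> level k m")
        case True
        then have l: "l = k" "x \<in> S" "y \<in> S" by (auto simp: mem_level)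
        show ?thesis using level_suffix_iff[OF km True[unfolded l] ab(1)] True l by (simp only: Int_iff lev_iff) auto
      qed auto
      then show "lev N \<inter> level k m = level k m \<inter> ?C"
        by (rule triple_set_eqI)
    qed
  next
    case False
    then have "lev N \<inter> level k m = level k m \<inter> {}"
      by (auto simp: lev_def mem_level)
    then show ?thesis by blast
  qed
  show "openin (gtop G) (lev N)" "closedin (gtop G) (lev N)"
    by (rule clopen_gtop[OF lev_sub_arrows *], assumption)+
qed

text \<open>In the product topology a level is closed in the compact set of triples over
  \<open>S\<close> of degree \<open>k\<close>. Openness in the groupoid is tested on levels, so the
  inclusion of the level is continuous and carries compactness over.\<close>

lemma compactin_level:
  assumes "int m + k \<ge> 0" shows "compactin (gtop G) (level k m)"
proof -
  let ?L = "level k m"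
  have "?L = (S \<times> {k} \<times> S) \<inter> {g. suffix (nat (k + int m)) (fst g) = suffix m (snd (snd g))}"
    using mem_level'[OF assms] by auto
  also have "\<dots> = (S \<times> {k} \<times> S) \<inter> (\<Inter>i. {g. fst g (nat (k + int m) + i) = snd (snd g) (m + i)})"
    by (auto simp: fun_eq_iff)
  finally have eq: "?L = (S \<times> {k} \<times> S) \<inter> (\<Inter>i. {g. fst g (nat (k + int m) + i) = snd (snd g) (m + i)})" .
  have "compact ?L" unfolding eq
    by (intro compact_Int_closed compact_Times compact_S compact_insert compact_empty closed_INT ballI
        closed_Collect_eq continuous_coordinates)
  then have "compactin (top_of_set ?L) ?L" by simp
  moreover have "continuous_map (top_of_set ?L) (gtop G) (\<lambda>g. g)"
    unfolding continuous_map_def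
  proof (intro conjI allI impI)
    show "(\<lambda>g. g) \<in> topspace (top_of_set ?L) \<rightarrow> topspace (gtop G)"
      using assms by (auto simp: mem_level' simp flip: arrows_def
          intro!: mem_arrowsI[of _ _ _ "nat (k + int m)" m])
    fix U assume "openin (gtop G) U"
    then have "openin (top_of_set ?L) (U \<inter> ?L)" using assms by (simp add: openin_gtop)
    moreover have "{g \<in> topspace (top_of_set ?L). g \<in> U} = U \<inter> ?L" by auto
    ultimately show "openin (top_of_set ?L) {g \<in> topspace (top_of_set ?L). g \<in> U}" by simp
  qed
  ultimately have "compactin (gtop G) ((\<lambda>g. g) ` ?L)" by (rule image_compactin)
  then show ?thesis by simp
qed

lemma compactin_lev: "compactin (gtop G) (lev N)"
proof (rule closed_compactin[OF _ _ clopen_lev(2)])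
  let ?K = "\<Union> ((\<lambda>(a, b). level (int a - int b) b) ` ({..N} \<times> {..N}))"
  show "compactin (gtop G) ?K"
  proof (rule compactin_Union)
    fix K assume "K \<in> (\<lambda>(a, b). level (int a - int b) b) ` ({..N} \<times> {..N})"
    then obtain a b where "K = level (int a - int b) b" by auto
    then show "compactin (gtop G) K" by (simp add: compactin_level)
  qed simp
  show "lev N \<subseteq> ?K"
  proof
    fix g assume "g \<in> lev N"
    then show "g \<in> ?K"
    proof (rule levE)
      fix x a b y
      assume g: "g = (x, int a - int b, y)" and "x \<in> S" "y \<in> S" "a \<le> N" "b \<le> N" "suffix a x = suffix b y"
      then have "(x, int a - int b, y) \<in> level (int a - int b) b"
        by (subst mem_level') simp_all
      then show ?thesis
        using \<open>a \<le> N\<close> \<open>b \<le> N\<close> by (intro UN_I[of "(a, b)"]) (simp_all add: g)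
    qed
  qed
qed

lemma compactin_sub_lev:
  assumes "compactin (gtop G) K" shows "\<exists>N. K \<subseteq> lev N"
proof -
  have "K \<subseteq> arrows" using compactin_subset_topspace[OF assms] by (simp add: arrows_def)
  then have "K \<subseteq> \<Union> (range lev)" using arrows_lev by blast
  moreover have "\<forall>U\<in>range lev. openin (gtop G) U" using clopen_lev by blast
  ultimately obtain F where F: "finite F" "F \<subseteq> range lev" "K \<subseteq> \<Union> F"
    using assms unfolding compactin_def by (elim conjE allE[of _ "range lev"]) blast
  then obtain I where I: "finite I" "F = lev ` I" by (meson finite_subset_image)
  have "lev i \<subseteq> lev (Max I)" if "i \<in> I" for i using I(1) that by (intro lev_mono Max_ge)
  then have "\<Union> F \<subseteq> lev (Max I)" unfolding I(2) by blast
  then show ?thesis using F by blast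
qed

text \<open>Compact support is replaced by support in some \<open>lev N\<close>; afterwards the
  groupoid topology re-enters only through the continuity in \<open>Cc\<close>.\<close>

lemma Bc_iff: "f \<in> Bc G \<longleftrightarrow> (\<exists>N. \<forall>g. f g \<noteq> 0 \<longrightarrow> g \<in> lev N) \<and> bounded (range f)"
proof
  assume f: "f \<in> Bc G"
  then obtain N where N: "gtop G closure_of {g. f g \<noteq> 0} \<subseteq> lev N"
    using compactin_sub_lev[of "gtop G closure_of {g. f g \<noteq> 0}"] unfolding Bc_def by blast
  have "{g. f g \<noteq> 0} \<subseteq> topspace (gtop G)" using f unfolding Bc_def by blast
  then have "{g. f g \<noteq> 0} \<subseteq> lev N" using N closure_of_subset by blast
  then show "(\<exists>N. \<forall>g. f g \<noteq> 0 \<longrightarrow> g \<in> lev N) \<and> bounded (range f)" using f by (auto simp: Bc_def)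
next
  assume "(\<exists>N. \<forall>g. f g \<noteq> 0 \<longrightarrow> g \<in> lev N) \<and> bounded (range f)"
  then obtain N where N: "{g. f g \<noteq> 0} \<subseteq> lev N" and b: "bounded (range f)" by blast
  have "gtop G closure_of {g. f g \<noteq> 0} \<subseteq> lev N"
    by (rule closure_of_minimal[OF N]) (rule clopen_lev)
  then have "compactin (gtop G) (gtop G closure_of {g. f g \<noteq> 0})"
    by (intro closed_compactin[OF compactin_lev]) auto
  moreover have "f g = 0" if "g \<notin> topspace (gtop G)" for g
    using that N lev_sub_arrows[of N] unfolding arrows_def by blast
  ultimately show "f \<in> Bc G" using b unfolding Bc_def by simp
qed

lemma BcE:
  assumes "f \<in> Bc G"
  obtains N M where "\<And>g. f g \<noteq> 0 \<Longrightarrow> g \<in> lev N" "\<And>g. cmod (f g) \<le> M" "M > 0"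
proof -
  obtain N where N: "\<forall>g. f g \<noteq> 0 \<longrightarrow> g \<in> lev N" and "bounded (range f)" using assms by (auto simp: Bc_iff)
  then obtain M where "M > 0" "\<forall>z\<in>range f. cmod z \<le> M" using bounded_pos by blast
  then show ?thesis using N that by blast
qed

lemma BcI:
  assumes "\<And>g. f g \<noteq> 0 \<Longrightarrow> g \<in> lev N" "\<And>g. cmod (f g) \<le> M" shows "f \<in> Bc G"
  unfolding Bc_iff using assms by (auto simp: bounded_iff)

lemma Bc_vanish: "f \<in> Bc G \<Longrightarrow> g \<notin> arrows \<Longrightarrow> f g = 0"
  unfolding Bc_def arrows_def by blast

section \<open>Elementary bisections\<close>

text \<open>The indicator of a set on which source and range are injective. It implements the
  partial bijection of \<open>S\<close> that exchanges the prefix \<open>v\<close> for the prefix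
  \<open>u\<close>.\<close>

definition bisection :: "nat list \<Rightarrow> nat list \<Rightarrow> arrow \<Rightarrow> complex" where
  "bisection u v = (\<lambda>(x, k, y). if k = int (length u) - int (length v) \<and>
     (\<exists>w. x = u \<frown> w \<and> y = v \<frown> w) \<and> x \<in> S \<and> y \<in> S then 1 else 0)"

lemma bisection_nonzero:
  "bisection u v g \<noteq> 0 \<longleftrightarrow> (\<exists>w. g = (u \<frown> w, int (length u) - int (length v), v \<frown> w) \<and> u \<frown> w \<in> S \<and> v \<frown> w \<in> S)"
proof -
  obtain x k y where "g = (x, k, y)" by (cases g)
  then show ?thesis by (auto simp: bisection_def)
qed

lemma bisection_support: "bisection u v g \<noteq> 0 \<Longrightarrow> g \<in> lev (max (length u) (length v))"
  unfolding bisection_nonzero by (auto intro!: levI[of _ _ "length u" _ "length v"])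

lemma bisection_in_Cc: "bisection u v \<in> Cc G"
proof -
  have Bc: "bisection u v \<in> Bc G"
    by (rule BcI[of _ "max (length u) (length v)" 1]) (use bisection_support in \<open>auto simp: bisection_def\<close>)
  define U where "U = {g. bisection u v g \<noteq> 0}"
  have sub: "U \<subseteq> arrows" unfolding U_def using bisection_support lev_sub_arrows by blast
  have *: "\<exists>C. open C \<and> closed C \<and> U \<inter> level k m = level k m \<inter> C"
    if km: "int m + k \<ge> 0" for k m
  proof (cases "k = int (length u) - int (length v)")
    case True
    let ?C = "{g :: arrow. \<forall>(i, j)\<in>(\<lambda>i. (length u + i, length v + i)) ` {..<m - length v}. fst g i = snd (snd g) j}"
    \<comment> \<open>Membership of the support splits into agreement of the tails, which is a
      finite condition on this level, and the two prefix conditions.\<close>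
    let ?D = "?C \<inter> {x. \<forall>i<length u. x i = u ! i} \<times> UNIV \<times> {x. \<forall>i<length v. x i = v ! i}"
    have cl: "open ?D" "closed ?D"
      by (intro open_Int open_Times clopen_agree clopen_cylinder; simp)
        (intro closed_Int closed_Times clopen_agree clopen_cylinder; simp)
    have "(x, l, y) \<in> U \<inter> level k m \<longleftrightarrow> (x, l, y) \<in> level k m \<inter> ?D" for x l y
    proof (cases "(x, l, y) \<in> level k m")
      case t: True
      then have l: "l = k" "x \<in> S" "y \<in> S" by (auto simp: mem_level)
      have "(x, l, y) \<in> U \<longleftrightarrow> (\<exists>w. x = u \<frown> w \<and> y = v \<frown> w)" using l True by (auto simp: U_def bisection_def)
      also have "\<dots> \<longleftrightarrow> suffix (length u) x = suffix (length v) y \<and> (\<forall>i<length u. x i = u ! i) \<and> (\<forall>i<length v. y i = v ! i)"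
        using conc_eq_iff[OF refl, of x u] conc_eq_iff[OF refl, of y v] by metis
      also have "\<dots> \<longleftrightarrow> (x, l, y) \<in> ?D"
        unfolding level_suffix_iff[OF km t[unfolded l] True] l(1) by auto
      finally show ?thesis using t by (simp only: Int_iff simp_thms)
    qed auto
    then have "U \<inter> level k m = level k m \<inter> ?D"
      by (rule triple_set_eqI)
    then show ?thesis using cl by blast
  next
    case False
    then have "U \<inter> level k m = level k m \<inter> {}"
      by (auto simp: U_def bisection_def mem_level)
    then show ?thesis by blast
  qed
  have U: "openin (gtop G) U" by (rule clopen_gtop[OF sub *])
  have "closedin (gtop G) U" by (rule clopen_gtop[OF sub *])
  then have U': "openin (gtop G) (arrows - U)" by (simp add: arrows_def openin_diff)
  have "continuous_map (gtop G) euclidean (bisection u v)"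
    unfolding continuous_map_def
  proof (intro conjI allI impI)
    fix V :: "complex set"
    have "{g \<in> topspace (gtop G). bisection u v g \<in> V} =
        (if 1 \<in> V then U else {}) \<union> (if 0 \<in> V then arrows - U else {})"
      using sub unfolding U_def arrows_def[symmetric]
      by (auto simp: bisection_def split: if_splits)
    moreover have "openin (gtop G) ((if 1 \<in> V then U else {}) \<union> (if 0 \<in> V then arrows - U else {}))"
      by (intro openin_Un) (simp_all add: U U')
    ultimately show "openin (gtop G) {g \<in> topspace (gtop G). bisection u v g \<in> V}" by simp
  qed auto
  then show ?thesis using Bc by (simp add: Cc_def)
qed

section \<open>Operator norm bounds\<close>

abbreviation vnorm :: "arrow set \<Rightarrow> (arrow \<Rightarrow> complex) \<Rightarrow> real" where
  "vnorm A \<alpha> \<equiv> L2_set (\<lambda>g. cmod (\<alpha> g)) A"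

abbreviation form :: "(arrow \<Rightarrow> complex) \<Rightarrow> arrow set \<Rightarrow> arrow set \<Rightarrow> (arrow \<Rightarrow> complex) \<Rightarrow> (arrow \<Rightarrow> complex) \<Rightarrow> complex" where
  "form f A B \<alpha> \<beta> \<equiv> \<Sum>g\<in>A. \<Sum>h\<in>B. \<alpha> g * f (quot g h) * \<beta> h"

text \<open>\<open>f\<close> acts on the source fibre of \<open>y\<close> as the matrix with entries \<open>f (quot g h)\<close>;
  testing finite sections makes the bound meaningful for every function on the groupoid.\<close>

definition op_bound :: "(arrow \<Rightarrow> complex) \<Rightarrow> real \<Rightarrow> bool" where
  "op_bound f R \<longleftrightarrow> 0 \<le> R \<and> (\<forall>y A B \<alpha> \<beta>. finite A \<longrightarrow> finite B \<longrightarrow> A \<subseteq> fibre y \<longrightarrow> B \<subseteq> fibre y \<longrightarrow>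
     cmod (form f A B \<alpha> \<beta>) \<le> R * vnorm A \<alpha> * vnorm B \<beta>)"

lemma op_boundI:
  assumes "0 \<le> R"
    and "\<And>y A B \<alpha> \<beta>. \<lbrakk>finite A; finite B; A \<subseteq> fibre y; B \<subseteq> fibre y\<rbrakk> \<Longrightarrow>
     cmod (form f A B \<alpha> \<beta>) \<le> R * vnorm A \<alpha> * vnorm B \<beta>"
  shows "op_bound f R"
  using assms unfolding op_bound_def by blast

lemma op_boundD:
  assumes "op_bound f R" "finite A" "finite B" "A \<subseteq> fibre y" "B \<subseteq> fibre y"
  shows "cmod (form f A B \<alpha> \<beta>) \<le> R * vnorm A \<alpha> * vnorm B \<beta>"
  using assms unfolding op_bound_def by blast

lemma op_bound_ge_0: "op_bound f R \<Longrightarrow> 0 \<le> R"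
  by (simp add: op_bound_def)

lemma op_bound_add:
  assumes "op_bound f R" "op_bound f' R'" shows "op_bound (\<lambda>g. f g + f' g) (R + R')"
proof (rule op_boundI)
  fix y A B \<alpha> \<beta> assume AB: "finite A" "finite B" "A \<subseteq> fibre y" "B \<subseteq> fibre y"
  have "(\<Sum>g\<in>A. \<Sum>h\<in>B. \<alpha> g * (f (quot g h) + f' (quot g h)) * \<beta> h) =
     (form f A B \<alpha> \<beta>) +
     (form f' A B \<alpha> \<beta>)"
    by (simp add: sum.distrib algebra_simps)
  then show "cmod (\<Sum>g\<in>A. \<Sum>h\<in>B. \<alpha> g * (f (quot g h) + f' (quot g h)) * \<beta> h) \<le>
      (R + R') * vnorm A \<alpha> * vnorm B \<beta>"
    using norm_triangle_le[OF add_mono[OF op_boundD[OF assms(1) AB, of \<alpha> \<beta>] op_boundD[OF assms(2) AB, of \<alpha> \<beta>]]]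
    by (simp add: algebra_simps)
qed (use assms op_bound_ge_0 in auto)

lemma op_bound_scale:
  assumes "op_bound f R" shows "op_bound (\<lambda>g. z * f g) (cmod z * R)"
proof (rule op_boundI)
  fix y A B \<alpha> \<beta> assume AB: "finite A" "finite B" "A \<subseteq> fibre y" "B \<subseteq> fibre y"
  have "(\<Sum>g\<in>A. \<Sum>h\<in>B. \<alpha> g * (z * f (quot g h)) * \<beta> h) =
     z * (form f A B \<alpha> \<beta>)"
    by (simp add: sum_distrib_left algebra_simps)
  then show "cmod (\<Sum>g\<in>A. \<Sum>h\<in>B. \<alpha> g * (z * f (quot g h)) * \<beta> h) \<le>
      (cmod z * R) * vnorm A \<alpha> * vnorm B \<beta>"
    using mult_left_mono[OF op_boundD[OF assms AB, of \<alpha> \<beta>], of "cmod z"]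
    by (simp add: norm_mult algebra_simps)
qed (use assms op_bound_ge_0 in auto)

text \<open>A finite section involves only finitely many values, so pointwise convergence suffices.
  This semicontinuity is what later makes evaluation injective.\<close>

lemma op_bound_lim:
  assumes lim: "\<And>g. g \<in> arrows \<Longrightarrow> (\<lambda>i. f i g) \<longlonglongrightarrow> f' g" and b: "\<And>i. op_bound (f i) R"
  shows "op_bound f' R"
proof (rule op_boundI)
  fix y A B \<alpha> \<beta> assume AB: "finite A" "finite B" "A \<subseteq> fibre y" "B \<subseteq> fibre y"
  have "(\<lambda>i. cmod (form (f i) A B \<alpha> \<beta>)) \<longlonglongrightarrow>
      cmod (form f' A B \<alpha> \<beta>)"
    using AB by (intro tendsto_intros lim quotient_in[of _ y]) auto
  then show "cmod (form f' A B \<alpha> \<beta>) \<le> R * vnorm A \<alpha> * vnorm B \<beta>"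
    by (rule LIMSEQ_le_const2) (use op_boundD[OF b AB] in blast)
qed (use b op_bound_ge_0 in blast)

text \<open>The value at \<open>g\<close> is the matrix entry between \<open>g\<close> and the unit
  at its source, a section of size one.\<close>

lemma norm_le_op_bound:
  assumes "op_bound f R" "g \<in> arrows" shows "cmod (f g) \<le> R"
proof -
  obtain x k y where g: "g = (x, k, y)" by (cases g)
  have y: "y \<in> S" using assms(2) by (simp add: g mem_arrows)
  have "cmod (\<Sum>g\<in>{g}. \<Sum>h\<in>{(y, 0, y)}. 1 * f (quot g h) * 1) \<le>
      R * vnorm {g} (\<lambda>_. 1) * vnorm {(y, 0, y)} (\<lambda>_. 1)"
    by (rule op_boundD[OF assms(1), of _ _ y]) (use assms(2) arrows_unit[OF y] in \<open>auto simp: g mem_fibre\<close>)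
  then show ?thesis by (simp add: g)
qed

text \<open>Cauchy-Schwarz over the pairs with a non-zero entry: \<open>a\<close> carries the weight
  of \<open>\<alpha>\<close> and \<open>b\<close> that of \<open>\<beta>\<close>. Each index occurs
  in at most \<open>K\<close> pairs, so either factor contributes \<open>sqrt K\<close>.\<close>

lemma schur_test:
  assumes M: "\<And>g. cmod (f g) \<le> M" "0 \<le> M"
    and row: "\<And>y g B. \<lbrakk>finite B; B \<subseteq> fibre y; g \<in> fibre y\<rbrakk> \<Longrightarrow> card {h \<in> B. f (quot g h) \<noteq> 0} \<le> K"
    and col: "\<And>y h A. \<lbrakk>finite A; A \<subseteq> fibre y; h \<in> fibre y\<rbrakk> \<Longrightarrow> card {g \<in> A. f (quot g h) \<noteq> 0} \<le> K"
  shows "op_bound f (M * real K)"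
proof (rule op_boundI)
  fix y A B \<alpha> \<beta> assume AB: "finite A" "finite B" "A \<subseteq> fibre y" "B \<subseteq> fibre y"
  define P where "P g h \<longleftrightarrow> f (quot g h) \<noteq> 0" for g h
  define a where "a = (\<lambda>(g, h). if P g h then cmod (\<alpha> g) else 0)"
  define b where "b = (\<lambda>(g, h). if P g h then cmod (\<beta> h) else 0)"
  have filt: "(\<Sum>h\<in>C. if Q h then c else 0) = real (card {h \<in> C. Q h}) * c"
    if "finite C" for C :: "arrow set" and Q and c :: real
    using that by (simp flip: sum.inter_filter)
  have sqa: "(a (g, h))\<^sup>2 = (if P g h then (cmod (\<alpha> g))\<^sup>2 else 0)" for g h by (simp add: a_def)
  have sqb: "(b (g, h))\<^sup>2 = (if P g h then (cmod (\<beta> h))\<^sup>2 else 0)" for g h by (simp add: b_def)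
  have "(\<Sum>p\<in>A \<times> B. (a p)\<^sup>2) = (\<Sum>g\<in>A. real (card {h \<in> B. P g h}) * (cmod (\<alpha> g))\<^sup>2)"
    using AB by (simp add: sqa filt sum.cartesian_product')
  also have "\<dots> \<le> (\<Sum>g\<in>A. real K * (cmod (\<alpha> g))\<^sup>2)"
    using AB row[of B y] unfolding P_def by (intro sum_mono mult_right_mono) auto
  finally have "(\<Sum>p\<in>A \<times> B. (a p)\<^sup>2) \<le> real K * (\<Sum>g\<in>A. (cmod (\<alpha> g))\<^sup>2)" by (simp add: sum_distrib_left)
  then have La: "L2_set a (A \<times> B) \<le> sqrt (real K) * vnorm A \<alpha>"
    unfolding L2_set_def by (metis real_sqrt_le_mono real_sqrt_mult)
  have "(\<Sum>p\<in>A \<times> B. (b p)\<^sup>2) = (\<Sum>h\<in>B. \<Sum>g\<in>A. if P g h then (cmod (\<beta> h))\<^sup>2 else 0)"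
    using AB sum.swap[of "\<lambda>g h. if P g h then (cmod (\<beta> h))\<^sup>2 else 0"]
    by (simp add: sqb sum.cartesian_product')
  also have "\<dots> = (\<Sum>h\<in>B. real (card {g \<in> A. P g h}) * (cmod (\<beta> h))\<^sup>2)"
    using AB by (simp add: filt)
  also have "\<dots> \<le> (\<Sum>h\<in>B. real K * (cmod (\<beta> h))\<^sup>2)"
    using AB col[of A y] unfolding P_def by (intro sum_mono mult_right_mono) auto
  finally have "(\<Sum>p\<in>A \<times> B. (b p)\<^sup>2) \<le> real K * (\<Sum>h\<in>B. (cmod (\<beta> h))\<^sup>2)" by (simp add: sum_distrib_left)
  then have Lb: "L2_set b (A \<times> B) \<le> sqrt (real K) * vnorm B \<beta>"
    unfolding L2_set_def by (metis real_sqrt_le_mono real_sqrt_mult)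
  have "cmod (form f A B \<alpha> \<beta>) \<le>
      (\<Sum>g\<in>A. \<Sum>h\<in>B. cmod (\<alpha> g * f (quot g h) * \<beta> h))"
    by (rule norm_sum[THEN order_trans], rule sum_mono, rule norm_sum)
  also have "\<dots> \<le> (\<Sum>g\<in>A. \<Sum>h\<in>B. M * (\<bar>a (g, h)\<bar> * \<bar>b (g, h)\<bar>))"
  proof (intro sum_mono)
    fix g h
    have "cmod (f (quot g h)) * (cmod (\<alpha> g) * cmod (\<beta> h)) \<le> M * (cmod (\<alpha> g) * cmod (\<beta> h))"
      by (intro mult_right_mono M) simp
    then show "cmod (\<alpha> g * f (quot g h) * \<beta> h) \<le> M * (\<bar>a (g, h)\<bar> * \<bar>b (g, h)\<bar>)"
      by (simp add: norm_mult a_def b_def P_def mult_ac)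
  qed
  also have "\<dots> = M * (\<Sum>p\<in>A \<times> B. \<bar>a p\<bar> * \<bar>b p\<bar>)"
    by (simp add: sum_distrib_left sum.cartesian_product')
  also have "\<dots> \<le> M * (L2_set a (A \<times> B) * L2_set b (A \<times> B))"
    by (intro mult_left_mono L2_set_mult_ineq M)
  also have "\<dots> \<le> M * ((sqrt (real K) * vnorm A \<alpha>) * (sqrt (real K) * vnorm B \<beta>))"
    by (intro mult_left_mono mult_mono La Lb M mult_nonneg_nonneg) auto
  also have "\<dots> = M * (sqrt (real K) * sqrt (real K)) * vnorm A \<alpha> * vnorm B \<beta>"
    by (simp only: mult_ac)
  also have "\<dots> = M * real K * vnorm A \<alpha> * vnorm B \<beta>" by simp
  finally show "cmod (form f A B \<alpha> \<beta>) \<le> M * real K * vnorm A \<alpha> * vnorm B \<beta>" .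
qed (use M in simp)

lemma op_bound_exists:
  assumes "f \<in> Bc G" obtains R where "op_bound f R"
proof -
  obtain N M where N: "\<And>g. f g \<noteq> 0 \<Longrightarrow> g \<in> lev N" and M: "\<And>g. cmod (f g) \<le> M" "M > 0"
    using assms by (rule BcE) blast
  have "op_bound f (M * real (row_bound N))"
  proof (rule schur_test[OF M(1)])
    fix y g B assume "finite B" "B \<subseteq> fibre y" "g \<in> fibre y"
    then have "{h \<in> B. f (quot g h) \<noteq> 0} \<subseteq> row N g"
      using N unfolding row_def fibre_def by blast
    then show "card {h \<in> B. f (quot g h) \<noteq> 0} \<le> row_bound N"
      by (meson card_mono card_row finite_row order_trans)
  next
    fix y h A assume A: "finite A" "A \<subseteq> fibre y" "h \<in> fibre y"
    have "g \<in> row N h" if "g \<in> A" "f (quot g h) \<noteq> 0" for g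
    proof -
      have "g \<in> fibre y" using that A by auto
      moreover have "h \<in> row N g" using N[OF that(2)] A(3) \<open>g \<in> fibre y\<close> by (simp add: row_def fibre_def)
      ultimately show ?thesis using row_commute[OF _ A(3)] by blast
    qed
    then have "{g \<in> A. f (quot g h) \<noteq> 0} \<subseteq> row N h" by blast
    then show "card {g \<in> A. f (quot g h) \<noteq> 0} \<le> row_bound N"
      by (meson card_mono card_row finite_row order_trans)
  qed (use M in simp)
  then show ?thesis using that by blast
qed

text \<open>The matrix is diagonal, so the Schur test applies with \<open>K = 1\<close> and the
  supremum of the values bounds the operator. The later comparison with a projection depends on this
  sharp constant.\<close>

lemma op_bound_diagonal:
  assumes "\<And>x k y. f (x, k, y) \<noteq> 0 \<Longrightarrow> k = 0 \<and> x = y" "\<And>g. cmod (f g) \<le> M" "0 \<le> M"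
  shows "op_bound f M"
proof -
  have eq: "g = h" if "g \<in> fibre y" "h \<in> fibre y" "f (quot g h) \<noteq> 0" for g h y
    using that assms(1)[of "fst g" "fst (snd g) - fst (snd h)" "fst h"]
    by (cases g; cases h) (simp add: mem_fibre)
  have "op_bound f (M * real 1)"
  proof (rule schur_test[OF assms(2,3)])
    fix y g B assume "finite B" "B \<subseteq> fibre y" "g \<in> fibre y"
    then have "{h \<in> B. f (quot g h) \<noteq> 0} \<subseteq> {g}" using eq by blast
    then show "card {h \<in> B. f (quot g h) \<noteq> 0} \<le> 1"
      using card_mono[of "{g}"] by fastforce
  next
    fix y h A assume "finite A" "A \<subseteq> fibre y" "h \<in> fibre y"
    then have "{g \<in> A. f (quot g h) \<noteq> 0} \<subseteq> {h}" using eq by blast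
    then show "card {g \<in> A. f (quot g h) \<noteq> 0} \<le> 1"
      using card_mono[of "{h}"] by fastforce
  qed
  then show ?thesis by simp
qed

text \<open>Right translation by the inverse of \<open>h\<close> identifies the fibre of
  \<open>y\<close> with the fibre over the range of \<open>h\<close>. Under this identification
  convolution is matrix multiplication.\<close>

lemma gconv_quotient:
  assumes f: "\<And>g. f g \<noteq> 0 \<Longrightarrow> g \<in> lev N" and g: "g \<in> fibre y" and h: "h \<in> fibre y"
    and Z: "finite Z" "row N g \<subseteq> Z" "Z \<subseteq> fibre y"
  shows "gconv G f f' (quot g h) = (\<Sum>z\<in>Z. f (quot g z) * f' (quot z h))"
proof -
  obtain x k where g': "g = (x, k, y)" "(x, k, y) \<in> arrows" using g by (cases g) (auto simp: mem_fibre)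
  obtain z l where h': "h = (z, l, y)" "(z, l, y) \<in> arrows" using h by (cases h) (auto simp: mem_fibre)
  have q: "(x, k - l, z) \<in> arrows" using quotient_in[OF g h] by (simp add: g' h')
  let ?H = "(\<lambda>w. quot w h) ` Z"
  have inj: "inj_on (\<lambda>w. quot w h) Z"
  proof (rule inj_onI)
    fix w w' assume ww: "w \<in> Z" "w' \<in> Z" "quot w h = quot w' h"
    then have "w \<in> fibre y" "w' \<in> fibre y" using Z(3) by auto
    then show "w = w'" using ww(3) by (cases w; cases w') (simp add: h' mem_fibre)
  qed
  have sub: "?H \<subseteq> fibre z"
    using Z(3) h quotient_in by (fastforce simp: h' fibre_def quot_def)
  have row: "row N (x, k - l, z) \<subseteq> ?H"
  proof
    fix h1 assume h1: "h1 \<in> row N (x, k - l, z)"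
    obtain w m where w: "h1 = (w, m, z)" "(w, m, z) \<in> arrows" using h1 by (cases h1) (auto simp: row_def mem_fibre)
    have "(w, m + l, y) \<in> arrows" using arrows_comp w h' by blast
    moreover have "(x, k - (m + l), w) \<in> lev N" using h1 by (simp add: row_def w algebra_simps)
    ultimately have "(w, m + l, y) \<in> row N g" by (simp add: row_def g' mem_fibre)
    moreover have "h1 = quot (w, m + l, y) h" by (simp add: w h')
    ultimately show "h1 \<in> ?H" using Z(2) by blast
  qed
  have "gconv G f f' (x, k - l, z) = (\<Sum>h1\<in>?H. f (quot (x, k - l, z) h1) * f' h1)"
    by (rule gconv_sum[OF f q finite_imageI[OF Z(1)] row sub])
  also have "\<dots> = (\<Sum>w\<in>Z. f (quot (x, k - l, z) (quot w h)) * f' (quot w h))"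
    by (simp add: sum.reindex[OF inj])
  also have "\<dots> = (\<Sum>w\<in>Z. f (quot g w) * f' (quot w h))"
    by (simp add: g' h' quot_def)
  finally show ?thesis by (simp add: g' h')
qed

lemma rows_finite:
  assumes "finite A" "A \<subseteq> fibre y"
  shows "\<exists>Z. finite Z \<and> Z \<subseteq> fibre y \<and> (\<forall>g\<in>A. row N g \<subseteq> Z)"
proof (intro exI conjI ballI)
  have "row N g \<subseteq> fibre y" if "g \<in> A" for g
  proof -
    have "snd (snd g) = y" using that assms(2) by (auto simp: fibre_def)
    then show ?thesis by (auto simp: row_def)
  qed
  then show "(\<Union>g\<in>A. row N g) \<subseteq> fibre y" by blast
  show "finite (\<Union>g\<in>A. row N g)" using assms(1) finite_row by simp
  show "row N g \<subseteq> (\<Union>g\<in>A. row N g)" if "g \<in> A" for g using that by blast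
qed

lemma square_le_imp_le: "s\<^sup>2 \<le> c * s \<Longrightarrow> 0 \<le> s \<Longrightarrow> 0 \<le> c \<Longrightarrow> s \<le> (c :: real)"
  by (cases "s = 0") (simp_all add: power2_eq_square)

lemma complex_of_real_vnorm_sq: "complex_of_real ((vnorm A \<alpha>)\<^sup>2) = (\<Sum>g\<in>A. cnj (\<alpha> g) * \<alpha> g)"
  by (simp add: L2_set_def sum_nonneg mult.commute flip: complex_norm_square)

lemma op_bound_conv:
  assumes f: "f \<in> Bc G" "op_bound f R" and f': "op_bound f' R'"
  shows "op_bound (gconv G f f') (R * R')"
proof (rule op_boundI)
  fix y A B \<alpha> \<beta> assume AB: "finite A" "finite B" "A \<subseteq> fibre y" "B \<subseteq> fibre y"
  obtain N where N: "\<And>g. f g \<noteq> 0 \<Longrightarrow> g \<in> lev N" using f(1) by (rule BcE) blast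
  obtain Z where Z: "finite Z" "Z \<subseteq> fibre y" "\<And>g. g \<in> A \<Longrightarrow> row N g \<subseteq> Z"
    using rows_finite[OF AB(1,3), of N] by (elim exE conjE) (rule that, auto)
  \<comment> \<open>The image of \<open>\<beta>\<close> under the matrix of \<open>f'\<close>,
    restricted to the indices that \<open>f\<close> can reach from \<open>A\<close>. Pairing it with
    its own conjugate bounds the square of its norm by a multiple of the norm, and
    \<open>square_le_imp_le\<close> cancels one factor.\<close>
  define \<xi> where "\<xi> z = (\<Sum>h\<in>B. f' (quot z h) * \<beta> h)" for z
  have "(vnorm Z \<xi>)\<^sup>2 = cmod (\<Sum>z\<in>Z. cnj (\<xi> z) * \<xi> z)"
    by (simp only: norm_of_real abs_power2 flip: complex_of_real_vnorm_sq)
  also have "\<dots> = cmod (\<Sum>z\<in>Z. \<Sum>h\<in>B. cnj (\<xi> z) * f' (quot z h) * \<beta> h)"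
    unfolding \<xi>_def by (simp only: sum_distrib_left mult.assoc)
  also have "\<dots> \<le> R' * vnorm Z (\<lambda>z. cnj (\<xi> z)) * vnorm B \<beta>"
    by (rule op_boundD[OF f' Z(1) AB(2) Z(2) AB(4)])
  also have "\<dots> = (R' * vnorm B \<beta>) * vnorm Z \<xi>" by simp
  finally have \<xi>: "vnorm Z \<xi> \<le> R' * vnorm B \<beta>"
    by (rule square_le_imp_le) (use op_bound_ge_0[OF f'] in auto)
  have "(form (gconv G f f') A B \<alpha> \<beta>) =
      (\<Sum>g\<in>A. \<Sum>h\<in>B. \<Sum>z\<in>Z. \<alpha> g * f (quot g z) * (f' (quot z h) * \<beta> h))"
  proof (intro sum.cong refl)
    fix g h assume gh: "g \<in> A" "h \<in> B"
    have "gconv G f f' (quot g h) = (\<Sum>z\<in>Z. f (quot g z) * f' (quot z h))"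
      by (rule gconv_quotient[OF N _ _ Z(1) Z(3)[OF gh(1)] Z(2)]) (use gh AB in auto)
    then show "\<alpha> g * gconv G f f' (quot g h) * \<beta> h =
        (\<Sum>z\<in>Z. \<alpha> g * f (quot g z) * (f' (quot z h) * \<beta> h))"
      by (simp add: sum_distrib_left sum_distrib_right mult.assoc)
  qed
  also have "\<dots> = (\<Sum>g\<in>A. \<Sum>z\<in>Z. \<Sum>h\<in>B. \<alpha> g * f (quot g z) * (f' (quot z h) * \<beta> h))"
    by (intro sum.cong refl sum.swap)
  also have "\<dots> = (\<Sum>g\<in>A. \<Sum>z\<in>Z. \<alpha> g * f (quot g z) * \<xi> z)"
    by (simp add: \<xi>_def sum_distrib_left)
  finally have "cmod (form (gconv G f f') A B \<alpha> \<beta>) \<le> R * vnorm A \<alpha> * vnorm Z \<xi>"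
    using op_boundD[OF f(2) AB(1) Z(1) AB(3) Z(2)] by simp
  also have "\<dots> \<le> R * vnorm A \<alpha> * (R' * vnorm B \<beta>)"
    using \<xi> op_bound_ge_0[OF f(2)] by (intro mult_left_mono) auto
  finally show "cmod (form (gconv G f f') A B \<alpha> \<beta>) \<le> R * R' * vnorm A \<alpha> * vnorm B \<beta>"
    by (simp add: algebra_simps)
qed (use f f' op_bound_ge_0 in auto)

lemma gstar_eq: "gstar G f (x, k, y) = (if (x, k, y) \<in> arrows then cnj (f (y, - k, x)) else 0)"
  by (simp add: gstar_def arrows_def) (simp add: subshift_groupoid_def)

lemma gstar_quotient: "\<lbrakk>g \<in> fibre y; h \<in> fibre y\<rbrakk> \<Longrightarrow> gstar G f (quot g h) = cnj (f (quot h g))"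
  using quotient_in[of g y h] by (cases g; cases h) (simp add: gstar_eq)

lemma op_bound_star:
  assumes "op_bound f R" shows "op_bound (gstar G f) R"
proof (rule op_boundI)
  fix y A B \<alpha> \<beta> assume AB: "finite A" "finite B" "A \<subseteq> fibre y" "B \<subseteq> fibre y"
  have "(form (gstar G f) A B \<alpha> \<beta>) =
      (\<Sum>g\<in>A. \<Sum>h\<in>B. cnj (cnj (\<beta> h) * f (quot h g) * cnj (\<alpha> g)))"
    using AB by (intro sum.cong refl) (auto simp: gstar_quotient[of _ y] subset_eq)
  also have "\<dots> = cnj (\<Sum>h\<in>B. \<Sum>g\<in>A. cnj (\<beta> h) * f (quot h g) * cnj (\<alpha> g))"
    by (subst sum.swap) (simp only: cnj_sum)
  finally have "cmod (form (gstar G f) A B \<alpha> \<beta>) =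
     cmod (\<Sum>h\<in>B. \<Sum>g\<in>A. cnj (\<beta> h) * f (quot h g) * cnj (\<alpha> g))"
    by (simp only: complex_mod_cnj)
  also have "\<dots> \<le> R * vnorm B (\<lambda>h. cnj (\<beta> h)) * vnorm A (\<lambda>g. cnj (\<alpha> g))"
    by (rule op_boundD[OF assms AB(2,1,4,3)])
  finally show "cmod (form (gstar G f) A B \<alpha> \<beta>) \<le> R * vnorm A \<alpha> * vnorm B \<beta>"
    by (simp add: mult_ac)
qed (use assms op_bound_ge_0 in auto)

section \<open>Square summable functions and the regular representations\<close>

lemma vnorm_le_l2_norm:
  assumes "\<psi> \<in> l2_space X" "finite A" "A \<subseteq> X" shows "vnorm A \<psi> \<le> l2_norm X \<psi>"
  unfolding L2_set_def l2_norm_def using assms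
  by (intro real_sqrt_le_mono finite_sum_le_infsum) (auto simp: l2_space_def)

lemma l2_of_vnorm_le:
  assumes "\<And>g. g \<notin> X \<Longrightarrow> \<psi> g = 0" and le: "\<And>A. finite A \<Longrightarrow> A \<subseteq> X \<Longrightarrow> vnorm A \<psi> \<le> c"
  shows "\<psi> \<in> l2_space X" "l2_norm X \<psi> \<le> c"
proof -
  have c: "0 \<le> c" using le[of "{}"] by simp
  have sum_le: "(\<Sum>g\<in>A. (cmod (\<psi> g))\<^sup>2) \<le> c\<^sup>2" if "finite A" "A \<subseteq> X" for A
    using le[OF that] by (simp add: L2_set_def sqrt_le_D)
  have sm: "(\<lambda>g. (cmod (\<psi> g))\<^sup>2) summable_on X"
    by (rule nonneg_bdd_above_summable_on) (auto intro!: bdd_aboveI2 sum_le)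
  then show "\<psi> \<in> l2_space X" using assms(1) by (simp add: l2_space_def)
  have "(\<Sum>\<^sub>\<infinity>g\<in>X. (cmod (\<psi> g))\<^sup>2) \<le> c\<^sup>2"
    by (rule infsum_le_finite_sums[OF sm sum_le])
  then show "l2_norm X \<psi> \<le> c" unfolding l2_norm_def using c by (metis real_sqrt_le_mono real_sqrt_abs abs_of_nonneg)
qed

lemma regular_rep_sum:
  assumes f: "\<And>g. f g \<noteq> 0 \<Longrightarrow> g \<in> lev N" and g: "g \<in> fibre y"
    and Z: "finite Z" "row N g \<subseteq> Z" "Z \<subseteq> fibre y"
  shows "regular_rep G (y, 0, y) f \<psi> g = (\<Sum>h\<in>Z. f (quot g h) * \<psi> h)"
proof -
  obtain x k where g': "g = (x, k, y)" "(x, k, y) \<in> arrows" using g by (cases g) (auto simp: mem_fibre)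
  show ?thesis using g Z gconv_sum[OF f g'(2) Z(1) _ Z(3)]
    by (simp add: regular_rep_def gsrc_fibre_eq g')
qed

text \<open>On finitely many arrows the image depends only on \<open>\<psi>\<close> on a finite set
  \<open>Z\<close>, so the finite sections apply; the l2-norm is then recovered from finite
  subsets.\<close>

lemma regular_rep_bound:
  assumes f: "f \<in> Bc G" "op_bound f R" and \<psi>: "\<psi> \<in> l2_space (fibre y)"
  shows "regular_rep G (y, 0, y) f \<psi> \<in> l2_space (fibre y)"
    "l2_norm (fibre y) (regular_rep G (y, 0, y) f \<psi>) \<le> R * l2_norm (fibre y) \<psi>"
proof -
  define T where "T = regular_rep G (y, 0, y) f \<psi>"
  obtain N where N: "\<And>g. f g \<noteq> 0 \<Longrightarrow> g \<in> lev N" using f(1) by (rule BcE) blast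
  have le: "vnorm A T \<le> R * l2_norm (fibre y) \<psi>" if A: "finite A" "A \<subseteq> fibre y" for A
  proof -
    obtain Z where Z: "finite Z" "Z \<subseteq> fibre y" "\<And>g. g \<in> A \<Longrightarrow> row N g \<subseteq> Z"
      using rows_finite[OF A, of N] by (elim exE conjE) (rule that, auto)
    have T: "T g = (\<Sum>h\<in>Z. f (quot g h) * \<psi> h)" if "g \<in> A" for g
      unfolding T_def by (rule regular_rep_sum[OF N _ Z(1) Z(3)[OF that] Z(2)]) (use that A in auto)
    have "(vnorm A T)\<^sup>2 = cmod (\<Sum>g\<in>A. cnj (T g) * T g)"
      by (simp only: norm_of_real abs_power2 flip: complex_of_real_vnorm_sq)
    also have "(\<Sum>g\<in>A. cnj (T g) * T g) = (\<Sum>g\<in>A. \<Sum>h\<in>Z. cnj (T g) * f (quot g h) * \<psi> h)"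
    proof (rule sum.cong[OF refl])
      fix g assume "g \<in> A"
      have "cnj (T g) * T g = cnj (T g) * (\<Sum>h\<in>Z. f (quot g h) * \<psi> h)" using T[OF \<open>g \<in> A\<close>] by simp
      then show "cnj (T g) * T g = (\<Sum>h\<in>Z. cnj (T g) * f (quot g h) * \<psi> h)"
        by (simp only: sum_distrib_left mult.assoc)
    qed
    also have "cmod \<dots> \<le> R * vnorm A (\<lambda>g. cnj (T g)) * vnorm Z \<psi>"
      by (rule op_boundD[OF f(2) A(1) Z(1) A(2) Z(2)])
    also have "\<dots> = (R * vnorm Z \<psi>) * vnorm A T" by simp
    finally have "vnorm A T \<le> R * vnorm Z \<psi>"
      by (rule square_le_imp_le) (use op_bound_ge_0[OF f(2)] in auto)
    also have "\<dots> \<le> R * l2_norm (fibre y) \<psi>"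
      by (intro mult_left_mono vnorm_le_l2_norm \<psi> Z op_bound_ge_0[OF f(2)])
    finally show ?thesis .
  qed
  have "T g = 0" if "g \<notin> fibre y" for g using that by (simp add: T_def regular_rep_def gsrc_fibre_eq)
  from l2_of_vnorm_le[OF this le]
  show "regular_rep G (y, 0, y) f \<psi> \<in> l2_space (fibre y)"
    "l2_norm (fibre y) (regular_rep G (y, 0, y) f \<psi>) \<le> R * l2_norm (fibre y) \<psi>"
    unfolding T_def by auto
qed

lemma l2_norm_ge_0: "0 \<le> l2_norm X \<psi>"
  unfolding l2_norm_def by (simp add: infsum_nonneg)

lemma zero_in_l2: "(\<lambda>_. 0) \<in> l2_space X" "l2_norm X (\<lambda>_. 0) = 0"
  by (simp_all add: l2_space_def l2_norm_def)

lemma regular_rep_norm_le: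
  assumes f: "f \<in> Bc G" "op_bound f R"
  shows "regular_rep_norm G (y, 0, y) f \<le> R"
    and "\<lbrakk>\<psi> \<in> l2_space (fibre y); l2_norm (fibre y) \<psi> \<le> 1\<rbrakk> \<Longrightarrow>
      l2_norm (fibre y) (regular_rep G (y, 0, y) f \<psi>) \<le> regular_rep_norm G (y, 0, y) f"
proof -
  have le: "l2_norm (fibre y) (regular_rep G (y, 0, y) f \<psi>) \<le> R"
    if "\<psi> \<in> l2_space (fibre y)" "l2_norm (fibre y) \<psi> \<le> 1" for \<psi>
  proof -
    have "R * l2_norm (fibre y) \<psi> \<le> R * 1"
      using that op_bound_ge_0[OF f(2)] by (intro mult_left_mono)
    then show ?thesis using regular_rep_bound(2)[OF f that(1)] by simp
  qed
  show "regular_rep_norm G (y, 0, y) f \<le> R"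
    unfolding regular_rep_norm_def gsrc_fibre_eq
    by (rule cSUP_least) (use zero_in_l2[of "fibre y"] le in auto)
  assume "\<psi> \<in> l2_space (fibre y)" "l2_norm (fibre y) \<psi> \<le> 1"
  then show "l2_norm (fibre y) (regular_rep G (y, 0, y) f \<psi>) \<le> regular_rep_norm G (y, 0, y) f"
    unfolding regular_rep_norm_def gsrc_fibre_eq
    by (intro cSUP_upper) (auto intro!: bdd_aboveI2 le)
qed

abbreviation nrm :: "(arrow \<Rightarrow> complex) \<Rightarrow> real" where "nrm \<equiv> anorm (Bc_algebra G)"

lemma nrm_def: "nrm f = (SUP y\<in>S. regular_rep_norm G (y, 0, y) f)"
  by (simp add: Bc_algebra_def gunits_eq image_image)

lemma S_nonempty: "S \<noteq> {}" using infinite_S by auto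

lemma regular_rep_norm_le_nrm:
  assumes "f \<in> Bc G" "y \<in> S" shows "regular_rep_norm G (y, 0, y) f \<le> nrm f"
proof -
  obtain R where "op_bound f R" using op_bound_exists[OF assms(1)] .
  then show ?thesis unfolding nrm_def
    using assms by (intro cSUP_upper) (auto intro!: bdd_aboveI2 regular_rep_norm_le)
qed

lemma nrm_ge_0:
  assumes "f \<in> Bc G" shows "0 \<le> nrm f"
proof -
  obtain R where R: "op_bound f R" using op_bound_exists[OF assms(1)] .
  obtain y where y: "y \<in> S" using S_nonempty by blast
  have "0 \<le> regular_rep_norm G (y, 0, y) f"
    using regular_rep_norm_le(2)[OF assms R zero_in_l2(1), of y] zero_in_l2(2)[of "fibre y"]
    by (intro order_trans[OF l2_norm_ge_0]) simp
  then show ?thesis using regular_rep_norm_le_nrm[OF assms y] by simp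
qed

text \<open>After normalisation and extension by zero, \<open>\<beta>\<close> is an admissible
  vector in the supremum that defines the norm; Cauchy-Schwarz on \<open>A\<close> brings in
  \<open>\<alpha>\<close>. The case of vanishing \<open>\<beta>\<close> has to be separated because
  of the normalisation.\<close>

lemma op_bound_of_nrm:
  assumes f: "f \<in> Bc G" shows "op_bound f (nrm f)"
proof (rule op_boundI)
  fix y A B \<alpha> \<beta> assume AB: "finite A" "finite B" "A \<subseteq> fibre y" "B \<subseteq> fibre y"
  obtain R where R: "op_bound f R" using op_bound_exists[OF f] .
  obtain N where N: "\<And>g. f g \<noteq> 0 \<Longrightarrow> g \<in> lev N" using f by (rule BcE) blast
  show "cmod (form f A B \<alpha> \<beta>) \<le> nrm f * vnorm A \<alpha> * vnorm B \<beta>"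
  proof (cases "vnorm B \<beta> = 0")
    case True
    then have "\<beta> h = 0" if "h \<in> B" for h
      using that AB by (simp add: L2_set_eq_0_iff)
    then show ?thesis using True by simp
  next
    case False
    then have pos: "vnorm B \<beta> > 0" by (simp add: less_le)
    then have "B \<noteq> {}" by auto
    then obtain h0 where "h0 \<in> B" by blast
    then have y: "y \<in> S" using AB(4) by (cases h0) (auto simp: mem_fibre mem_arrows subset_eq)
    define c where "c = complex_of_real (vnorm B \<beta>)"
    define \<psi> where "\<psi> h = (if h \<in> B then \<beta> h / c else 0)" for h
    have cmod_c: "cmod c = vnorm B \<beta>" by (simp add: c_def)
    have le1: "vnorm C \<psi> \<le> 1" if C: "finite C" "C \<subseteq> fibre y" for C
    proof -
      have "(\<Sum>h\<in>C. (cmod (\<psi> h))\<^sup>2) = (\<Sum>h\<in>C \<inter> B. (cmod (\<beta> h) / vnorm B \<beta>)\<^sup>2)"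
        using C by (intro sum.mono_neutral_cong_right) (auto simp: \<psi>_def norm_divide cmod_c)
      also have "\<dots> \<le> (\<Sum>h\<in>B. (cmod (\<beta> h) / vnorm B \<beta>)\<^sup>2)"
        using AB by (intro sum_mono2) auto
      also have "\<dots> = (\<Sum>h\<in>B. (cmod (\<beta> h))\<^sup>2) / (vnorm B \<beta>)\<^sup>2" by (simp add: power_divide sum_divide_distrib)
      also have "(\<Sum>h\<in>B. (cmod (\<beta> h))\<^sup>2) = (vnorm B \<beta>)\<^sup>2" by (simp add: L2_set_def sum_nonneg)
      finally show ?thesis using pos by (simp add: L2_set_def)
    qed
    have \<psi>: "\<psi> \<in> l2_space (fibre y)" "l2_norm (fibre y) \<psi> \<le> 1"
    proof -
      have "\<psi> h = 0" if "h \<notin> fibre y" for h using that AB(4) by (auto simp: \<psi>_def)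
      from l2_of_vnorm_le[OF this le1] show "\<psi> \<in> l2_space (fibre y)" "l2_norm (fibre y) \<psi> \<le> 1" by auto
    qed
    define T where "T = regular_rep G (y, 0, y) f \<psi>"
    have "l2_norm (fibre y) T \<le> nrm f"
      unfolding T_def using regular_rep_norm_le(2)[OF f R \<psi>] regular_rep_norm_le_nrm[OF f y] by simp
    moreover have "vnorm A T \<le> l2_norm (fibre y) T"
      unfolding T_def by (intro vnorm_le_l2_norm regular_rep_bound(1)[OF f R \<psi>(1)] AB)
    ultimately have T_le: "vnorm A T \<le> nrm f" by simp
    have T: "c * T g = (\<Sum>h\<in>B. f (quot g h) * \<beta> h)" if "g \<in> A" for g
    proof -
      have g: "g \<in> fibre y" using that AB by auto
      have sub: "row N g \<subseteq> fibre y" using g by (auto simp: row_def fibre_def)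
      have "T g = (\<Sum>h\<in>row N g \<union> B. f (quot g h) * \<psi> h)"
        unfolding T_def by (rule regular_rep_sum[OF N g]) (use AB finite_row sub in auto)
      also have "\<dots> = (\<Sum>h\<in>B. f (quot g h) * \<psi> h)"
        by (rule sum.mono_neutral_right) (use AB finite_row in \<open>auto simp: \<psi>_def\<close>)
      finally show ?thesis using pos by (simp add: sum_distrib_left \<psi>_def c_def)
    qed
    have "cmod (form f A B \<alpha> \<beta>) = cmod (\<Sum>g\<in>A. \<alpha> g * (c * T g))"
      using T by (simp add: sum_distrib_left mult.assoc)
    also have "\<dots> \<le> (\<Sum>g\<in>A. cmod c * (\<bar>cmod (\<alpha> g)\<bar> * \<bar>cmod (T g)\<bar>))"
      by (intro norm_sum[THEN order_trans] sum_mono) (simp add: norm_mult mult_ac)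
    also have "\<dots> = cmod c * (\<Sum>g\<in>A. \<bar>cmod (\<alpha> g)\<bar> * \<bar>cmod (T g)\<bar>)" by (simp only: sum_distrib_left)
    also have "\<dots> \<le> cmod c * (vnorm A \<alpha> * vnorm A T)" by (intro mult_left_mono L2_set_mult_ineq) simp
    also have "\<dots> \<le> cmod c * (vnorm A \<alpha> * nrm f)" by (intro mult_left_mono T_le) auto
    finally show ?thesis by (simp add: cmod_c mult_ac)
  qed
qed (rule nrm_ge_0[OF f])

text \<open>The norm is the least operator bound. Every further norm estimate goes through finite
  sums, and the suprema over vectors and units do not occur again.\<close>

lemma nrm_le_iff:
  assumes "f \<in> Bc G" "0 \<le> R" shows "nrm f \<le> R \<longleftrightarrow> op_bound f R"
proof
  assume "nrm f \<le> R"
  then show "op_bound f R" using op_bound_of_nrm[OF assms(1)] assms(2) unfolding op_bound_def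
    by (meson mult_right_mono order_trans L2_set_nonneg)
next
  assume "op_bound f R"
  then show "nrm f \<le> R" unfolding nrm_def
    by (intro cSUP_least S_nonempty regular_rep_norm_le(1) assms(1))
qed

section \<open>The normed \<open>*\<close>-algebra\<close>

lemma Bc_zero: "(\<lambda>_. 0) \<in> Bc G"
  by (rule BcI[of _ 0 0]) auto

lemma BcE2:
  assumes "f \<in> Bc G" "f' \<in> Bc G"
  obtains N M where "\<And>g. f g \<noteq> 0 \<Longrightarrow> g \<in> lev N" "\<And>g. f' g \<noteq> 0 \<Longrightarrow> g \<in> lev N"
    "\<And>g. cmod (f g) \<le> M" "\<And>g. cmod (f' g) \<le> M" "M > 0"
proof -
  obtain N M where 1: "\<And>g. f g \<noteq> 0 \<Longrightarrow> g \<in> lev N" "\<And>g. cmod (f g) \<le> M" "M > 0"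
    using assms(1) by (rule BcE) blast
  obtain N' M' where 2: "\<And>g. f' g \<noteq> 0 \<Longrightarrow> g \<in> lev N'" "\<And>g. cmod (f' g) \<le> M'" "M' > 0"
    using assms(2) by (rule BcE) blast
  show ?thesis
  proof (rule that[of "max N N'" "max M M'"])
    show "g \<in> lev (max N N')" if "f g \<noteq> 0" for g using 1(1)[OF that] lev_mono[of N "max N N'"] by auto
    show "g \<in> lev (max N N')" if "f' g \<noteq> 0" for g using 2(1)[OF that] lev_mono[of N' "max N N'"] by auto
  qed (use 1 2 in \<open>auto simp: le_max_iff_disj\<close>)
qed

lemma Bc_add:
  assumes "f \<in> Bc G" "f' \<in> Bc G" shows "(\<lambda>g. f g + f' g) \<in> Bc G"
proof -
  obtain N M where NM: "\<And>g. f g \<noteq> 0 \<Longrightarrow> g \<in> lev N" "\<And>g. f' g \<noteq> 0 \<Longrightarrow> g \<in> lev N"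
    "\<And>g. cmod (f g) \<le> M" "\<And>g. cmod (f' g) \<le> M"
    using BcE2[OF assms] by metis
  show ?thesis
  proof (rule BcI[of _ N "M + M"])
    fix g show "f g + f' g \<noteq> 0 \<Longrightarrow> g \<in> lev N" using NM(1,2)[of g] by fastforce
    show "cmod (f g + f' g) \<le> M + M" by (intro norm_triangle_le add_mono NM)
  qed
qed

lemma Bc_scale:
  assumes "f \<in> Bc G" shows "(\<lambda>g. z * f g) \<in> Bc G"
proof -
  obtain N M where NM: "\<And>g. f g \<noteq> 0 \<Longrightarrow> g \<in> lev N" "\<And>g. cmod (f g) \<le> M"
    using assms by (rule BcE) blast
  show ?thesis
  proof (rule BcI[of _ N "cmod z * M"])
    fix g show "z * f g \<noteq> 0 \<Longrightarrow> g \<in> lev N" by (rule NM(1)) simp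
    show "cmod (z * f g) \<le> cmod z * M" unfolding norm_mult by (intro mult_left_mono NM(2)) simp
  qed
qed

lemma gconv_support:
  assumes f: "\<And>g. f g \<noteq> 0 \<Longrightarrow> g \<in> lev N" and nz: "gconv G f f' (x, k, y) \<noteq> 0"
  obtains z l where "f (x, l, z) \<noteq> 0" "f' (z, k - l, y) \<noteq> 0"
proof -
  have xy: "(x, k, y) \<in> arrows" using nz by (auto simp: gconv_eq split: if_splits)
  have "\<exists>h\<in>row N (x, k, y). f (quot (x, k, y) h) * f' h \<noteq> 0"
  proof (rule ccontr)
    assume nex: "\<not> ?thesis"
    have "gconv G f f' (x, k, y) = (\<Sum>h\<in>row N (x, k, y). f (quot (x, k, y) h) * f' h)"
      by (rule gconv_row[OF _ xy]) (use f in blast)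
    also have "\<dots> = 0" by (rule sum.neutral) (use nex in blast)
    finally show False using nz by simp
  qed
  then obtain h where h: "h \<in> row N (x, k, y)" "f (quot (x, k, y) h) \<noteq> 0" "f' h \<noteq> 0" by auto
  obtain z m where "h = (z, m, y)" using h(1) by (cases h) (auto simp: row_def mem_fibre)
  then show ?thesis using h that[of "k - m" z] by simp
qed

lemma Bc_conv:
  assumes "f \<in> Bc G" "f' \<in> Bc G" shows "gconv G f f' \<in> Bc G"
proof -
  obtain N M where NM: "\<And>g. f g \<noteq> 0 \<Longrightarrow> g \<in> lev N" "\<And>g. f' g \<noteq> 0 \<Longrightarrow> g \<in> lev N"
    using BcE2[OF assms] by metis
  obtain R R' where R: "op_bound f R" "op_bound f' R'" using op_bound_exists assms by metis
  \<comment> \<open>The operator bound of the product also bounds its values, which supplies the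
    boundedness required in \<open>Bc\<close>.\<close>
  have b: "op_bound (gconv G f f') (R * R')" by (rule op_bound_conv[OF assms(1) R])
  show ?thesis
  proof (rule BcI[of _ "N + N" "R * R'"])
    fix g :: arrow
    obtain x k y where g: "g = (x, k, y)" by (cases g)
    show "g \<in> lev (N + N)" if nz: "gconv G f f' g \<noteq> 0"
    proof -
      obtain z l where "f (x, l, z) \<noteq> 0" "f' (z, k - l, y) \<noteq> 0"
        using gconv_support[OF NM(1) nz[unfolded g]] by blast
      then show ?thesis using lev_comp[OF NM(1) NM(2)] by (fastforce simp: g)
    qed
    show "cmod (gconv G f f' g) \<le> R * R'"
    proof (cases "g \<in> arrows")
      case True then show ?thesis by (rule norm_le_op_bound[OF b])
    next
      case False then show ?thesis using op_bound_ge_0[OF b] by (simp add: g gconv_eq)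
    qed
  qed
qed

lemma Bc_star:
  assumes "f \<in> Bc G" shows "gstar G f \<in> Bc G"
proof -
  obtain N M where NM: "\<And>g. f g \<noteq> 0 \<Longrightarrow> g \<in> lev N" "\<And>g. cmod (f g) \<le> M" "M > 0"
    using assms by (rule BcE) blast
  show ?thesis
  proof (rule BcI[of _ N M])
    fix g :: arrow
    obtain x k y where g: "g = (x, k, y)" by (cases g)
    show "gstar G f g \<noteq> 0 \<Longrightarrow> g \<in> lev N"
      using NM(1)[of "(y, - k, x)"] lev_inv[of x k y N] by (auto simp: g gstar_eq split: if_splits)
    show "cmod (gstar G f g) \<le> M" using NM by (auto simp: g gstar_eq less_imp_le)
  qed
qed

lemma gstar_gstar: "f \<in> Bc G \<Longrightarrow> gstar G (gstar G f) = f"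
proof
  fix g :: arrow assume f: "f \<in> Bc G"
  obtain x k y where g: "g = (x, k, y)" by (cases g)
  show "gstar G (gstar G f) g = f g"
    using Bc_vanish[OF f] arrows_inv[of x k y] by (auto simp: g gstar_eq)
qed

lemma gconv_add_left:
  assumes "f \<in> Bc G" "f' \<in> Bc G"
  shows "gconv G (\<lambda>g. f g + f' g) f'' = (\<lambda>g. gconv G f f'' g + gconv G f' f'' g)"
proof
  fix g :: arrow
  obtain x k y where g: "g = (x, k, y)" by (cases g)
  obtain N M where NM: "\<And>g. f g \<noteq> 0 \<Longrightarrow> g \<in> lev N" "\<And>g. f' g \<noteq> 0 \<Longrightarrow> g \<in> lev N"
    using BcE2[OF assms] by metis
  have N: "\<forall>g. f g + f' g \<noteq> 0 \<longrightarrow> g \<in> lev N" "\<forall>g. f g \<noteq> 0 \<longrightarrow> g \<in> lev N" "\<forall>g. f' g \<noteq> 0 \<longrightarrow> g \<in> lev N"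
    using NM by force+
  show "gconv G (\<lambda>g. f g + f' g) f'' g = gconv G f f'' g + gconv G f' f'' g"
  proof (cases "(x, k, y) \<in> arrows")
    case True
    show ?thesis unfolding g N[THEN gconv_row, OF True] by (simp add: sum.distrib distrib_right)
  qed (simp add: g gconv_eq)
qed

lemma gconv_linear_right:
  assumes "f \<in> Bc G"
  shows "gconv G f (\<lambda>g. f' g + f'' g) = (\<lambda>g. gconv G f f' g + gconv G f f'' g)"
    "gconv G f (\<lambda>g. z * f' g) = (\<lambda>g. z * gconv G f f' g)"
    "gconv G (\<lambda>g. z * f g) f' = (\<lambda>g. z * gconv G f f' g)"
proof -
  obtain N where N: "\<And>g. f g \<noteq> 0 \<Longrightarrow> g \<in> lev N" using assms by (rule BcE) blast
  have N': "\<forall>g. f g \<noteq> 0 \<longrightarrow> g \<in> lev N" "\<forall>g. z * f g \<noteq> 0 \<longrightarrow> g \<in> lev N" using N by auto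
  have "gconv G f (\<lambda>g. f' g + f'' g) (x, k, y) = gconv G f f' (x, k, y) + gconv G f f'' (x, k, y) \<and>
    gconv G f (\<lambda>g. z * f' g) (x, k, y) = z * gconv G f f' (x, k, y) \<and>
    gconv G (\<lambda>g. z * f g) f' (x, k, y) = z * gconv G f f' (x, k, y)" for x k y
  proof (cases "(x, k, y) \<in> arrows")
    case True
    show ?thesis unfolding N'[THEN gconv_row, OF True]
      by (simp add: distrib_left distrib_right sum.distrib sum_distrib_left mult_ac)
  qed (simp add: gconv_eq)
  then show "gconv G f (\<lambda>g. f' g + f'' g) = (\<lambda>g. gconv G f f' g + gconv G f f'' g)"
    "gconv G f (\<lambda>g. z * f' g) = (\<lambda>g. z * gconv G f f' g)"
    "gconv G (\<lambda>g. z * f g) f' = (\<lambda>g. z * gconv G f f' g)"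
    by (simp_all add: fun_eq_iff)
qed

lemma Bc_algebra_simps [simp]:
  "acarrier (Bc_algebra G) = Bc G" "azero (Bc_algebra G) = (\<lambda>_. 0)"
  "aplus (Bc_algebra G) f f' = (\<lambda>g. f g + f' g)" "ascale (Bc_algebra G) z f = (\<lambda>g. z * f g)"
  "atimes (Bc_algebra G) f f' = gconv G f f'" "astar (Bc_algebra G) f = gstar G f"
  by (simp_all add: Bc_algebra_def)

lemma nrm_zero: "nrm (\<lambda>_. 0) \<le> 0"
  by (subst nrm_le_iff) (auto simp: Bc_zero op_bound_def)

lemma nrm_scale_le: "f \<in> Bc G \<Longrightarrow> nrm (\<lambda>g. z * f g) \<le> cmod z * nrm f"
  by (subst nrm_le_iff) (auto simp: Bc_scale nrm_ge_0 op_bound_scale op_bound_of_nrm)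

text \<open>The missing inequality is \<open>nrm_scale_le\<close> for the inverse scalar, applied to
  the scaled function.\<close>

lemma nrm_scale:
  assumes "f \<in> Bc G" shows "nrm (\<lambda>g. z * f g) = cmod z * nrm f"
proof (cases "z = 0")
  case True
  then show ?thesis using nrm_zero nrm_ge_0[OF Bc_zero] by simp
next
  case False
  have "nrm (\<lambda>g. inverse z * (z * f g)) \<le> cmod (inverse z) * nrm (\<lambda>g. z * f g)"
    by (rule nrm_scale_le[OF Bc_scale[OF assms]])
  then have "nrm f \<le> nrm (\<lambda>g. z * f g) / cmod z" using False
    by (simp add: norm_inverse divide_inverse mult.commute flip: mult.assoc)
  then have "cmod z * nrm f \<le> nrm (\<lambda>g. z * f g)" using False by (simp add: pos_le_divide_eq mult.commute)
  then show ?thesis using nrm_scale_le[OF assms, of z] by simp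
qed

lemma nrm_star_le: "f \<in> Bc G \<Longrightarrow> nrm (gstar G f) \<le> nrm f"
  by (subst nrm_le_iff) (auto simp: Bc_star nrm_ge_0 op_bound_star op_bound_of_nrm)

sublocale Bc: normed_star_algebra "Bc_algebra G"
proof (unfold_locales, goal_cases)
  case 1 then show ?case by (simp add: Bc_zero)
next
  case (2 a b) then show ?case by (simp add: Bc_add)
next
  case (3 a z) then show ?case by (simp add: Bc_scale)
next
  case (4 a b) then show ?case by (simp add: Bc_conv)
next
  case (5 a) then show ?case by (simp add: Bc_star)
next
  case (13 a b c) then show ?case by (simp add: gconv_add_left)
next
  case (14 a b c) then show ?case by (simp add: gconv_linear_right)
next
  case (15 a b z) then show ?case by (simp add: gconv_linear_right)
next
  case (16 a b z) then show ?case by (simp add: gconv_linear_right)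
next
  case (17 a b) then show ?case by (auto simp: fun_eq_iff gstar_def)
next
  case (18 a z) then show ?case by (auto simp: fun_eq_iff gstar_def)
next
  case (19 a b)
  then show ?case
    by (simp, subst nrm_le_iff) (auto simp: Bc_add nrm_ge_0 op_bound_add op_bound_of_nrm)
next
  case (20 a z) then show ?case by (simp add: nrm_scale)
next
  case (21 a b)
  then show ?case
    by (simp, subst nrm_le_iff) (auto simp: Bc_conv nrm_ge_0 op_bound_conv op_bound_of_nrm)
next
  case (22 a)
  then show ?case using nrm_star_le[of a] nrm_star_le[of "gstar G a"] by (simp add: Bc_star gstar_gstar)
qed (auto simp: algebra_simps)

abbreviation Br :: "(nat \<Rightarrow> arrow \<Rightarrow> complex) set star_algebra" where "Br \<equiv> Br_algebra G"

sublocale Br: normed_star_algebra Br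
  unfolding Br_algebra_def by (rule Bc.normed_star_algebra_completion)

section \<open>Elements of the completion as functions\<close>

abbreviation embed :: "(arrow \<Rightarrow> complex) \<Rightarrow> (nat \<Rightarrow> arrow \<Rightarrow> complex) set" where
  "embed \<equiv> completion_embed (Bc_algebra G)"

lemma embed_simps:
  "f \<in> Bc G \<Longrightarrow> embed f \<in> acarrier Br"
  "\<lbrakk>f \<in> Bc G; f' \<in> Bc G\<rbrakk> \<Longrightarrow> aplus Br (embed f) (embed f') = embed (\<lambda>g. f g + f' g)"
  "f \<in> Bc G \<Longrightarrow> ascale Br z (embed f) = embed (\<lambda>g. z * f g)"
  "\<lbrakk>f \<in> Bc G; f' \<in> Bc G\<rbrakk> \<Longrightarrow> atimes Br (embed f) (embed f') = embed (gconv G f f')"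
  "azero Br = embed (\<lambda>_. 0)"
  "f \<in> Bc G \<Longrightarrow> anorm Br (embed f) = nrm f"
  using Bc.embed_in[of f] Bc.embed_plus[of f f'] Bc.embed_scale[of f] Bc.embed_times[of f f'] Bc.embed_zero
    Bc.embed_norm[of f]
  by (simp_all add: Br_algebra_def)

lemma norm_le_nrm:
  assumes "f \<in> Bc G" shows "cmod (f g) \<le> nrm f"
proof (cases "g \<in> arrows")
  case True then show ?thesis by (rule norm_le_op_bound[OF op_bound_of_nrm[OF assms]])
next
  case False then show ?thesis using Bc_vanish[OF assms False] nrm_ge_0[OF assms] by simp
qed

lemma norm_diff_le_adist:
  assumes "f \<in> Bc G" "f' \<in> Bc G" shows "cmod (f g - f' g) \<le> adist (Bc_algebra G) f f'"
  using norm_le_nrm[OF Bc_add[OF assms(1) Bc_scale[OF assms(2), of "-1"]], of g]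
  by (simp add: adist_def)

text \<open>Evaluation at an arrow is contractive on \<open>B_c\<close> by
  \<open>norm_le_nrm\<close> and hence extends to the completion. The choice of the representative
  has no influence on the limit, see \<open>evaluate_lim\<close>.\<close>

definition evaluate :: "(nat \<Rightarrow> arrow \<Rightarrow> complex) set \<Rightarrow> arrow \<Rightarrow> complex" where
  "evaluate X g = lim (\<lambda>i. (SOME f. f \<in> X) i g)"

lemma evaluate_lim:
  assumes f: "f \<in> cauchy_seqs (Bc_algebra G)"
  shows "(\<lambda>i. f i g) \<longlonglongrightarrow> evaluate (Bc.cls f) g"
proof -
  define f' where "f' = (SOME f'. f' \<in> Bc.cls f)"
  have "f' \<in> Bc.cls f"
    unfolding f'_def using Bc.class_self[OF f]
    by (rule someI[where P = "\<lambda>f'. f' \<in> Bc.cls f"])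
  note F = Bc.class_memD[OF this]
  have Bc: "f i \<in> Bc G" "f' i \<in> Bc G" for i
    using Bc.cauchy_seqsD(1)[OF F(1)] Bc.cauchy_seqsD(1)[OF F(2)] by simp_all
  have "Cauchy (\<lambda>i. f' i g)"
  proof (rule metric_CauchyI)
    fix e :: real assume "e > 0"
    then obtain N where N: "\<forall>m\<ge>N. \<forall>n\<ge>N. adist (Bc_algebra G) (f' m) (f' n) < e"
      using Bc.cauchy_seqsD(2)[OF F(2)] by blast
    show "\<exists>M. \<forall>m\<ge>M. \<forall>n\<ge>M. dist (f' m g) (f' n g) < e"
    proof (intro exI allI impI)
      fix m n assume "N \<le> m" "N \<le> n"
      then show "dist (f' m g) (f' n g) < e"
        using N norm_diff_le_adist[OF Bc(2) Bc(2), of m g n] unfolding dist_norm by (meson order_le_less_trans)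
    qed
  qed
  then have lim': "(\<lambda>i. f' i g) \<longlonglongrightarrow> evaluate (Bc.cls f) g"
    unfolding evaluate_def f'_def[symmetric] Cauchy_convergent_iff convergent_LIMSEQ_iff .
  have "(\<lambda>i. f i g - f' i g) \<longlonglongrightarrow> 0"
    by (rule Lim_null_comparison[OF _ F(3)]) (simp add: norm_diff_le_adist Bc)
  from tendsto_add[OF this lim'] show ?thesis by simp
qed

lemma evaluate_embed: "f \<in> Bc G \<Longrightarrow> evaluate (embed f) g = f g"
  using evaluate_lim[OF Bc.const_cauchy, of f g] LIMSEQ_unique[OF _ tendsto_const]
  by (simp add: completion_embed_def)

lemma norm_evaluate_diff_le:
  assumes "X \<in> acarrier Br" "Y \<in> acarrier Br"
  shows "cmod (evaluate X g - evaluate Y g) \<le> adist Br X Y"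
proof -
  obtain f f' where f: "f \<in> cauchy_seqs (Bc_algebra G)" "X = Bc.cls f"
    "f' \<in> cauchy_seqs (Bc_algebra G)" "Y = Bc.cls f'"
    using assms unfolding Br_algebra_def by (metis Bc.classE)
  have "f i \<in> Bc G" "f' i \<in> Bc G" for i
    using Bc.cauchy_seqsD(1)[OF f(1)] Bc.cauchy_seqsD(1)[OF f(3)] by simp_all
  then show ?thesis
    using LIMSEQ_le[OF tendsto_norm[OF tendsto_diff[OF evaluate_lim[OF f(1)] evaluate_lim[OF f(3)]]]
      Bc.completion_dist[OF f(1,3)]] norm_diff_le_adist
    unfolding f Br_algebra_def by blast
qed

text \<open>For large indices \<open>f i - f (j + N)\<close> has operator bound \<open>e/2\<close>.
  As \<open>j\<close> grows, the subtracted term vanishes pointwise, and by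
  \<open>op_bound_lim\<close> the bound is inherited by \<open>f i\<close> itself.\<close>

lemma evaluate_eq_0:
  assumes X: "X \<in> acarrier Br" and zero: "\<And>g. evaluate X g = 0"
  shows "X = azero Br"
proof -
  obtain f where f: "f \<in> cauchy_seqs (Bc_algebra G)" "X = Bc.cls f"
    using X unfolding Br_algebra_def by (metis Bc.classE)
  have Bc: "f i \<in> Bc G" for i using Bc.cauchy_seqsD(1)[OF f(1)] by simp
  have "(\<lambda>i. nrm (f i)) \<longlonglongrightarrow> 0"
  proof (rule LIMSEQ_I)
    fix e :: real assume "e > 0"
    then obtain N where N: "\<forall>m\<ge>N. \<forall>n\<ge>N. adist (Bc_algebra G) (f m) (f n) < e/2"
      using Bc.cauchy_seqsD(2)[OF f(1), of "e/2"] by auto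
    have "nrm (f i) \<le> e/2" if i: "i \<ge> N" for i
    proof -
      have "op_bound (f i) (e/2)"
      proof (rule op_bound_lim[where f = "\<lambda>j g. f i g + - 1 * f (j + N) g"])
        fix g
        have "(\<lambda>j. f j g) \<longlonglongrightarrow> 0" using evaluate_lim[OF f(1), of g] zero[of g] by (simp add: f(2))
        then have "(\<lambda>j. f (j + N) g) \<longlonglongrightarrow> 0" by (rule LIMSEQ_ignore_initial_segment)
        from tendsto_add[OF tendsto_const tendsto_mult_left[OF this, of "- 1"], of "f i g"]
        show "(\<lambda>j. f i g + - 1 * f (j + N) g) \<longlonglongrightarrow> f i g" by simp
      next
        fix j
        have "nrm (\<lambda>g. f i g + - 1 * f (j + N) g) \<le> e/2"
          using N i by (simp add: adist_def less_imp_le)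
        then show "op_bound (\<lambda>g. f i g + - 1 * f (j + N) g) (e/2)"
          using \<open>e > 0\<close> by (subst nrm_le_iff[symmetric]) (simp_all only: Bc_add Bc_scale Bc)
      qed
      then show ?thesis using nrm_le_iff[OF Bc, of "e/2" i] \<open>e > 0\<close> by simp
    qed
    then have "\<forall>i\<ge>N. norm (nrm (f i) - 0) < e" using \<open>e > 0\<close> nrm_ge_0[OF Bc] by fastforce
    then show "\<exists>no. \<forall>i\<ge>no. norm (nrm (f i) - 0) < e" by blast
  qed
  then have "(\<lambda>i. adist (Bc_algebra G) (f i) (azero (Bc_algebra G))) \<longlonglongrightarrow> 0"
    by (simp add: adist_def)
  then show ?thesis
    unfolding f(2) Br_algebra_def Bc.completion_zero
    using Bc.class_eq_iff[OF f(1) Bc.const_cauchy[OF Bc.zero_in]] by blast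
qed

text \<open>At the unit \<open>y\<close> the function \<open>f^* f\<close> is the sum of
  \<open>|f h|^2\<close> over the source fibre, so each arrow of the fibre gives a lower bound; this
  is then carried to the limit.\<close>

lemma evaluate_star_times:
  assumes X: "X \<in> acarrier Br" and g: "(x, k, y) \<in> arrows"
  shows "(cmod (evaluate X (x, k, y)))\<^sup>2 \<le>
    Re (evaluate (atimes Br (astar Br X) X) (y, 0, y))"
proof -
  obtain f where f: "f \<in> cauchy_seqs (Bc_algebra G)" "X = Bc.cls f"
    using X unfolding Br_algebra_def by (metis Bc.classE)
  have Bc: "f i \<in> Bc G" for i using Bc.cauchy_seqsD(1)[OF f(1)] by simp
  have y: "(y, 0, y) \<in> arrows" using g arrows_unit by (simp add: mem_arrows)
  have le: "(cmod (f i (x, k, y)))\<^sup>2 \<le> Re (gconv G (gstar G (f i)) (f i) (y, 0, y))" for i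
  proof -
    obtain N where N: "\<And>g. gstar G (f i) g \<noteq> 0 \<Longrightarrow> g \<in> lev N" using Bc_star[OF Bc] by (rule BcE) blast
    \<comment> \<open>The given arrow is inserted so that it occurs among the summands whatever the
      support of \<open>f i\<close> is.\<close>
    define Z where "Z = insert (x, k, y) (row N (y, 0, y))"
    have Z: "finite Z" "row N (y, 0, y) \<subseteq> Z" "Z \<subseteq> fibre y"
      using finite_row g by (auto simp: Z_def row_def mem_fibre)
    have "gconv G (gstar G (f i)) (f i) (y, 0, y) = (\<Sum>h\<in>Z. gstar G (f i) (quot (y, 0, y) h) * f i h)"
      by (rule gconv_sum[OF N y Z])
    also have "\<dots> = (\<Sum>h\<in>Z. complex_of_real ((cmod (f i h))\<^sup>2))"
    proof (rule sum.cong[OF refl])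
      fix h assume "h \<in> Z"
      then have h: "h \<in> fibre y" using Z by auto
      moreover have "(y, 0, y) \<in> fibre y" using y by (simp add: mem_fibre)
      moreover have "quot h (y, 0, y) = h" using h by (cases h) (simp add: mem_fibre)
      ultimately have "gstar G (f i) (quot (y, 0, y) h) = cnj (f i h)" by (simp add: gstar_quotient)
      then show "gstar G (f i) (quot (y, 0, y) h) * f i h = complex_of_real ((cmod (f i h))\<^sup>2)"
        by (simp only: complex_norm_square mult.commute)
    qed
    finally have "Re (gconv G (gstar G (f i)) (f i) (y, 0, y)) = (\<Sum>h\<in>Z. (cmod (f i h))\<^sup>2)"
      by (simp only: Re_complex_of_real flip: of_real_sum)
    moreover have "(cmod (f i (x, k, y)))\<^sup>2 \<le> (\<Sum>h\<in>Z. (cmod (f i h))\<^sup>2)"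
      by (rule member_le_sum) (use Z in \<open>auto simp: Z_def\<close>)
    ultimately show ?thesis by simp
  qed
  have "atimes Br (astar Br X) X =
      Bc.cls (\<lambda>i. gconv G (gstar G (f i)) (f i))"
    using Bc.completion_star[OF f(1)] Bc.completion_times[OF Bc.cauchy_star[OF f(1)] f(1)]
    by (simp add: f(2) Br_algebra_def)
  moreover have "(\<lambda>i. gconv G (gstar G (f i)) (f i)) \<in> cauchy_seqs (Bc_algebra G)"
    using Bc.cauchy_times[OF Bc.cauchy_star[OF f(1)] f(1)] by simp
  ultimately have "(\<lambda>i. gconv G (gstar G (f i)) (f i) (y, 0, y)) \<longlonglongrightarrow>
      evaluate (atimes Br (astar Br X) X) (y, 0, y)"
    using evaluate_lim by simp
  then have "(\<lambda>i. Re (gconv G (gstar G (f i)) (f i) (y, 0, y))) \<longlonglongrightarrow>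
      Re (evaluate (atimes Br (astar Br X) X) (y, 0, y))"
    by (rule tendsto_Re)
  moreover have "(\<lambda>i. (cmod (f i (x, k, y)))\<^sup>2) \<longlonglongrightarrow> (cmod (evaluate X (x, k, y)))\<^sup>2"
    unfolding f(2) by (intro tendsto_intros evaluate_lim f(1))
  ultimately show ?thesis using le by (rule_tac LIMSEQ_le) auto
qed

section \<open>Convolution with elementary bisections\<close>

lemma bisection_eq:
  "\<lbrakk>u \<frown> w \<in> S; v \<frown> w \<in> S\<rbrakk> \<Longrightarrow> bisection u v (u \<frown> w, int (length u) - int (length v), v \<frown> w) = 1"
  by (auto simp: bisection_def)

text \<open>Exactly one arrow \<open>h\<close> makes the entry of \<open>bisection u v\<close>
  non-zero, namely the one whose range has \<open>v\<close> in place of \<open>u\<close>; the degree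
  drops by the difference of the lengths.\<close>

lemma gconv_bisection_left:
  assumes g: "(u \<frown> w, k, y) \<in> arrows" and v: "v \<frown> w \<in> S"
  shows "gconv G (bisection u v) f (u \<frown> w, k, y) = f (v \<frown> w, k - int (length u) + int (length v), y)"
proof -
  let ?h = "(v \<frown> w, k - int (length u) + int (length v), y)"
  have u: "u \<frown> w \<in> S" using g by (simp add: mem_arrows)
  have h: "?h \<in> fibre y" using arrows_comp[OF arrowsI[OF v u] g] by (simp add: mem_fibre algebra_simps)
  have "(\<Sum>\<^sub>\<infinity>h\<in>fibre y. bisection u v (quot (u \<frown> w, k, y) h) * f h) =
      bisection u v (quot (u \<frown> w, k, y) ?h) * f ?h"
  proof (rule infsum_single_nonzero[OF h])
    fix h assume h': "h \<in> fibre y" "h \<noteq> ?h"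
    obtain z l where "h = (z, l, y)" using h' by (cases h) (auto simp: mem_fibre)
    then have "bisection u v (quot (u \<frown> w, k, y) h) = 0"
      using h'(2) by (auto simp: bisection_def)
    then show "bisection u v (quot (u \<frown> w, k, y) h) * f h = 0" by simp
  qed
  then show ?thesis using g bisection_eq[OF u v] by (simp add: gconv_eq)
qed

lemma gconv_bisection_left_0:
  assumes "\<And>w. x = u \<frown> w \<Longrightarrow> v \<frown> w \<notin> S"
  shows "gconv G (bisection u v) f (x, k, y) = 0"
proof -
  have "bisection u v (quot (x, k, y) h) = 0" for h
    using assms by (cases h) (auto simp: bisection_def)
  then show ?thesis by (simp add: gconv_eq)
qed

section \<open>Indicator functions on the unit space\<close>

definition diag :: "(nat \<Rightarrow> nat) set \<Rightarrow> arrow \<Rightarrow> complex" where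
  "diag D = (\<lambda>(x, k, y). if x \<in> D \<and> k = 0 \<and> x = y then 1 else 0)"

lemma diag_simp: "diag D (x, k, y) = (if x \<in> D \<and> k = 0 \<and> x = y then 1 else 0)"
  by (simp add: diag_def)

text \<open>\<open>D\<close> is an arbitrary subset: continuity plays no part in \<open>B_c\<close>,
  so these projections are available before it is known which of them lie in the reduced
  algebra.\<close>

lemma diag_Bc: "D \<subseteq> S \<Longrightarrow> diag D \<in> Bc G"
proof (rule BcI[of _ 0 1])
  fix g :: arrow
  assume D: "D \<subseteq> S"
  obtain x k y where g: "g = (x, k, y)" by (cases g)
  show "g \<in> lev 0" if "diag D g \<noteq> 0"
    using that D by (auto simp: g diag_simp split: if_splits intro: levI[of _ _ 0 _ 0])
  show "cmod (diag D g) \<le> 1" by (simp add: g diag_simp)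
qed

lemma gconv_unit_left:
  assumes D: "D \<subseteq> S" and f: "f \<in> Bc G"
  shows "gconv G (diag D) f = (\<lambda>(x, k, y). if x \<in> D then f (x, k, y) else 0)"
proof (rule ext)
  fix g :: arrow
  obtain x k y where g: "g = (x, k, y)" by (cases g)
  show "gconv G (diag D) f g = (case g of (x, k, y) \<Rightarrow> if x \<in> D then f (x, k, y) else 0)"
  proof (cases "g \<in> arrows")
    case True
    then have h: "(x, k, y) \<in> fibre y" by (simp add: g mem_fibre)
    have "(\<Sum>\<^sub>\<infinity>h\<in>fibre y. diag D (quot (x, k, y) h) * f h) =
        diag D (quot (x, k, y) (x, k, y)) * f (x, k, y)"
      by (rule infsum_single_nonzero[OF h]) (auto simp: diag_def fibre_def quot_def)
    then show ?thesis using True by (simp add: g gconv_eq diag_simp)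
  next
    case False then show ?thesis using Bc_vanish[OF f False] by (simp add: g gconv_eq)
  qed
qed

lemma gconv_unit_right:
  assumes D: "D \<subseteq> S" and f: "f \<in> Bc G"
  shows "gconv G f (diag D) = (\<lambda>(x, k, y). if y \<in> D then f (x, k, y) else 0)"
proof (rule ext)
  fix g :: arrow
  obtain x k y where g: "g = (x, k, y)" by (cases g)
  show "gconv G f (diag D) g = (case g of (x, k, y) \<Rightarrow> if y \<in> D then f (x, k, y) else 0)"
  proof (cases "g \<in> arrows")
    case True
    then have h: "(y, 0, y) \<in> fibre y" by (simp add: g mem_fibre arrows_unit mem_arrows[of x])
    have "(\<Sum>\<^sub>\<infinity>h\<in>fibre y. f (quot (x, k, y) h) * diag D h) =
        f (quot (x, k, y) (y, 0, y)) * diag D (y, 0, y)"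
      by (rule infsum_single_nonzero[OF h])
        (auto simp: diag_def fibre_def quot_def split: if_splits)
    then show ?thesis using True by (simp add: g gconv_eq diag_simp)
  next
    case False then show ?thesis using Bc_vanish[OF f False] by (simp add: g gconv_eq)
  qed
qed

lemma diag_mult:
  "\<lbrakk>D \<subseteq> S; D' \<subseteq> S\<rbrakk> \<Longrightarrow>
    gconv G (diag D) (diag D') = diag (D \<inter> D')"
  by (simp only: gconv_unit_left diag_Bc) (auto simp: diag_def)

text \<open>The range of the partial bijection given by \<open>bisection u v\<close>. It is closed
  but in general not open in \<open>S\<close>, which is why its indicator can leave
  \<open>Cc\<close>.\<close>

definition comparable :: "nat list \<Rightarrow> nat list \<Rightarrow> (nat \<Rightarrow> nat) set" where
  "comparable u v = {x \<in> S. \<exists>w. x = u \<frown> w \<and> v \<frown> w \<in> S}"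

lemma bisection_mult: "gconv G (bisection u v) (bisection v u) = diag (comparable u v)"
proof (rule ext)
  fix g :: arrow
  obtain x k y where g: "g = (x, k, y)" by (cases g)
  show "gconv G (bisection u v) (bisection v u) g = diag (comparable u v) g"
  proof (cases "\<exists>w. x = u \<frown> w \<and> v \<frown> w \<in> S")
    case True
    then obtain w where w: "x = u \<frown> w" "v \<frown> w \<in> S" by blast
    show ?thesis
    proof (cases "g \<in> arrows")
      case arr: True
      have u: "u \<frown> w \<in> S" using arr by (simp add: g w mem_arrows)
      have "gconv G (bisection u v) (bisection v u) g =
          bisection v u (v \<frown> w, k - int (length u) + int (length v), y)"
        using gconv_bisection_left[of u w k y v] arr w by (simp add: g)
      also have "\<dots> = diag (comparable u v) g"
      proof (cases "k = 0 \<and> y = u \<frown> w")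
        case True
        then show ?thesis using w u bisection_eq[OF w(2) u] by (auto simp: g diag_simp comparable_def)
      next
        case False
        then have "bisection v u (v \<frown> w, k - int (length u) + int (length v), y) = 0"
          by (auto simp: bisection_def)
        then show ?thesis using False by (auto simp: g diag_simp w)
      qed
      finally show ?thesis .
    next
      case False
      then have "\<not> (x \<in> S \<and> k = 0 \<and> x = y)" using arrows_unit by (auto simp: g)
      then show ?thesis using False by (auto simp: g gconv_eq diag_simp comparable_def)
    qed
  next
    case False
    then show ?thesis unfolding g by (subst gconv_bisection_left_0) (auto simp: diag_simp comparable_def)
  qed
qed

lemma bisection_Bc: "bisection u v \<in> Bc G"
  using bisection_in_Cc by (simp add: Cc_def)

text \<open>Conjugation pulls \<open>D\<close> back along the map that prepends \<open>u\<close>.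
  Within an ideal it therefore passes from \<open>D\<close> to the images under shifts of parts of
  \<open>D\<close>.\<close>

lemma bisection_conjugate:
  assumes D: "D \<subseteq> S"
  shows "gconv G (bisection [] u) (gconv G (diag D) (bisection u [])) =
    diag {w. u \<frown> w \<in> D}"
proof (rule ext)
  fix g :: arrow
  obtain x k y where g: "g = (x, k, y)" by (cases g)
  define f where "f = gconv G (diag D) (bisection u [])"
  have f: "f (z, l, y) = (if z \<in> D then bisection u [] (z, l, y) else 0)" for z l y
    by (simp add: f_def gconv_unit_left[OF D bisection_Bc])
  have "gconv G (bisection [] u) f g = diag {w. u \<frown> w \<in> D} g"
  proof (cases "u \<frown> x \<in> D")
    case True
    then have ux: "u \<frown> x \<in> S" "x \<in> S" using D conc_tail_in by blast+
    show ?thesis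
    proof (cases "g \<in> arrows")
      case arr: True
      have "gconv G (bisection [] u) f g = f (u \<frown> x, k + int (length u), y)"
        using gconv_bisection_left[of "[]" x k y u f] arr ux by (simp add: g)
      also have "\<dots> = diag {w. u \<frown> w \<in> D} g"
        using True ux by (auto simp: f g diag_simp bisection_def)
      finally show ?thesis .
    next
      case False
      then have "\<not> (k = 0 \<and> x = y)" using arrows_unit[OF ux(2)] by (auto simp: g)
      then show ?thesis using False by (auto simp: g gconv_eq diag_simp)
    qed
  next
    case False
    show ?thesis
    proof (cases "g \<in> arrows \<and> u \<frown> x \<in> S")
      case arr: True
      have "gconv G (bisection [] u) f g = f (u \<frown> x, k + int (length u), y)"
        using gconv_bisection_left[of "[]" x k y u f] arr by (simp add: g)
      then show ?thesis using False by (simp add: f g diag_simp)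
    next
      case na: False
      then have "gconv G (bisection [] u) f g = 0"
        using gconv_bisection_left_0[of x "[]" u f k y] by (auto simp: g gconv_eq)
      then show ?thesis using False by (simp add: g diag_simp)
    qed
  qed
  then show "gconv G (bisection [] u) (gconv G (diag D) (bisection u [])) g = diag {w. u \<frown> w \<in> D} g"
    by (simp add: f_def)
qed

section \<open>The reduced algebra\<close>

definition cr :: "(nat \<Rightarrow> arrow \<Rightarrow> complex) set set" where
  "cr = acarrier (Cr_algebra G)"

lemma Cr_algebra_eq: "Cr_algebra G = Br\<lparr>acarrier := cr\<rparr>"
  by (simp add: cr_def Cr_algebra_def cstar_generated_def)

lemma cr_eq: "cr = \<Inter>{B. cstar_subalgebra Br B \<and> embed ` Cc G \<subseteq> B}"
  by (simp add: cr_def Cr_algebra_def cstar_generated_def)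

lemma cr_least: "\<lbrakk>cstar_subalgebra Br B; embed ` Cc G \<subseteq> B\<rbrakk> \<Longrightarrow> cr \<subseteq> B"
  unfolding cr_eq by blast

lemma cr_sub: "cr \<subseteq> acarrier Br"
proof (rule cr_least)
  show "cstar_subalgebra Br (acarrier Br)"
    by (simp add: cstar_subalgebra_def linear_subspace_def anorm_closed_def Br.closed_ops)
  show "embed ` Cc G \<subseteq> acarrier Br" by (auto simp: Cc_def embed_simps)
qed

lemma cr_ops:
  "azero Br \<in> cr"
  "\<lbrakk>X \<in> cr; Y \<in> cr\<rbrakk> \<Longrightarrow> aplus Br X Y \<in> cr"
  "X \<in> cr \<Longrightarrow> ascale Br z X \<in> cr"
  "\<lbrakk>X \<in> cr; Y \<in> cr\<rbrakk> \<Longrightarrow> atimes Br X Y \<in> cr"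
  "X \<in> cr \<Longrightarrow> astar Br X \<in> cr"
  unfolding cr_eq by (auto simp: cstar_subalgebra_def linear_subspace_def)

lemma embed_Cc_in_cr: "f \<in> Cc G \<Longrightarrow> embed f \<in> cr"
  unfolding cr_eq by blast

lemma embed_conv_in_cr:
  "\<lbrakk>f \<in> Bc G; f' \<in> Bc G; embed f \<in> cr; embed f' \<in> cr\<rbrakk> \<Longrightarrow> embed (gconv G f f') \<in> cr"
  using cr_ops(4)[of "embed f" "embed f'"] by (simp add: embed_simps)

lemma comparable_sub: "comparable u v \<subseteq> S"
  by (auto simp: comparable_def)

lemma comparable_in_cr: "embed (diag (comparable u v)) \<in> cr"
  unfolding bisection_mult[symmetric]
  by (intro embed_conv_in_cr bisection_Bc embed_Cc_in_cr bisection_in_Cc)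

section \<open>Generalized cylinders and their indicators\<close>

abbreviation cyl :: "nat list \<Rightarrow> nat list set \<Rightarrow> (nat \<Rightarrow> nat) set" where
  "cyl \<equiv> generalized_cylinder S"

lemma conc_mem_cyl:
  "u \<frown> w \<in> cyl u F \<longleftrightarrow> u \<frown> w \<in> S \<and> (\<forall>v\<in>F. v \<frown> w \<in> S)"
proof -
  have "(\<exists>y\<in>cylinder S v. \<forall>i. y (length v + i) = (u \<frown> w) (length u + i)) \<longleftrightarrow> v \<frown> w \<in> S" for v
  proof
    assume "\<exists>y\<in>cylinder S v. \<forall>i. y (length v + i) = (u \<frown> w) (length u + i)"
    then obtain y where y: "y \<in> S" "\<forall>i<length v. y i = v ! i" "\<forall>i. y (length v + i) = w i"
      by (auto simp: cylinder_def)
    have "suffix (length v) y = w" using y(3) by (simp add: fun_eq_iff)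
    then have "y = v \<frown> w" using conc_eq_iff[OF refl, of y v w] y(2) by blast
    then show "v \<frown> w \<in> S" using y(1) by simp
  next
    assume "v \<frown> w \<in> S"
    then show "\<exists>y\<in>cylinder S v. \<forall>i. y (length v + i) = (u \<frown> w) (length u + i)"
      by (intro bexI[of _ "v \<frown> w"]) (auto simp: cylinder_def)
  qed
  then show ?thesis by (auto simp: generalized_cylinder_def cylinder_def)
qed

lemma cylE:
  assumes "x \<in> cyl u F"
  obtains w where "x = u \<frown> w" "u \<frown> w \<in> S" "\<And>v. v \<in> F \<Longrightarrow> v \<frown> w \<in> S"
proof -
  have "x = u \<frown> suffix (length u) x"
    using assms conc_eq_iff[OF refl, of x u] by (auto simp: generalized_cylinder_def cylinder_def)
  then show ?thesis using that assms conc_mem_cyl by metis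
qed

lemma cyl_sub: "cyl u F \<subseteq> S"
  by (auto simp: generalized_cylinder_def cylinder_def)

lemma cyl_insert:
  "cyl u (insert v F) = cyl u F \<inter> comparable u v"
proof -
  have "x \<in> cyl u (insert v F) \<longleftrightarrow> x \<in> cyl u F \<inter> comparable u v" for x
  proof (cases "\<exists>w. x = u \<frown> w")
    case True
    then obtain w where w: "x = u \<frown> w" by blast
    have "u \<frown> w = u \<frown> w' \<longleftrightarrow> w = w'" for w' by (metis suffix_conc_length)
    then show ?thesis unfolding w Int_iff conc_mem_cyl by (auto simp: comparable_def)
  next
    case False
    then have "x \<notin> cyl u F" for F using cylE by metis
    then show ?thesis by blast
  qed
  then show ?thesis by blast
qed

text \<open>A generalized cylinder is a finite intersection of sets \<open>comparable u v\<close>,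
  and the indicator of each of these is a product of two functions in \<open>Cc\<close>. The words
  in \<open>F\<close> may have any lengths here.\<close>

lemma cyl_in_cr:
  "finite F \<Longrightarrow> embed (diag (cyl u F)) \<in> cr"
proof (induction F rule: finite_induct)
  case empty
  \<comment> \<open>The plain cylinder fits the same pattern with \<open>v = u\<close>.\<close>
  have "cyl u {} = comparable u u"
    using cyl_insert[of u u "{}"]
    by (auto simp: comparable_def conc_mem_cyl elim!: cylE)
  then show ?case using comparable_in_cr by simp
next
  case (insert v F)
  then show ?case
    unfolding cyl_insert diag_mult[OF cyl_sub comparable_sub, symmetric]
    by (intro embed_conv_in_cr diag_Bc cyl_sub comparable_sub comparable_in_cr)
qed

lemma unit_in_cr: "embed (diag S) \<in> cr"
proof -
  have "cyl [] {} = S" by (auto simp: generalized_cylinder_def cylinder_def)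
  then show ?thesis using cyl_in_cr[of "{}" "[]"] by simp
qed

section \<open>The topology generated by generalized cylinders\<close>

text \<open>The neighbourhood filter of \<open>x\<close> for the topology on \<open>S\<close> generated by the generalized
  cylinders (with words of arbitrary lengths); the functions in the algebra generated by \<open>Cc\<close> need
  not be continuous for the original topology, but they are for this one.\<close>

definition tail_filter :: "(nat \<Rightarrow> nat) \<Rightarrow> (nat \<Rightarrow> nat) filter" where
  "tail_filter x = inf (nhds x)
     (INF p\<in>{(v, L). v \<frown> suffix L x \<in> S}. principal {y. case p of (v, L) \<Rightarrow> v \<frown> suffix L y \<in> S})"

lemma eventually_tail_nhds: "eventually P (nhds x) \<Longrightarrow> eventually P (tail_filter x)"
  unfolding tail_filter_def by (rule filter_leD[OF inf_le1])

lemma eventually_tail_in: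
  assumes "v \<frown> suffix L x \<in> S" shows "\<forall>\<^sub>F y in tail_filter x. v \<frown> suffix L y \<in> S"
proof -
  have "eventually (\<lambda>y. v \<frown> suffix L y \<in> S)
     (INF p\<in>{(v, L). v \<frown> suffix L x \<in> S}. principal {y. case p of (v, L) \<Rightarrow> v \<frown> suffix L y \<in> S})"
    by (rule eventually_INF1[of "(v, L)"]) (use assms in \<open>auto simp: eventually_principal\<close>)
  then show ?thesis unfolding tail_filter_def by (rule filter_leD[OF inf_le2])
qed

lemma eventually_conc_in: "v \<frown> x \<in> S \<Longrightarrow> \<forall>\<^sub>F y in tail_filter x. v \<frown> y \<in> S"
  using eventually_tail_in[of v 0 x] by simp

text \<open>\<open>S\<close> is closed, so not belonging to it is an open condition already for the
  original topology. Only the positive condition requires the finer one.\<close>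

lemma eventually_tail_notin:
  assumes "v \<frown> suffix L x \<notin> S" shows "\<forall>\<^sub>F y in tail_filter x. v \<frown> suffix L y \<notin> S"
proof (rule eventually_tail_nhds)
  have "open ((\<lambda>y. v \<frown> suffix L y) -` (- S))"
    by (intro open_vimage continuous_conc_suffix) (simp add: closed_S open_Compl)
  then show "\<forall>\<^sub>F y in nhds x. v \<frown> suffix L y \<notin> S"
    using assms unfolding eventually_nhds by (intro exI conjI) auto
qed

lemma eventually_tail_prefix: "\<forall>\<^sub>F y in tail_filter x. \<forall>i<L. y i = x i"
proof (rule eventually_tail_nhds)
  have "open {y. \<forall>i<length (prefix L x). y i = prefix L x ! i}" by (rule clopen_cylinder)
  then show "\<forall>\<^sub>F y in nhds x. \<forall>i<L. y i = x i" unfolding eventually_nhds by (intro exI conjI) auto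
qed

text \<open>Continuity for the finer topology: the condition \<open>(v, L)\<close> at the shifted
  point is the condition \<open>(v, N + L)\<close> at the original point.\<close>

lemma filterlim_suffix: "filterlim (suffix N) (tail_filter (suffix N x)) (tail_filter x)"
proof -
  have "((\<lambda>y. suffix N y) \<longlongrightarrow> suffix N x) (at x)"
    using continuous_conc_suffix[of "[]" N] by (simp add: continuous_on_def)
  then have "((\<lambda>y. suffix N y) \<longlongrightarrow> suffix N x) (nhds x)"
    by (simp add: tendsto_at_iff_tendsto_nhds)
  then have 1: "filterlim (suffix N) (nhds (suffix N x)) (tail_filter x)"
    unfolding tail_filter_def by (rule filterlim_mono) (auto simp: le_infI1)
  have 2: "\<forall>\<^sub>F y in tail_filter x. suffix N y \<in> {y. case p of (v, L) \<Rightarrow> v \<frown> suffix L y \<in> S}"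
    if "p \<in> {(v, L). v \<frown> suffix L (suffix N x) \<in> S}" for p
    using that eventually_tail_in[of "fst p" "N + snd p" x] by (cases p) simp
  show ?thesis unfolding tail_filter_def[of "suffix N x"] filterlim_inf filterlim_INF filterlim_principal
    using 1 2 by blast
qed

lemma eventually_cyl:
  assumes "finite F" "x \<in> cyl p F"
  shows "\<forall>\<^sub>F y in tail_filter x. y \<in> cyl p F"
proof -
  obtain w where w: "x = p \<frown> w" "p \<frown> w \<in> S" "\<And>v. v \<in> F \<Longrightarrow> v \<frown> w \<in> S"
    using assms(2) by (rule cylE) blast
  have "\<forall>\<^sub>F y in tail_filter x. \<forall>v\<in>insert p F. v \<frown> suffix (length p) y \<in> S"
  proof (subst eventually_ball_finite_distrib)
    show "\<forall>v\<in>insert p F. \<forall>\<^sub>F y in tail_filter x. v \<frown> suffix (length p) y \<in> S"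
      using w by (auto intro!: eventually_tail_in)
  qed (use assms in simp)
  moreover have "\<forall>\<^sub>F y in tail_filter x. \<forall>i<length p. y i = x i" by (rule eventually_tail_prefix)
  ultimately show ?thesis
  proof eventually_elim
    case (elim y)
    have "y = p \<frown> suffix (length p) y" using elim(2) conc_eq_iff[OF refl, of y p] by (simp add: w(1))
    then show ?case using elim(1) conc_mem_cyl by (metis insert_iff)
  qed
qed

text \<open>The generalized cylinders containing \<open>x\<close> form a neighbourhood base, even
  with arbitrarily long defining words. Long words are what later forces a prescribed number of
  letters to be constant.\<close>

lemma eventually_tailE:
  assumes P: "eventually P (tail_filter x)" and x: "x \<in> S"
  obtains p F where "finite F" "length p \<ge> M" "x \<in> cyl p F"
    "\<And>y. y \<in> cyl p F \<Longrightarrow> P y"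
proof -
  obtain Q R where Q: "eventually Q (nhds x)" and QR: "\<And>y. Q y \<Longrightarrow> R y \<Longrightarrow> P y"
    and R: "eventually R (INF p\<in>{(v, L). v \<frown> suffix L x \<in> S}. principal {y. case p of (v, L) \<Rightarrow> v \<frown> suffix L y \<in> S})"
    using P unfolding tail_filter_def eventually_inf by blast
  obtain U where U: "open U" "x \<in> U" "\<And>y. y \<in> U \<Longrightarrow> Q y" using Q unfolding eventually_nhds by blast
  obtain L0 where L0: "\<And>y. (\<forall>i<L0. y i = x i) \<Longrightarrow> y \<in> U"
    using open_contains_prefix_cylinder[OF U(1,2)] by blast
  obtain X where X: "X \<subseteq> {(v, L). v \<frown> suffix L x \<in> S}" "finite X"
    and "eventually R (INF p\<in>X. principal {y. case p of (v, L) \<Rightarrow> v \<frown> suffix L y \<in> S})"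
    using iffD1[OF eventually_INF R] by (elim exE conjE) (rule that)
  then have R: "R y" if "\<And>v L. (v, L) \<in> X \<Longrightarrow> v \<frown> suffix L y \<in> S" for y
    using that by (auto simp: INF_principal_finite eventually_principal)
  \<comment> \<open>Once the prefix \<open>p\<close> has length at least \<open>L\<close>, the
    condition \<open>(v, L)\<close> can be expressed through the tail behind \<open>p\<close>, with
    the word \<open>v @ drop L p\<close>. Hence \<open>K\<close> dominates all the \<open>L\<close>,
    besides \<open>L0\<close> and \<open>M\<close>.\<close>
  define K where "K = Max (insert (max L0 M) (snd ` X))"
  have K: "L0 \<le> K" "M \<le> K" "\<And>v L. (v, L) \<in> X \<Longrightarrow> L \<le> K"
  proof -
    have fin: "finite (insert (max L0 M) (snd ` X))" using X(2) by simp
    have "max L0 M \<le> K" unfolding K_def by (rule Max_ge[OF fin]) simp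
    then show "L0 \<le> K" "M \<le> K" by auto
    show "L \<le> K" if "(v, L) \<in> X" for v L
      unfolding K_def by (rule Max_ge[OF fin]) (use that in force)
  qed
  define p where "p = prefix K x"
  define F where "F = (\<lambda>(v, L). v @ drop L p) ` X"
  have split: "v \<frown> suffix L (p \<frown> w) = (v @ drop L p) \<frown> w" if "(v, L) \<in> X" for v L w
  proof -
    have "suffix L (p \<frown> w) = drop L p \<frown> w"
      using K(3)[OF that] by (auto simp: fun_eq_iff p_def conc_def add.commute)
    then show ?thesis by simp
  qed
  have px: "p \<frown> suffix K x = x" by (simp add: p_def)
  show ?thesis
  proof (rule that)
    show "finite F" using X(2) by (simp add: F_def)
    show "M \<le> length p" using K by (simp add: p_def)
    have "u \<frown> suffix K x \<in> S" if u: "u \<in> F" for u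
    proof -
      obtain v L where vL: "(v, L) \<in> X" "u = v @ drop L p" using u by (auto simp: F_def)
      have "v \<frown> suffix L x \<in> S" using X(1) vL(1) by auto
      then show ?thesis using split[OF vL(1), of "suffix K x"] vL(2) px by simp
    qed
    then show "x \<in> cyl p F"
      using conc_mem_cyl[of p "suffix K x" F] x px by simp
  next
    fix y assume "y \<in> cyl p F"
    then obtain w where w: "y = p \<frown> w" "\<And>v. v \<in> F \<Longrightarrow> v \<frown> w \<in> S" by (rule cylE) blast
    have "y \<in> U" using K(1) by (intro L0) (auto simp: w p_def)
    moreover have "R y"
    proof (rule R)
      fix v L assume vL: "(v, L) \<in> X"
      then have "v @ drop L p \<in> F" unfolding F_def by force
      then show "v \<frown> suffix L y \<in> S" using w split[OF vL, of w] by simp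
    qed
    ultimately show "P y" using U(3) QR by blast
  qed
qed

text \<open>Continuity for the finer topology, expressed in the charts that send a tail
  \<open>w\<close> to \<open>(u \<frown> w, int (length u) - int (length v), v \<frown> w)\<close>.
  The filter forces both ends of such an arrow into \<open>S\<close> eventually.\<close>

definition tame :: "(arrow \<Rightarrow> complex) \<Rightarrow> bool" where
  "tame f \<longleftrightarrow> (\<forall>u v x. u \<frown> x \<in> S \<longrightarrow> v \<frown> x \<in> S \<longrightarrow>
     ((\<lambda>w. f (u \<frown> w, int (length u) - int (length v), v \<frown> w)) \<longlongrightarrow>
       f (u \<frown> x, int (length u) - int (length v), v \<frown> x)) (tail_filter x))"

lemma tameD:
  "\<lbrakk>tame f; u \<frown> x \<in> S; v \<frown> x \<in> S; k = int (length u) - int (length v)\<rbrakk> \<Longrightarrow>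
     ((\<lambda>w. f (u \<frown> w, k, v \<frown> w)) \<longlongrightarrow> f (u \<frown> x, k, v \<frown> x)) (tail_filter x)"
  by (simp add: tame_def)

text \<open>The chart words may be lengthened by a common prefix \<open>t\<close> of
  \<open>x\<close>, since points close to \<open>x\<close> share it. This permits the assumption
  that \<open>u\<close> is longer than the level of a given function.\<close>

lemma tameI:
  assumes "\<And>u v x. \<lbrakk>u \<frown> x \<in> S; v \<frown> x \<in> S; N \<le> length u\<rbrakk> \<Longrightarrow>
     ((\<lambda>w. f (u \<frown> w, int (length u) - int (length v), v \<frown> w)) \<longlongrightarrow>
       f (u \<frown> x, int (length u) - int (length v), v \<frown> x)) (tail_filter x)"
  shows "tame f"
  unfolding tame_def
proof (intro allI impI)
  fix u v x assume uv: "u \<frown> x \<in> S" "v \<frown> x \<in> S"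
  define t where "t = prefix N x"
  define z where "z = suffix N x"
  have x: "x = t \<frown> z" by (simp add: t_def z_def)
  have len: "length t = N" by (simp add: t_def)
  have "((\<lambda>w. f ((u @ t) \<frown> w, int (length (u @ t)) - int (length (v @ t)), (v @ t) \<frown> w)) \<longlongrightarrow>
       f ((u @ t) \<frown> z, int (length (u @ t)) - int (length (v @ t)), (v @ t) \<frown> z)) (tail_filter z)"
    by (rule assms) (use uv in \<open>simp_all add: x len\<close>)
  from filterlim_compose[OF this[unfolded z_def] filterlim_suffix]
  have "((\<lambda>w. f ((u @ t) \<frown> suffix N w, int (length u) - int (length v), (v @ t) \<frown> suffix N w)) \<longlongrightarrow>
       f (u \<frown> x, int (length u) - int (length v), v \<frown> x)) (tail_filter x)"
    by (simp add: t_def flip: conc_conc)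
  moreover have "\<forall>\<^sub>F w in tail_filter x. f ((u @ t) \<frown> suffix N w, int (length u) - int (length v), (v @ t) \<frown> suffix N w) =
      f (u \<frown> w, int (length u) - int (length v), v \<frown> w)"
    using eventually_tail_prefix[of N x]
  proof eventually_elim
    case (elim w)
    have "w = t \<frown> suffix N w" using elim conc_eq_iff[OF len, of w] by (simp add: t_def)
    then show ?case by (metis conc_conc)
  qed
  ultimately show "((\<lambda>w. f (u \<frown> w, int (length u) - int (length v), v \<frown> w)) \<longlongrightarrow>
       f (u \<frown> x, int (length u) - int (length v), v \<frown> x)) (tail_filter x)"
    by (rule Lim_transform_eventually)
qed

lemma tame_zero: "tame (\<lambda>_. 0)"
  by (simp add: tame_def)

lemma tame_add: "tame f \<Longrightarrow> tame f' \<Longrightarrow> tame (\<lambda>g. f g + f' g)"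
  unfolding tame_def by (intro allI impI tendsto_add) auto

lemma tame_scale: "tame f \<Longrightarrow> tame (\<lambda>g. z * f g)"
  unfolding tame_def by (intro allI impI tendsto_mult tendsto_const) auto

lemma tame_star:
  assumes "tame f" shows "tame (gstar G f)"
proof (rule tameI[of 0])
  fix u v x assume uv: "u \<frown> x \<in> S" "v \<frown> x \<in> S"
  let ?k = "int (length u) - int (length v)"
  have eq: "gstar G f (u \<frown> w, ?k, v \<frown> w) = cnj (f (v \<frown> w, - ?k, u \<frown> w))"
    if "u \<frown> w \<in> S" "v \<frown> w \<in> S" for w
    using arrowsI[OF that] by (simp add: gstar_eq)
  have "((\<lambda>w. cnj (f (v \<frown> w, - ?k, u \<frown> w))) \<longlongrightarrow> cnj (f (v \<frown> x, - ?k, u \<frown> x))) (tail_filter x)"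
    by (intro tendsto_cnj tameD[OF assms]) (use uv in auto)
  moreover have "\<forall>\<^sub>F w in tail_filter x. cnj (f (v \<frown> w, - ?k, u \<frown> w)) = gstar G f (u \<frown> w, ?k, v \<frown> w)"
    using eventually_conc_in[OF uv(1)] eventually_conc_in[OF uv(2)]
    by eventually_elim (simp add: eq)
  ultimately show "((\<lambda>w. gstar G f (u \<frown> w, ?k, v \<frown> w)) \<longlongrightarrow> gstar G f (u \<frown> x, ?k, v \<frown> x)) (tail_filter x)"
    unfolding eq[OF uv] by (rule Lim_transform_eventually)
qed

text \<open>If \<open>u\<close> has at least \<open>N\<close> letters, a factor in level
  \<open>N\<close> deletes only letters of \<open>u\<close>, so the intermediate point is
  \<open>q \<frown> w\<close> with the tail intact. The words \<open>q\<close> run through a finite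
  set independent of \<open>w\<close>, so the convolution is one fixed finite sum as
  \<open>w\<close> varies.\<close>

lemma gconv_words:
  assumes f: "f \<in> Bc G" "\<And>g. f g \<noteq> 0 \<Longrightarrow> g \<in> lev N" and uv: "u \<frown> w \<in> S" "v \<frown> w \<in> S" and N: "N \<le> length u"
  shows "gconv G f f' (u \<frown> w, int (length u) - int (length v), v \<frown> w) =
    (\<Sum>q\<in>{q \<in> words. length q \<le> N + length u}.
       f (u \<frown> w, int (length u) - int (length q), q \<frown> w) * f' (q \<frown> w, int (length q) - int (length v), v \<frown> w))"
proof -
  let ?k = "int (length u) - int (length v)"
  define W where "W = {q \<in> words. length q \<le> N + length u}"
  define h where "h q = (q \<frown> w, int (length q) - int (length v), v \<frown> w)" for q
  define W' where "W' = {q \<in> W. q \<frown> w \<in> S}"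
  have fin: "finite W" unfolding W_def by (rule finite_words)
  have inj: "inj_on h W'"
  proof (rule inj_onI)
    fix q q' assume "h q = h q'"
    then have "length q = length q'" "q \<frown> w = q' \<frown> w" by (auto simp: h_def)
    then show "q = q'" by (metis conc_fst nth_equalityI)
  qed
  have row: "row N (u \<frown> w, ?k, v \<frown> w) \<subseteq> h ` W'"
  proof
    fix h1 assume h1: "h1 \<in> row N (u \<frown> w, ?k, v \<frown> w)"
    obtain z l where z: "h1 = (z, l, v \<frown> w)" "z \<in> S" using h1 by (cases h1) (auto simp: row_def mem_fibre mem_arrows)
    obtain c d where cd: "c \<le> N" "d \<le> N" "?k - l = int c - int d" "suffix c (u \<frown> w) = suffix d z"
      using h1 by (auto simp: row_def z lev_def)
    \<comment> \<open>The new prefix \<open>d\<close> letters of \<open>z\<close>, followed by what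
      remains of \<open>u\<close> after \<open>c\<close> letters;
      \<open>c \<le> N \<le> length u\<close> ensures that nothing of \<open>w\<close> is
      deleted.\<close>
    define q where "q = prefix d z @ drop c u"
    have "suffix c (u \<frown> w) = drop c u \<frown> w" using cd(1) N by (auto simp: fun_eq_iff conc_def add.commute)
    then have "prefix d z \<frown> suffix d z = q \<frown> w" by (simp add: q_def flip: cd(4))
    then have zq: "z = q \<frown> w" by simp
    have "length q = d + (length u - c)" by (simp add: q_def)
    then have len: "int (length q) = int d + int (length u) - int c" "length q \<le> N + length u" using cd N by auto
    have "q \<in> W'" using words_conc z(2) len unfolding zq W'_def W_def by blast
    moreover have "h1 = h q" using cd(3) len by (simp add: z(1) h_def zq)
    ultimately show "h1 \<in> h ` W'" by blast
  qed
  have sub: "h ` W' \<subseteq> fibre (v \<frown> w)"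
    using arrowsI[OF _ uv(2)] by (auto simp: h_def W'_def mem_fibre)
  have "gconv G f f' (u \<frown> w, ?k, v \<frown> w) = (\<Sum>h1\<in>h ` W'. f (quot (u \<frown> w, ?k, v \<frown> w) h1) * f' h1)"
    by (rule gconv_sum[OF f(2) arrowsI[OF uv] _ row sub]) (auto simp: W'_def intro: finite_subset[OF _ fin])
  also have "\<dots> = (\<Sum>q\<in>W'. f (u \<frown> w, int (length u) - int (length q), q \<frown> w) * f' (h q))"
    by (subst sum.reindex[OF inj]) (simp add: h_def)
  also have "\<dots> = (\<Sum>q\<in>W. f (u \<frown> w, int (length u) - int (length q), q \<frown> w) * f' (h q))"
  proof (rule sum.mono_neutral_left[OF fin])
    show "\<forall>q\<in>W - W'. f (u \<frown> w, int (length u) - int (length q), q \<frown> w) * f' (h q) = 0"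
    proof
      fix q assume "q \<in> W - W'"
      then have "(u \<frown> w, int (length u) - int (length q), q \<frown> w) \<notin> arrows" by (simp add: W'_def mem_arrows)
      then show "f (u \<frown> w, int (length u) - int (length q), q \<frown> w) * f' (h q) = 0"
        using Bc_vanish[OF f(1)] by simp
    qed
  qed (auto simp: W'_def)
  finally show ?thesis by (simp add: W_def h_def)
qed

lemma tame_conv:
  assumes f: "f \<in> Bc G" "tame f" and f': "f' \<in> Bc G" "tame f'" shows "tame (gconv G f f')"
proof -
  obtain N where N: "\<And>g. f g \<noteq> 0 \<Longrightarrow> g \<in> lev N" using f(1) by (rule BcE) blast
  show ?thesis
  proof (rule tameI[of N])
    fix u v x assume uv: "u \<frown> x \<in> S" "v \<frown> x \<in> S" and len: "N \<le> length u"
    let ?k = "int (length u) - int (length v)"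
    let ?t = "\<lambda>w. \<Sum>q\<in>{q \<in> words. length q \<le> N + length u}.
       f (u \<frown> w, int (length u) - int (length q), q \<frown> w) * f' (q \<frown> w, int (length q) - int (length v), v \<frown> w)"
    have eq: "gconv G f f' (u \<frown> w, ?k, v \<frown> w) = ?t w" if "u \<frown> w \<in> S" "v \<frown> w \<in> S" for w
      by (rule gconv_words[OF f(1) N that len])
    have "(?t \<longlongrightarrow> ?t x) (tail_filter x)"
    proof (rule tendsto_sum)
      fix q
      show "((\<lambda>w. f (u \<frown> w, int (length u) - int (length q), q \<frown> w) * f' (q \<frown> w, int (length q) - int (length v), v \<frown> w)) \<longlongrightarrow>
          f (u \<frown> x, int (length u) - int (length q), q \<frown> x) * f' (q \<frown> x, int (length q) - int (length v), v \<frown> x)) (tail_filter x)"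
      proof (cases "q \<frown> x \<in> S")
        case True
        show ?thesis by (intro tendsto_mult tameD[OF f(2)] tameD[OF f'(2)] uv True refl)
      next
        case False
        \<comment> \<open>A summand whose intermediate point is outside \<open>S\<close> vanishes at
          \<open>x\<close>, and it also vanishes near \<open>x\<close> because \<open>S\<close> is
          closed.\<close>
        have zero: "f (u \<frown> w, int (length u) - int (length q), q \<frown> w) = 0" if "q \<frown> w \<notin> S" for w
          using that Bc_vanish[OF f(1)] by (simp add: mem_arrows)
        have "\<forall>\<^sub>F w in tail_filter x. q \<frown> w \<notin> S" using eventually_tail_notin[of q 0 x] False by simp
        then have "\<forall>\<^sub>F w in tail_filter x. 0 = f (u \<frown> w, int (length u) - int (length q), q \<frown> w) *
            f' (q \<frown> w, int (length q) - int (length v), v \<frown> w)"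
          by eventually_elim (simp add: zero)
        then show ?thesis unfolding zero[OF False] mult_zero_left by (rule Lim_transform_eventually[OF tendsto_const])
      qed
    qed
    moreover have "\<forall>\<^sub>F w in tail_filter x. ?t w = gconv G f f' (u \<frown> w, ?k, v \<frown> w)"
      using eventually_conc_in[OF uv(1)] eventually_conc_in[OF uv(2)]
      by eventually_elim (simp only: eq)
    ultimately show "((\<lambda>w. gconv G f f' (u \<frown> w, ?k, v \<frown> w)) \<longlongrightarrow> gconv G f f' (u \<frown> x, ?k, v \<frown> x)) (tail_filter x)"
      unfolding eq[OF uv] by (rule Lim_transform_eventually)
  qed
qed

text \<open>The chart lands in one level, on which an open set of the groupoid is relatively open in
  the product topology. There the chart is continuous already for the original topology.\<close>

lemma tame_Cc:
  assumes "f \<in> Cc G" shows "tame f"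
proof (rule tameI[of 0])
  fix u v x assume uv: "u \<frown> x \<in> S" "v \<frown> x \<in> S"
  let ?k = "int (length u) - int (length v)"
  define j where "j w = (u \<frown> w, ?k, v \<frown> w)" for w :: "nat \<Rightarrow> nat"
  define L where "L = level ?k (length v)"
  have jL: "j w \<in> L" if "u \<frown> w \<in> S" "v \<frown> w \<in> S" for w
    using that unfolding L_def j_def by (subst mem_level') auto
  have contj: "continuous_on UNIV j"
    unfolding j_def using continuous_conc_suffix[of u 0] continuous_conc_suffix[of v 0]
    by (intro continuous_on_Pair continuous_on_const) simp_all
  have "((\<lambda>w. f (j w)) \<longlongrightarrow> f (j x)) (tail_filter x)"
  proof (rule topological_tendstoI)
    fix V assume V: "open V" "f (j x) \<in> V"
    define U where "U = {g \<in> topspace (gtop G). f g \<in> V}"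
    have "openin (gtop G) U" unfolding U_def
      by (rule openin_continuous_map_preimage[where Y = euclidean]) (use assms V in \<open>auto simp: Cc_def\<close>)
    then have "openin (top_of_set L) (U \<inter> L)" unfolding openin_gtop L_def by auto
    then obtain T where T: "open T" "U \<inter> L = L \<inter> T" by (auto simp: openin_open)
    have "j x \<in> U" using V arrowsI[OF uv] by (simp add: U_def j_def arrows_def)
    then have "x \<in> j -` T" using jL[OF uv] T(2) by auto
    then have "\<forall>\<^sub>F w in nhds x. w \<in> j -` T"
      using open_vimage[OF T(1) contj] unfolding eventually_nhds by blast
    from eventually_tail_nhds[OF this] eventually_conc_in[OF uv(1)] eventually_conc_in[OF uv(2)]
    show "\<forall>\<^sub>F w in tail_filter x. f (j w) \<in> V"
    proof eventually_elim
      case (elim w)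
      then have "j w \<in> U" using jL[of w] T(2) by auto
      then show ?case by (simp add: U_def)
    qed
  qed
  then show "((\<lambda>w. f (u \<frown> w, ?k, v \<frown> w)) \<longlongrightarrow> f (u \<frown> x, ?k, v \<frown> x)) (tail_filter x)"
    by (simp add: j_def)
qed

text \<open>The tame functions in \<open>B_c\<close> contain \<open>Cc\<close> and are closed under
  all operations, so their closure is one of the subalgebras whose intersection defines
  \<open>cr\<close>.\<close>

lemma cr_approx:
  assumes "X \<in> cr" "e > 0"
  obtains f where "f \<in> Bc G" "tame f" "adist Br X (embed f) < e"
proof -
  define B where "B = {f \<in> Bc G. tame f}"
  have "linear_subspace (Bc_algebra G) B"
    by (auto simp: linear_subspace_def B_def Bc_zero tame_zero Bc_add tame_add Bc_scale tame_scale)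
  then have "cstar_subalgebra Br (completion_closure (Bc_algebra G) B)"
    unfolding Br_algebra_def
    by (rule Bc.closure_cstar_subalgebra) (auto simp: B_def Bc_conv tame_conv Bc_star tame_star)
  moreover have "embed ` Cc G \<subseteq> completion_closure (Bc_algebra G) B"
    using Bc.embed_in_closure[of B] tame_Cc by (auto simp: B_def Cc_def)
  ultimately have "cr \<subseteq> completion_closure (Bc_algebra G) B" by (rule cr_least)
  then have "X \<in> completion_closure (Bc_algebra G) B" using assms(1) by blast
  then show ?thesis
    using assms(2) that unfolding Br_algebra_def by (elim Bc.closure_approx) (auto simp: B_def)
qed

section \<open>Minimality\<close>

definition minimality :: bool where
  "minimality \<longleftrightarrow>
    (\<forall>u F. u \<in> subshift_words S \<and> finite F \<and> F \<subseteq> subshift_words S \<and>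
           (\<forall>v\<in>F. length v = length u) \<and> generalized_cylinder S u F \<noteq> {} \<longrightarrow>
       (\<exists>m::nat. \<forall>x\<in>S. \<exists>y\<in>generalized_cylinder S u F. \<exists>k\<in>{0..m}. \<forall>i. x i = y (i + k)))"

text \<open>Extending all words to the left to a common length reduces words of different lengths to the
  case of the minimality condition.\<close>

lemma cyl_covers:
  assumes min: "minimality" and F: "finite F" and x0: "x0 \<in> cyl p F"
  obtains m where "\<And>x. x \<in> S \<Longrightarrow> \<exists>y\<in>cyl p F. \<exists>k\<le>m. x = suffix k y"
proof -
  obtain w0 where w0: "p \<frown> w0 \<in> S" "\<And>v. v \<in> F \<Longrightarrow> v \<frown> w0 \<in> S" using x0 by (rule cylE) blast
  define L where "L = Max (length ` insert p F)"
  have L: "length v \<le> L" if "v \<in> insert p F" for v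
    unfolding L_def by (rule Max_ge) (use that F in auto)
  have "\<exists>e. length e = L - length v \<and> e \<frown> (v \<frown> w0) \<in> S" if "v \<in> insert p F" for v
    by (rule left_extension) (use that w0 in auto)
  then obtain e where e: "\<And>v. v \<in> insert p F \<Longrightarrow> length (e v) = L - length v"
    "\<And>v. v \<in> insert p F \<Longrightarrow> e v \<frown> (v \<frown> w0) \<in> S" by metis
  define u' where "u' = e p @ p"
  define F' where "F' = (\<lambda>v. e v @ v) ` F"
  have len: "length u' = L" "\<And>v. v \<in> F' \<Longrightarrow> length v = L"
    using e(1) L by (auto simp: u'_def F'_def)
  have word: "v \<in> subshift_words S" if "v \<frown> w0 \<in> S" for v
    unfolding subshift_words_def using that by (intro CollectI bexI[of _ "v \<frown> w0"] exI[of _ 0]) auto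
  have in_S: "u' \<frown> w0 \<in> S" "\<And>v. v \<in> F' \<Longrightarrow> v \<frown> w0 \<in> S" using e(2) by (auto simp: u'_def F'_def)
  have "u' \<frown> w0 \<in> cyl u' F'" using in_S by (simp add: conc_mem_cyl)
  then have "cyl u' F' \<noteq> {}" by blast
  moreover have "finite F'" using F by (simp add: F'_def)
  moreover have "F' \<subseteq> subshift_words S" using word in_S(2) by blast
  moreover have "u' \<in> subshift_words S" using word in_S(1) by blast
  ultimately have "u' \<in> subshift_words S \<and> finite F' \<and> F' \<subseteq> subshift_words S \<and>
      (\<forall>v\<in>F'. length v = length u') \<and> cyl u' F' \<noteq> {}"
    using len by simp
  from min[unfolded minimality_def, THEN spec, THEN spec, THEN mp, OF this]
  obtain m where m: "\<forall>x\<in>S. \<exists>y\<in>cyl u' F'. \<exists>k\<in>{0..m}. \<forall>i. x i = y (i + k)" ..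
  show ?thesis
  proof (rule that[of "m + length p"])
    fix x assume "x \<in> S"
    \<comment> \<open>The condition is applied to \<open>q \<frown> x\<close>, with \<open>q\<close>
      as long as the padded word \<open>u'\<close>. Deleting \<open>L\<close> letters on both sides
      then removes \<open>u'\<close> from \<open>y\<close> and exhibits \<open>x\<close> as
      \<open>suffix k w\<close>; restoring \<open>p\<close> in front of \<open>w\<close> costs
      \<open>length p\<close> further shifts.\<close>
    then obtain q where q: "length q = L" "q \<frown> x \<in> S" using left_extension by blast
    then obtain y k where y: "y \<in> cyl u' F'" "k \<le> m" "\<forall>i. (q \<frown> x) i = y (i + k)"
      using m by fastforce
    obtain w where w: "y = u' \<frown> w" "u' \<frown> w \<in> S" "\<And>v. v \<in> F' \<Longrightarrow> v \<frown> w \<in> S"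
      using y(1) by (rule cylE) blast
    have "e p \<frown> (p \<frown> w) \<in> S" using w(2) by (simp add: u'_def)
    then have "p \<frown> w \<in> S" by (rule conc_tail_in)
    moreover have "v \<frown> w \<in> S" if "v \<in> F" for v
    proof -
      have "e v \<frown> (v \<frown> w) \<in> S" using w(3)[of "e v @ v"] that by (simp add: F'_def)
      then show ?thesis by (rule conc_tail_in)
    qed
    ultimately have "p \<frown> w \<in> cyl p F" by (simp add: conc_mem_cyl)
    moreover have "x = suffix (k + length p) (p \<frown> w)"
    proof -
      have "q \<frown> x = suffix k y" using y(3) by (simp add: fun_eq_iff add.commute)
      then have "suffix L (q \<frown> x) = suffix L (suffix k (u' \<frown> w))" by (simp add: w(1))
      then have "x = suffix k (suffix (length u') (u' \<frown> w))" using q(1) by (simp add: len(1) add.commute)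
      then have "x = suffix k (suffix (length p) (p \<frown> w))" by simp
      then show ?thesis by (simp add: add.commute)
    qed
    ultimately show "\<exists>y\<in>cyl p F. \<exists>k\<le>m + length p. x = suffix k y"
      using y(2) by (intro bexI[of _ "p \<frown> w"] exI[of _ "k + length p"]) auto
  qed
qed

lemma cyl_infinite:
  assumes "minimality" "finite F" "x0 \<in> cyl p F"
  shows "infinite (cyl p F)"
proof
  assume fin: "finite (cyl p F)"
  obtain m where "\<And>x. x \<in> S \<Longrightarrow> \<exists>y\<in>cyl p F. \<exists>k\<le>m. x = suffix k y"
    by (rule cyl_covers[OF assms]) blast
  then have "S \<subseteq> (\<Union>k\<le>m. suffix k ` cyl p F)" by blast
  then show False using infinite_S fin by (meson finite_UN_I finite_atMost finite_imageI finite_subset)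
qed

text \<open>Such a point is determined by its first \<open>b\<close> letters: each later letter
  repeats the one \<open>b - a\<close> places earlier.\<close>

lemma finite_eventually_periodic:
  assumes "a < b" shows "finite {x \<in> S. suffix a x = suffix b x}"
proof -
  let ?P = "{x \<in> S. suffix a x = suffix b x}"
  have "inj_on (prefix b) ?P"
  proof (rule inj_onI)
    fix x x' assume x: "x \<in> ?P" "x' \<in> ?P" "prefix b x = prefix b x'"
    show "x = x'"
    proof
      fix i show "x i = x' i"
      proof (induction i rule: less_induct)
        case (less i)
        show ?case
        proof (cases "i < b")
          case True then show ?thesis using x(3) by (metis add_0 diff_zero subsequence_nth)
        next
          case False
          then have "b + (i - b) = i" by simp
          have "x (a + (i - b)) = x i" "x' (a + (i - b)) = x' i"
            using x(1,2) False by (auto simp: fun_eq_iff dest!: spec[of _ "i - b"])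
          then show ?thesis using less[of "a + (i - b)"] assms False by simp
        qed
      qed
    qed
  qed
  moreover have "prefix b ` ?P \<subseteq> {u \<in> words. length u \<le> b}"
  proof
    fix u assume "u \<in> prefix b ` ?P"
    then obtain x where x: "x \<in> S" "u = prefix b x" by blast
    then have "u \<frown> suffix b x \<in> S" by simp
    then have "u \<in> words" by (rule words_conc)
    then show "u \<in> {u \<in> words. length u \<le> b}" using x(2) by simp
  qed
  ultimately show ?thesis using finite_words[of b] by (meson finite_imageD finite_subset)
qed

section \<open>Closed ideals\<close>

lemma Cr_ideal:
  assumes "closed_ideal (Cr_algebra G) J"
  shows "J \<subseteq> cr" "azero Br \<in> J"
    "\<lbrakk>X \<in> J; Y \<in> J\<rbrakk> \<Longrightarrow> aplus Br X Y \<in> J"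
    "X \<in> J \<Longrightarrow> ascale Br z X \<in> J"
    "\<lbrakk>X \<in> J; Y \<in> cr\<rbrakk> \<Longrightarrow> atimes Br X Y \<in> J"
    "\<lbrakk>X \<in> J; Y \<in> cr\<rbrakk> \<Longrightarrow> atimes Br Y X \<in> J"
  using assms unfolding Cr_algebra_eq closed_ideal_def linear_subspace_def by simp_all

text \<open>Inclusion-exclusion, with the product of the two projections as the indicator of the
  intersection.\<close>

lemma embed_diag_Un:
  assumes J: "closed_ideal (Cr_algebra G) J" and D: "D \<subseteq> S" "D' \<subseteq> S"
    and "embed (diag D) \<in> J" "embed (diag D') \<in> J"
  shows "embed (diag (D \<union> D')) \<in> J"
proof -
  note Bc = diag_Bc[OF D(1)] diag_Bc[OF D(2)]
  have Bc3: "diag (D \<inter> D') \<in> Bc G" using D by (intro diag_Bc) auto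
  have "embed (diag D') \<in> cr" using assms(5) Cr_ideal(1)[OF J] by blast
  then have "embed (diag (D \<inter> D')) \<in> J"
    using Cr_ideal(5)[OF J assms(4), of "embed (diag D')"]
    by (simp add: embed_simps Bc diag_mult D)
  then have "aplus Br (embed (diag D)) (aplus Br (embed (diag D'))
      (ascale Br (-1) (embed (diag (D \<inter> D'))))) \<in> J"
    by (intro Cr_ideal(3,4)[OF J] assms)
  also have "aplus Br (embed (diag D)) (aplus Br (embed (diag D'))
      (ascale Br (-1) (embed (diag (D \<inter> D'))))) =
      embed (\<lambda>g. diag D g + (diag D' g + - 1 * diag (D \<inter> D') g))"
    by (simp only: embed_simps Bc Bc3 Bc_add Bc_scale)
  also have "(\<lambda>g. diag D g + (diag D' g + - 1 * diag (D \<inter> D') g)) = diag (D \<union> D')"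
    by (auto simp: diag_def fun_eq_iff)
  finally show ?thesis .
qed

text \<open>Conjugating by bisections puts the indicator of \<open>{w. u \<frown> w \<in> D}\<close>
  into the ideal for every word \<open>u\<close>. By the covering hypothesis the finitely many words
  of length at most \<open>m\<close> already yield all of \<open>S\<close>.\<close>

lemma unit_in_ideal:
  assumes J: "closed_ideal (Cr_algebra G) J" and D: "D \<subseteq> S" "embed (diag D) \<in> J"
    and cover: "\<And>x. x \<in> S \<Longrightarrow> \<exists>y\<in>D. \<exists>k\<le>m. x = suffix k y"
  shows "embed (diag S) \<in> J"
proof -
  have sub: "{w. u \<frown> w \<in> D} \<subseteq> S" for u using D(1) conc_tail_in by blast
  have translate: "embed (diag {w. u \<frown> w \<in> D}) \<in> J" for u
  proof -
    note Bc = diag_Bc[OF D(1)] bisection_Bc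
    have "atimes Br (embed (bisection [] u))
        (atimes Br (embed (diag D)) (embed (bisection u []))) \<in> J"
      by (intro Cr_ideal(5,6)[OF J] D embed_Cc_in_cr bisection_in_Cc)
    then show ?thesis by (simp add: embed_simps Bc Bc_conv bisection_conjugate[OF D(1)])
  qed
  have union: "finite U \<Longrightarrow> embed (diag (\<Union>u\<in>U. {w. u \<frown> w \<in> D})) \<in> J" for U
  proof (induction U rule: finite_induct)
    case empty
    have "diag {} = (\<lambda>_. 0)" by (auto simp: diag_def)
    then show ?case using Cr_ideal(2)[OF J] by (simp add: embed_simps)
  next
    case (insert u U)
    have "embed (diag ({w. u \<frown> w \<in> D} \<union> (\<Union>u\<in>U. {w. u \<frown> w \<in> D}))) \<in> J"
      by (rule embed_diag_Un[OF J sub _ translate insert.IH]) (use sub in blast)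
    then show ?case by simp
  qed
  have "(\<Union>u\<in>{u \<in> words. length u \<le> m}. {w. u \<frown> w \<in> D}) = S"
  proof
    show "(\<Union>u\<in>{u \<in> words. length u \<le> m}. {w. u \<frown> w \<in> D}) \<subseteq> S" using sub by blast
    show "S \<subseteq> (\<Union>u\<in>{u \<in> words. length u \<le> m}. {w. u \<frown> w \<in> D})"
    proof
      fix x assume "x \<in> S"
      then obtain y k where y: "y \<in> D" "k \<le> m" "x = suffix k y" using cover by blast
      have yx: "prefix k y \<frown> x = y" by (simp add: y(3))
      then have "prefix k y \<frown> x \<in> S" using y(1) D(1) by auto
      then have "prefix k y \<in> words" by (rule words_conc)
      then show "x \<in> (\<Union>u\<in>{u \<in> words. length u \<le> m}. {w. u \<frown> w \<in> D})"
        using y(1,2) yx by (intro UN_I[of "prefix k y"]) auto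
    qed
  qed
  then show ?thesis using union[OF finite_words[of m]] by simp
qed

lemma times_unit:
  assumes "X \<in> acarrier Br"
  shows "atimes Br X (embed (diag S)) = X"
proof -
  obtain f where f: "f \<in> cauchy_seqs (Bc_algebra G)" "X = Bc.cls f"
    using assms unfolding Br_algebra_def by (metis Bc.classE)
  have Bc: "f i \<in> Bc G" for i using Bc.cauchy_seqsD(1)[OF f(1)] by simp
  have "gconv G (f i) (diag S) = f i" for i
  proof -
    have "f i (x, k, y) = 0" if "y \<notin> S" for x k y using that by (intro Bc_vanish[OF Bc]) (simp add: mem_arrows)
    then show ?thesis unfolding gconv_unit_right[OF order_refl Bc] by auto
  qed
  then show ?thesis
    using Bc.completion_times[OF f(1) Bc.const_cauchy[of "diag S"]]
    by (simp add: f(2) Br_algebra_def completion_embed_def diag_Bc)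
qed

text \<open>Checked on representatives, where multiplication by \<open>diag D\<close> is restriction
  to the arrows with range in \<open>D\<close>.\<close>

lemma diag_times_idem:
  assumes "D \<subseteq> S" "X \<in> acarrier Br"
  shows "atimes Br (embed (diag D)) (atimes Br (embed (diag D)) X) =
    atimes Br (embed (diag D)) X"
proof -
  obtain f where f: "f \<in> cauchy_seqs (Bc_algebra G)" "X = Bc.cls f"
    using assms(2) unfolding Br_algebra_def by (metis Bc.classE)
  have Bc: "f i \<in> Bc G" for i using Bc.cauchy_seqsD(1)[OF f(1)] by simp
  have D: "diag D \<in> Bc G" by (rule diag_Bc[OF assms(1)])
  have "gconv G (diag D) (gconv G (diag D) (f i)) = gconv G (diag D) (f i)" for i
    by (subst gconv_unit_left[OF assms(1) Bc_conv[OF D Bc]]) (auto simp: gconv_unit_left[OF assms(1) Bc])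
  moreover have c: "(\<lambda>i. diag D) \<in> cauchy_seqs (Bc_algebra G)" by (rule Bc.const_cauchy) (simp add: D)
  moreover have "(\<lambda>i. gconv G (diag D) (f i)) \<in> cauchy_seqs (Bc_algebra G)"
    using Bc.cauchy_times[OF c f(1)] by simp
  ultimately show ?thesis
    using Bc.completion_times[OF c f(1)] Bc.completion_times[OF c, of "\<lambda>i. gconv G (diag D) (f i)"]
    by (simp add: f(2) Br_algebra_def completion_embed_def)
qed

text \<open>The cut-down of an element close to \<open>f\<close> by a small generalized cylinder on which \<open>f\<close> lives
  only on the unit space is close to a multiple of a projection.\<close>

lemma diag_in_ideal:
  assumes J: "closed_ideal (Cr_algebra G) J" and Y: "Y \<in> J" and c: "c \<noteq> 0"
    and f: "f \<in> Bc G" "adist Br Y (embed f) \<le> cmod c / 4"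
    and D: "D \<subseteq> S" "embed (diag D) \<in> cr"
    and diag: "\<And>x k y. \<lbrakk>x \<in> D; y \<in> D; f (x, k, y) \<noteq> 0\<rbrakk> \<Longrightarrow> k = 0 \<and> x = y"
    and near: "\<And>x. x \<in> D \<Longrightarrow> cmod (f (x, 0, x) - c) \<le> cmod c / 4"
  shows "embed (diag D) \<in> J"
proof -
  let ?B = "Br"
  define P where "P = embed (diag D)"
  define Q where "Q = (\<lambda>X. atimes ?B P (atimes ?B X P))"
  \<comment> \<open>The normalised cut-down of \<open>Y\<close>, an element of the ideal. It is
    compared with \<open>P\<close> through \<open>h\<close>, the same cut-down of the function
    \<open>f\<close>; each of the two steps costs 1/4.\<close>
  define T where "T = ascale ?B (1 / c) (Q Y)"
  define h where "h = (\<lambda>g. 1 / c * gconv G (diag D) (gconv G f (diag D)) g)"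
  have DBc: "diag D \<in> Bc G" by (rule diag_Bc[OF D(1)])
  have P: "P \<in> cr" "P \<in> acarrier ?B" using D(2) cr_sub by (auto simp: P_def)
  have YB: "Y \<in> acarrier ?B" using Y Cr_ideal(1)[OF J] cr_sub by blast
  have fB: "embed f \<in> acarrier ?B" by (simp add: embed_simps f)
  have TJ: "T \<in> J" unfolding T_def Q_def by (intro Cr_ideal(4,5,6)[OF J] Y P)
  then have T: "T \<in> cr" "T \<in> acarrier ?B" using Cr_ideal(1)[OF J] cr_sub by blast+
  have hBc: "h \<in> Bc G" unfolding h_def by (intro Bc_scale Bc_conv DBc f)
  have Qf: "ascale ?B (1 / c) (Q (embed f)) = embed h"
    by (simp add: Q_def P_def embed_simps f DBc Bc_conv h_def)
  have nP: "anorm ?B P \<le> 1"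
    unfolding P_def embed_simps(6)[OF DBc] nrm_le_iff[OF DBc zero_le_one]
    by (rule op_bound_diagonal) (auto simp: diag_def split: if_splits)
  have "adist ?B P (embed h) = nrm (\<lambda>g. diag D g + - 1 * h g)"
    by (simp only: P_def adist_def embed_simps DBc hBc Bc_add Bc_scale)
  \<comment> \<open>The difference is supported on units, so its norm is controlled by its values
    \<open>(c - f (x, 0, x)) / c\<close>.\<close>
  also have "\<dots> \<le> 1 / 4"
  proof (subst nrm_le_iff)
    show "(\<lambda>g. diag D g + - 1 * h g) \<in> Bc G" by (intro Bc_add Bc_scale DBc hBc)
    have h: "h (x, k, y) = (if x \<in> D \<and> y \<in> D then 1 / c * f (x, k, y) else 0)" for x k y
    proof -
      have "gconv G (diag D) (gconv G f (diag D)) (x, k, y) =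
          (if x \<in> D then gconv G f (diag D) (x, k, y) else 0)"
        by (simp add: gconv_unit_left[OF D(1) Bc_conv[OF f(1) DBc]])
      moreover have "gconv G f (diag D) (x, k, y) = (if y \<in> D then f (x, k, y) else 0)"
        by (simp add: gconv_unit_right[OF D(1) f(1)])
      ultimately show ?thesis by (simp add: h_def)
    qed
    show "op_bound (\<lambda>g. diag D g + - 1 * h g) (1 / 4)"
    proof (rule op_bound_diagonal)
      fix x k y assume "diag D (x, k, y) + - 1 * h (x, k, y) \<noteq> 0"
      then show "k = 0 \<and> x = y" using diag[of x y k] by (auto simp: diag_simp h split: if_splits)
    next
      fix g :: arrow
      obtain x k y where g: "g = (x, k, y)" by (cases g)
      show "cmod (diag D g + - 1 * h g) \<le> 1 / 4"
      proof (cases "x \<in> D \<and> k = 0 \<and> x = y")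
        case True
        then have x: "x \<in> D" and "g = (x, 0, x)" by (auto simp: g)
        then have "diag D g + - 1 * h g = (c - f (x, 0, x)) / c"
          using c by (simp add: diag_simp h diff_divide_distrib)
        then have "cmod (diag D g + - 1 * h g) = cmod (f (x, 0, x) - c) / cmod c"
          by (simp add: norm_divide norm_minus_commute)
        then show ?thesis using near[OF x] c by (simp add: pos_divide_le_eq)
      next
        case False
        then have "diag D g + - 1 * h g = 0"
          using diag[of x y k] by (auto simp: g diag_simp h)
        then show ?thesis by simp
      qed
    qed simp
  qed simp
  finally have 1: "adist ?B P (embed h) \<le> 1 / 4" .
  have "adist ?B (Q (embed f)) (Q Y) \<le> cmod c / 4"
  proof -
    have "adist ?B (atimes ?B (embed f) P) (atimes ?B Y P) \<le> adist ?B (embed f) Y * 1"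
      unfolding adist_def Br.diff_times[OF fB YB P(2)] using nP fB YB
      by (intro order_trans[OF Br.norm_times] mult_left_mono Br.norm_ge_0 P Br.closed_ops) auto
    moreover have "adist ?B (Q (embed f)) (Q Y) \<le> 1 * adist ?B (atimes ?B (embed f) P) (atimes ?B Y P)"
      unfolding Q_def adist_def
        Br.times_diff[OF P(2) Br.times_in[OF fB P(2)] Br.times_in[OF YB P(2)]] using nP fB YB
      by (intro order_trans[OF Br.norm_times] mult_right_mono Br.norm_ge_0 P Br.closed_ops) auto
    ultimately show ?thesis using f(2) Br.dist_commute[OF fB YB] by simp
  qed
  then have Q: "cmod (1 / c) * adist ?B (Q (embed f)) (Q Y) \<le> cmod (1 / c) * (cmod c / 4)"
    by (rule mult_left_mono) simp
  have "adist ?B (embed h) T = cmod (1 / c) * adist ?B (Q (embed f)) (Q Y)"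
    unfolding T_def Qf[symmetric] by (rule Br.dist_scale) (simp_all add: Q_def Br.closed_ops P fB YB)
  also have "\<dots> \<le> cmod (1 / c) * (cmod c / 4)" by (rule Q)
  also have "\<dots> = 1 / 4" using c by (simp add: norm_divide)
  finally have 2: "adist ?B (embed h) T \<le> 1 / 4" .
  have PT: "adist ?B P T < 1"
    using Br.dist_triangle[OF P(2) embed_simps(1)[OF hBc] T(2)] 1 2 by simp
  \<comment> \<open>\<open>P - d = T\<close> lies in the ideal, \<open>P d = d\<close>, and
    \<open>d\<close> has norm below 1, so the geometric argument of \<open>closed_ideal_memI\<close>
    applies.\<close>
  define d where "d = aplus ?B P (ascale ?B (-1) T)"
  show ?thesis unfolding P_def[symmetric]
  proof (rule Br.closed_ideal_memI[OF cr_sub J[unfolded Cr_algebra_eq] cr_ops(4) P(1)])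
    show "d \<in> cr" unfolding d_def by (intro cr_ops P T)
    have PP: "atimes ?B P P = P" by (simp add: P_def embed_simps DBc diag_mult D)
    have "atimes ?B P T = T"
      unfolding T_def Q_def using diag_times_idem[OF D(1) Br.times_in[OF YB P(2)]]
      by (subst Br.times_scale) (auto simp: P_def[symmetric] intro!: Br.closed_ops P YB)
    then show "atimes ?B P d = d"
      unfolding d_def using PP by (simp add: Br.times_plus Br.times_scale Br.closed_ops P T)
    have "aplus ?B P (ascale ?B (-1) d) = aplus ?B P (aplus ?B (ascale ?B (-1) P) T)"
      unfolding d_def by (simp add: Br.scale_plus Br.scale_scale Br.scale_one Br.closed_ops P T)
    also have "\<dots> = T" using P T
      by (simp add: Br.closed_ops Br.plus_minus Br.zero_plus flip: Br.plus_assoc)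
    finally show "aplus ?B P (ascale ?B (-1) d) \<in> J" using TJ by simp
    show "anorm ?B d < 1" using PT by (simp add: adist_def d_def)
  qed
qed

lemma nonzero_ideal_contains_cylinder:
  assumes min: "minimality" and J: "closed_ideal (Cr_algebra G) J" "J \<noteq> {azero Br}"
  obtains p F x where "finite F" "x \<in> cyl p F"
    "embed (diag (cyl p F)) \<in> J"
proof -
  obtain X where X: "X \<in> J" "X \<noteq> azero Br" using J(2) Cr_ideal(2)[OF J(1)] by blast
  have XB: "X \<in> cr" "X \<in> acarrier Br" using X(1) Cr_ideal(1)[OF J(1)] cr_sub by blast+
  obtain x k y where g: "evaluate X (x, k, y) \<noteq> 0" using evaluate_eq_0[OF XB(2)] X(2) by fastforce
  have arr: "(x, k, y) \<in> arrows"
  proof (rule ccontr)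
    assume "(x, k, y) \<notin> arrows"
    obtain f where f: "f \<in> cauchy_seqs (Bc_algebra G)" "X = Bc.cls f"
      using XB(2) unfolding Br_algebra_def by (metis Bc.classE)
    have "f i (x, k, y) = 0" for i
      using Bc.cauchy_seqsD(1)[OF f(1)] \<open>(x, k, y) \<notin> arrows\<close> by (intro Bc_vanish) simp_all
    then have "(\<lambda>_. 0) \<longlonglongrightarrow> evaluate X (x, k, y)"
      using evaluate_lim[OF f(1), of "(x, k, y)"] by (simp add: f(2))
    then show False using g LIMSEQ_unique[OF _ tendsto_const] by blast
  qed
  then have y: "y \<in> S" by (simp add: mem_arrows)
  \<comment> \<open>The non-zero value of \<open>X\<close> may sit at an arrow that is not a unit;
    \<open>Y\<close> has a non-zero value at the unit of its source.\<close>
  define Y where "Y = atimes Br (astar Br X) X"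
  define c where "c = evaluate Y (y, 0, y)"
  have YJ: "Y \<in> J" unfolding Y_def by (intro Cr_ideal(6)[OF J(1)] X cr_ops XB)
  then have YB: "Y \<in> cr" "Y \<in> acarrier Br" using Cr_ideal(1)[OF J(1)] cr_sub by blast+
  have "0 < (cmod (evaluate X (x, k, y)))\<^sup>2" using g by simp
  also have "\<dots> \<le> Re c" unfolding c_def Y_def by (rule evaluate_star_times[OF XB(2) arr])
  finally have c: "c \<noteq> 0" by auto
  \<comment> \<open>One eighth of \<open>cmod c\<close> is spent on approximating \<open>Y\<close>
    and one eighth on the variation of \<open>f\<close> near \<open>y\<close>, together the quarter
    allowed in \<open>diag_in_ideal\<close>.\<close>
  obtain f where f: "f \<in> Bc G" "tame f" "adist Br Y (embed f) < cmod c / 8"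
    by (rule cr_approx[OF YB(1), of "cmod c / 8"]) (use c in auto)
  have "cmod (f (y, 0, y) - c) < cmod c / 8"
    using norm_evaluate_diff_le[OF YB(2) embed_simps(1)[OF f(1)], of "(y, 0, y)"] f(3)
    by (simp add: c_def evaluate_embed[OF f(1)] norm_minus_commute)
  moreover have "\<forall>\<^sub>F w in tail_filter y. dist (f (w, 0, w)) (f (y, 0, y)) < cmod c / 8"
    using tendstoD[OF tameD[OF f(2), of "[]" y "[]" 0], of "cmod c / 8"] y c by simp
  ultimately have ev: "\<forall>\<^sub>F w in tail_filter y. cmod (f (w, 0, w) - c) \<le> cmod c / 4"
  proof (elim eventually_mono)
    fix w assume "cmod (f (y, 0, y) - c) < cmod c / 8" "dist (f (w, 0, w)) (f (y, 0, y)) < cmod c / 8"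
    then show "cmod (f (w, 0, w) - c) \<le> cmod c / 4"
      using norm_triangle_ineq[of "f (w, 0, w) - f (y, 0, y)" "f (y, 0, y) - c"] by (simp add: dist_norm)
  qed
  obtain p F where pF: "finite F" "y \<in> cyl p F"
    "\<And>w. w \<in> cyl p F \<Longrightarrow> cmod (f (w, 0, w) - c) \<le> cmod c / 4"
    by (rule eventually_tailE[OF ev y, of 0]) (rule that)
  obtain N where N: "\<And>g. f g \<noteq> 0 \<Longrightarrow> g \<in> lev N" using f(1) by (rule BcE) blast
  \<comment> \<open>Only coincidences of tails with exponents up to the level \<open>N\<close> of
    \<open>f\<close> can produce unwanted values of \<open>f\<close>, so finitely many points have
    to be avoided.\<close>
  define Per where "Per = (\<Union>b\<le>N. \<Union>a<b. {x \<in> S. suffix a x = suffix b x})"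
  have "finite Per" unfolding Per_def by (intro finite_UN_I finite_atMost finite_lessThan finite_eventually_periodic) auto
  then obtain x1 where x1: "x1 \<in> cyl p F" "x1 \<notin> Per"
    using cyl_infinite[OF min pF(1,2)] by (meson finite_subset subsetI)
  have x1S: "x1 \<in> S" using x1(1) cyl_sub by blast
  have "\<exists>i. x1 (a + i) \<noteq> x1 (b + i)" if "a \<le> N" "b \<le> N" "a \<noteq> b" for a b
  proof (rule ccontr)
    assume "\<nexists>i. x1 (a + i) \<noteq> x1 (b + i)"
    then have "suffix a x1 = suffix b x1" by (simp add: fun_eq_iff)
    then have "suffix (min a b) x1 = suffix (max a b) x1" by (cases "a \<le> b") (simp_all add: min_def max_def)
    then have "x1 \<in> Per" unfolding Per_def using that x1S by (intro UN_I[of "max a b"] UN_I[of "min a b"]) auto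
    then show False using x1(2) by blast
  qed
  then obtain i where i: "\<And>a b. \<lbrakk>a \<le> N; b \<le> N; a \<noteq> b\<rbrakk> \<Longrightarrow> x1 (a + i a b) \<noteq> x1 (b + i a b)" by metis
  \<comment> \<open>The first \<open>M\<close> letters of \<open>x1\<close> witness that its tails
    from any two distinct positions up to \<open>N\<close> differ.\<close>
  define M where "M = Suc N + Max ((\<lambda>(a, b). i a b) ` ({..N} \<times> {..N}))"
  have M: "N + i a b < M" if "a \<le> N" "b \<le> N" for a b
  proof -
    have "i a b \<le> Max ((\<lambda>(a, b). i a b) ` ({..N} \<times> {..N}))" by (rule Max_ge) (use that in force)+
    then show ?thesis by (simp add: M_def)
  qed
  \<comment> \<open>A smaller cylinder around \<open>x1\<close> all of whose points share those
    \<open>M\<close> letters, so that the witnesses apply to each of them.\<close>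
  obtain q H where qH: "finite H" "M \<le> length q" "x1 \<in> cyl q H"
    "\<And>w. w \<in> cyl q H \<Longrightarrow> w \<in> cyl p F"
    by (rule eventually_tailE[OF eventually_cyl[OF pF(1) x1(1)] x1S, of M]) (rule that)
  have agree: "w i = x1 i" if "w \<in> cyl q H" "i < M" for w i
    using that qH(2,3) by (auto simp: generalized_cylinder_def cylinder_def)
  have "embed (diag (cyl q H)) \<in> J"
  proof (rule diag_in_ideal[OF J(1) YJ c f(1)])
    show "adist Br Y (embed f) \<le> cmod c / 4" using f(3) norm_ge_zero[of c] by linarith
    show "cyl q H \<subseteq> S" by (rule cyl_sub)
    show "embed (diag (cyl q H)) \<in> cr" by (rule cyl_in_cr[OF qH(1)])
    show "cmod (f (x, 0, x) - c) \<le> cmod c / 4" if "x \<in> cyl q H" for x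
      by (rule pF(3)[OF qH(4)[OF that]])
  next
    fix z k w
    assume zw: "z \<in> cyl q H" "w \<in> cyl q H" "f (z, k, w) \<noteq> 0"
    obtain a b where ab: "a \<le> N" "b \<le> N" "k = int a - int b" "suffix a z = suffix b w"
      using N[OF zw(3)] by (auto simp: lev_def)
    have "a = b"
    proof (rule ccontr)
      assume "a \<noteq> b"
      define j where "j = i a b"
      have j: "x1 (a + j) \<noteq> x1 (b + j)" "a + j < M" "b + j < M"
        using i[OF ab(1,2) \<open>a \<noteq> b\<close>] M[OF ab(1,2)] ab(1,2) by (auto simp: j_def)
      have "z (a + j) = w (b + j)" using fun_cong[OF ab(4), of j] by simp
      then show False using j agree[OF zw(1)] agree[OF zw(2)] by simp
    qed
    \<comment> \<open>Before position \<open>a\<close> both points have the letters of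
      \<open>x1\<close>; from there on their tails coincide, because the exponents are
      equal.\<close>
    moreover have "z = w"
    proof
      fix j show "z j = w j"
      proof (cases "j < a")
        case True
        then have "j < M" using M[OF ab(1,2)] ab(1) by simp
        then show ?thesis using agree[OF zw(1)] agree[OF zw(2)] by simp
      next
        case False then show ?thesis using fun_cong[OF ab(4), of "j - a"] \<open>a = b\<close> by simp
      qed
    qed
    ultimately show "k = 0 \<and> z = w" using ab(3) by simp
  qed
  then show ?thesis using that qH by blast
qed

lemma simple_if_minimal:
  assumes min: "minimality" shows "simple_cstar_algebra (Cr_algebra G)"
  unfolding simple_cstar_algebra_def
proof (intro conjI allI impI)
  obtain x where x: "x \<in> S" using S_nonempty by blast
  have "evaluate (embed (diag S)) (x, 0, x) \<noteq> evaluate (azero Br) (x, 0, x)"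
    using x by (simp add: evaluate_embed diag_Bc embed_simps Bc_zero diag_simp)
  then have "embed (diag S) \<noteq> azero Br" by auto
  then show "acarrier (Cr_algebra G) \<noteq> {azero (Cr_algebra G)}" using unit_in_cr by (auto simp: Cr_algebra_eq)
next
  fix J assume J: "closed_ideal (Cr_algebra G) J"
  have "J = cr" if ne: "J \<noteq> {azero Br}"
  proof -
    obtain p F x where pF: "finite F" "x \<in> cyl p F"
      "embed (diag (cyl p F)) \<in> J"
      by (rule nonzero_ideal_contains_cylinder[OF min J ne]) blast
    obtain m where m: "\<And>x. x \<in> S \<Longrightarrow> \<exists>y\<in>cyl p F. \<exists>k\<le>m. x = suffix k y"
      by (rule cyl_covers[OF min pF(1,2)]) blast
    have unit: "embed (diag S) \<in> J"
      by (rule unit_in_ideal[OF J cyl_sub pF(3) m])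
    have "X \<in> J" if X: "X \<in> cr" for X
      using Cr_ideal(6)[OF J unit X] by (simp add: times_unit subsetD[OF cr_sub X])
    then show ?thesis using Cr_ideal(1)[OF J] by (intro equalityI subsetI) auto
  qed
  then show "J = {azero (Cr_algebra G)} \<or> J = acarrier (Cr_algebra G)" by (auto simp: Cr_algebra_eq)
qed

section \<open>The ideal attached to a generalized cylinder\<close>

definition saturation :: "(nat \<Rightarrow> nat) set \<Rightarrow> nat \<Rightarrow> (nat \<Rightarrow> nat) set" where
  "saturation C N = {x \<in> S. \<exists>a\<le>N. \<exists>b\<le>N. \<exists>y\<in>C. suffix a x = suffix b y}"

lemma saturation_mono: "N \<le> M \<Longrightarrow> saturation C N \<subseteq> saturation C M"
  unfolding saturation_def using order_trans by blast

lemma saturation_lev: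
  assumes "(x, k, z) \<in> lev N" "z \<in> saturation C M" shows "x \<in> saturation C (N + M)"
proof -
  obtain a b where ab: "a \<le> N" "b \<le> N" "suffix a x = suffix b z" "x \<in> S" using assms(1) by (auto simp: lev_def)
  obtain c d y where cd: "c \<le> M" "d \<le> M" "y \<in> C" "suffix c z = suffix d y" using assms(2) by (auto simp: saturation_def)
  have "suffix (a + c) x = suffix (d + b) y"
    using suffix_eq_mono[OF ab(3), of "a + c" c "b + c"] suffix_eq_mono[OF cd(4), of "c + b" b "d + b"]
    by (simp add: add.commute)
  moreover have "a + c \<le> N + M" "d + b \<le> N + M" using ab cd by auto
  ultimately show ?thesis using ab(4) cd(3) unfolding saturation_def by blast
qed

text \<open>One \<open>N\<close> has to serve the whole support of \<open>f\<close>. This uniformity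
  is the source of the uniform bound on the shifts in the minimality condition.\<close>

definition supported_over :: "(nat \<Rightarrow> nat) set \<Rightarrow> (arrow \<Rightarrow> complex) set" where
  "supported_over C = {f \<in> Bc G. \<exists>N. \<forall>x k y. f (x, k, y) \<noteq> 0 \<longrightarrow> x \<in> saturation C N}"

lemma supported_overI:
  "\<lbrakk>f \<in> Bc G; \<And>x k y. f (x, k, y) \<noteq> 0 \<Longrightarrow> x \<in> saturation C N\<rbrakk> \<Longrightarrow> f \<in> supported_over C"
  unfolding supported_over_def by blast

lemma supported_over_subspace: "linear_subspace (Bc_algebra G) (supported_over C)"
  unfolding linear_subspace_def
proof (intro conjI ballI allI)
  show "supported_over C \<subseteq> acarrier (Bc_algebra G)" by (auto simp: supported_over_def)
  show "azero (Bc_algebra G) \<in> supported_over C" by (simp add: supported_over_def Bc_zero)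
  fix f assume f: "f \<in> supported_over C"
  then obtain N where N: "\<And>x k y. f (x, k, y) \<noteq> 0 \<Longrightarrow> x \<in> saturation C N" "f \<in> Bc G"
    by (auto simp: supported_over_def)
  show "ascale (Bc_algebra G) z f \<in> supported_over C" for z
    using N by (auto simp: supported_over_def Bc_scale intro!: exI[of _ N])
  fix f' assume f': "f' \<in> supported_over C"
  then obtain N' where N': "\<And>x k y. f' (x, k, y) \<noteq> 0 \<Longrightarrow> x \<in> saturation C N'" "f' \<in> Bc G"
    by (auto simp: supported_over_def)
  have sum: "x \<in> saturation C (max N N')" if "f (x, k, y) + f' (x, k, y) \<noteq> 0" for x k y
    using that N(1)[of x k y] N'(1)[of x k y] saturation_mono[of N "max N N'" C] saturation_mono[of N' "max N N'" C]
    by fastforce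
  show "aplus (Bc_algebra G) f f' \<in> supported_over C"
    unfolding Bc_algebra_simps by (rule supported_overI[OF Bc_add[OF N(2) N'(2)] sum])
qed

text \<open>A right factor leaves the range of an arrow in the support of \<open>f\<close>
  unchanged; a left factor in \<open>lev L\<close> moves it and enlarges the exponent by at most
  \<open>L\<close>.\<close>

lemma supported_over_conv:
  assumes f: "f \<in> supported_over C" and f': "f' \<in> Bc G"
  shows "gconv G f f' \<in> supported_over C" "gconv G f' f \<in> supported_over C"
proof -
  obtain N where N: "\<And>x k y. f (x, k, y) \<noteq> 0 \<Longrightarrow> x \<in> saturation C N" and fB: "f \<in> Bc G"
    using f by (auto simp: supported_over_def)
  obtain L M where L: "\<And>g. f g \<noteq> 0 \<Longrightarrow> g \<in> lev L" "\<And>g. f' g \<noteq> 0 \<Longrightarrow> g \<in> lev L" using BcE2[OF fB f'] by metis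
  have 1: "x \<in> saturation C N" if "gconv G f f' (x, k, y) \<noteq> 0" for x k y
    by (rule gconv_support[OF L(1) that]) (auto intro: N)
  show "gconv G f f' \<in> supported_over C" by (rule supported_overI[OF Bc_conv[OF fB f'] 1])
  have 2: "x \<in> saturation C (L + N)" if "gconv G f' f (x, k, y) \<noteq> 0" for x k y
    by (rule gconv_support[OF L(2) that]) (auto intro: saturation_lev[OF L(2) N])
  show "gconv G f' f \<in> supported_over C" by (rule supported_overI[OF Bc_conv[OF f' fB] 2])
qed

text \<open>The functions form an ideal of \<open>B_c\<close> and need not be continuous. Their
  closure is an ideal of the large completion, and only the intersection with \<open>cr\<close>
  brings it into the reduced algebra.\<close>

lemma supported_over_ideal:
  "closed_ideal (Cr_algebra G) (cr \<inter> completion_closure (Bc_algebra G) (supported_over C))"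
proof -
  let ?K = "completion_closure (Bc_algebra G) (supported_over C)"
  note K = Bc.closure_linear_subspace[OF supported_over_subspace, of C, folded Br_algebra_def]
  have sub: "supported_over C \<subseteq> acarrier (Bc_algebra G)" by (auto simp: supported_over_def)
  have closed: "anorm_closed Br ?K" unfolding Br_algebra_def by (rule Bc.closure_closed[OF sub])
  have full: "X \<in> completion_closure (Bc_algebra G) (acarrier (Bc_algebra G))" if "X \<in> cr" for X
    using that cr_sub unfolding Bc.completion_closure_carrier Br_algebra_def by blast
  have times: "atimes Br X Y \<in> ?K" "atimes Br Y X \<in> ?K"
    if X: "X \<in> cr" and Y: "Y \<in> ?K" for X Y
  proof -
    show "atimes Br X Y \<in> ?K" unfolding Br_algebra_def
      by (rule Bc.closure_times[OF _ full[OF X] Y]) (simp add: supported_over_conv)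
    show "atimes Br Y X \<in> ?K" unfolding Br_algebra_def
      by (rule Bc.closure_times[OF _ Y full[OF X]]) (simp add: supported_over_conv)
  qed
  show ?thesis
    unfolding closed_ideal_def
  proof (intro conjI ballI)
    show "linear_subspace (Cr_algebra G) (cr \<inter> ?K)"
      using K unfolding linear_subspace_def by (auto simp: Cr_algebra_eq cr_ops)
    fix X Y assume "X \<in> acarrier (Cr_algebra G)" "Y \<in> cr \<inter> ?K"
    then show "atimes (Cr_algebra G) X Y \<in> cr \<inter> ?K" "atimes (Cr_algebra G) Y X \<in> cr \<inter> ?K"
      using times by (auto simp: Cr_algebra_eq cr_ops)
  next
    show "anorm_closed (Cr_algebra G) (cr \<inter> ?K)"
      using closed cr_sub unfolding anorm_closed_def Cr_algebra_eq adist_def by auto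
  qed
qed

lemma minimal_if_simple:
  assumes simple: "simple_cstar_algebra (Cr_algebra G)" shows minimality
  unfolding minimality_def
proof (intro allI impI, elim conjE)
  fix u F assume F: "finite F" and ne: "cyl u F \<noteq> {}"
  let ?C = "cyl u F"
  let ?J = "cr \<inter> completion_closure (Bc_algebra G) (supported_over ?C)"
  obtain x0 where x0: "x0 \<in> ?C" using ne by blast
  have CBc: "diag ?C \<in> Bc G" by (rule diag_Bc[OF cyl_sub])
  have "diag ?C \<in> supported_over ?C"
    using CBc cyl_sub
    by (auto simp: supported_over_def diag_simp saturation_def intro!: exI[of _ 0])
  then have "embed (diag ?C) \<in> ?J"
    using cyl_in_cr[OF F] by (auto intro!: Bc.embed_in_closure simp: supported_over_def)
  moreover have "evaluate (embed (diag ?C)) (x0, 0, x0) \<noteq> evaluate (azero Br) (x0, 0, x0)"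
    using x0 by (simp add: evaluate_embed CBc embed_simps Bc_zero diag_simp)
  ultimately have "?J \<noteq> {azero Br}" by (metis singletonD)
  then have "?J \<noteq> {azero (Cr_algebra G)}" by (simp add: Cr_algebra_eq)
  moreover have "?J = {azero (Cr_algebra G)} \<or> ?J = acarrier (Cr_algebra G)"
    using simple supported_over_ideal[of ?C] unfolding simple_cstar_algebra_def by blast
  ultimately have "?J = cr" by (simp add: cr_def)
  then have "embed (diag S) \<in> completion_closure (Bc_algebra G) (supported_over ?C)"
    using unit_in_cr by blast
  \<comment> \<open>Distance below 1 from the unit leaves \<open>f\<close> no zero on the unit
    space, so the single \<open>N\<close> belonging to \<open>f\<close> covers all of
    \<open>S\<close>.\<close>
  then obtain f where f: "f \<in> supported_over ?C" "adist Br (embed (diag S)) (embed f) < 1"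
    unfolding Br_algebra_def by (rule Bc.closure_approx[where e = 1]) auto
  obtain N where N: "\<And>x k y. f (x, k, y) \<noteq> 0 \<Longrightarrow> x \<in> saturation ?C N" and fB: "f \<in> Bc G"
    using f(1) by (auto simp: supported_over_def)
  have SBc: "diag S \<in> Bc G" by (rule diag_Bc) simp
  have sat: "x \<in> saturation ?C N" if "x \<in> S" for x
  proof (rule N[of x 0 x], rule notI)
    assume "f (x, 0, x) = 0"
    then show False
      using norm_evaluate_diff_le[OF embed_simps(1)[OF SBc] embed_simps(1)[OF fB], of "(x, 0, x)"] f(2) that
      by (simp add: evaluate_embed SBc fB diag_simp)
  qed
  have "\<exists>y\<in>?C. \<exists>k\<in>{0..2 * N}. \<forall>i. x i = y (i + k)" if x: "x \<in> S" for x
  proof -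
    \<comment> \<open>The relation at a point has an exponent \<open>a \<le> N\<close> on its
      left-hand side. Prepending \<open>N\<close> letters to \<open>x\<close> leaves room to shift
      by a further \<open>N - a\<close>, which removes exactly \<open>q\<close>; the exponent on the
      right becomes \<open>b + (N - a) \<le> 2 * N\<close>.\<close>
    obtain q where q: "length q = N" "q \<frown> x \<in> S" using left_extension[OF x] by blast
    obtain a b y where ab: "a \<le> N" "b \<le> N" "y \<in> ?C" "suffix a (q \<frown> x) = suffix b y"
      using sat[OF q(2)] by (auto simp: saturation_def)
    have "suffix N (q \<frown> x) = suffix (b + (N - a)) y"
      by (rule suffix_eq_mono[OF ab(4), of _ "N - a"]) (use ab in auto)
    then have "x = suffix (b + (N - a)) y" using q(1) by simp
    then have "x i = y (i + (b + (N - a)))" for i by (simp add: add.commute)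
    then show ?thesis using ab by (intro bexI[OF _ ab(3)] bexI[of _ "b + (N - a)"]) auto
  qed
  then show "\<exists>m. \<forall>x\<in>S. \<exists>y\<in>?C. \<exists>k\<in>{0..m}. \<forall>i. x i = y (i + k)" by blast
qed

end

theorem theorem4p20:
  fixes n :: nat and S :: "(nat \<Rightarrow> nat) set"
  assumes "one_sided_subshift n S"
    and "infinite S"
  shows "simple_cstar_algebra (Cr_algebra (subshift_groupoid S)) \<longleftrightarrow>
    (\<forall>u F. u \<in> subshift_words S \<and> finite F \<and> F \<subseteq> subshift_words S \<and>
           (\<forall>v\<in>F. length v = length u) \<and> generalized_cylinder S u F \<noteq> {} \<longrightarrow>
       (\<exists>m::nat. \<forall>x\<in>S. \<exists>y\<in>generalized_cylinder S u F. \<exists>k\<in>{0..m}. \<forall>i. x i = y (i + k)))"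
proof -
  interpret infinite_subshift n S by unfold_locales (use assms in auto)
  show ?thesis using simple_if_minimal minimal_if_simple unfolding minimality_def by blast
qed

end
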